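(* Let $P$ be a poset with underlying set $[n]$ and let $0\le m\le n$. As right $H_m(0)\otimes H_{n-m}(0)$-modules, $$M_P\downarrow_{H_m(0)\otimes H_{n-m}(0)}^{H_n(0)}\ \cong\ \bigoplus_{Q\in\mathsf{LS}(P;m)} M_{\mathrm{st}(Q)}\otimes M_{\mathrm{st}(P\setminus Q)}.$$
   Context: Permutations in $\mathfrak{S}_n$ are composed as functions, $(\sigma\tau)(i)=\sigma(\tau(i))$; $s_i=(i\ i{+}1)$, $\ell$ is the length, and $\mathrm{Des}_R(\gamma)=\{i\in[n-1]:\ell(\gamma s_i)<\ell(\gamma)\}$. The $0$-Hecke algebra $H_n(0)$ is the associative unital $\mathbb{C}$-algebra generated by $\overline{\pi}_1,\dots,\overline{\pi}_{n-1}$ with relations $\overline{\pi}_i^2=-\overline{\pi}_i$, $\overline{\pi}_i\overline{\pi}_{i+1}\overline{\pi}_i=\overline{\pi}_{i+1}\overline{\pi}_i\overline{\pi}_{i+1}$, and $\overline{\pi}_i\overline{\pi}_j=\overline{\pi}_j\overline{\pi}_i$ for $|i-j|\ge 2$. $H_m(0)\otimes H_{n-m}(0)$ is identified with the subalgebra of $H_n(0)$ generated by $\overline{\pi}_i$, $i\in[n-1]\setminus\{m\}$ (with $\overline{\pi}_i\leftrightarrow\overline{\pi}_i\otimes 1$ for $i<m$ and $\overline{\pi}_i\leftrightarrow 1\otimes\overline{\pi}_{i-m}$ for $i>m$). For a partial order $P$ on $[n]=\{1,\dots,n\}$, let $\Sigma_R(P)$ be the set of $\sigma\in\mathfrak{S}_n$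 such that $\sigma^{-1}(i)<\sigma^{-1}(j)$ whenever $i\prec_P j$. The poset module $M_P$ is the right $H_n(0)$-module with $\mathbb{C}$-basis $\Sigma_R(P)$ and action: $\gamma\cdot\overline{\pi}_i=-\gamma$ if $i\in\mathrm{Des}_R(\gamma)$; $0$ if $i\notin\mathrm{Des}_R(\gamma)$ and $\gamma s_i\notin\Sigma_R(P)$; $\gamma s_i$ if $i\notin\mathrm{Des}_R(\gamma)$ and $\gamma s_i\in\Sigma_R(P)$. A lower subposet of $P$ is an induced subposet $Q$ such that $x\in Q$, $y\in P$, $y\preceq_P x$ imply $y\in Q$; $\mathsf{LS}(P;m)$ is the set of lower subposets of $P$ with exactly $m$ elements. $P\setminus Q$ denotes the induced subposet on the complement of $Q$. For an induced subposet $Q=\{k_1<k_2<\cdots<k_m\}$ (indexed in the usual order of integers), $\mathrm{st}(Q)$ is the poset on $[m]$ with $i\preceq_{\mathrm{st}(Q)}j$ if and only if $k_i\preceq_Q k_j$. *)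

theory Defs
  imports
    "HOL-Algebra.Algebraic_Closure_Type"
    "HOL-Algebra.Module"
    "HOL-Algebra.QuotRing"
    "HOL-Library.Poly_Mapping"
    "HOL-Combinatorics.Permutations"
begin

section \<open>Complex algebras and right modules\<close>

text \<open>
  Complex vector spaces are modules over the field \<open>\<complex>\<close> in the sense of
  \<^locale>\<open>module\<close>.  As there, the components \<^const>\<open>mult\<close> and \<^const>\<open>one\<close> of the record
  carry no meaning unless the space is an algebra.
\<close>

abbreviation CC :: "complex ring" where
  "CC \<equiv> ring_of_type_algebra"

locale complex_algebra = module CC A + ring A for A :: "(complex, 'a) module" (structure) +
  assumes smult_mult_left: "\<lbrakk>x \<in> carrier A; y \<in> carrier A\<rbrakk> \<Longrightarrow> (c \<odot> x) \<otimes> y = c \<odot> (x \<otimes> y)"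
    and smult_mult_right: "\<lbrakk>x \<in> carrier A; y \<in> carrier A\<rbrakk> \<Longrightarrow> x \<otimes> (c \<odot> y) = c \<odot> (x \<otimes> y)"

record ('a, 'v) rmodule = "(complex, 'v) module" +
  ract :: "'v \<Rightarrow> 'a \<Rightarrow> 'v"  (infixl \<open>\<cdot>\<index>\<close> 70)

locale right_module = A: complex_algebra A + module CC M
  for A :: "(complex, 'a) module" and M :: "('a, 'v) rmodule" (structure) +
  assumes ract_closed: "\<lbrakk>v \<in> carrier M; a \<in> carrier A\<rbrakk> \<Longrightarrow> v \<cdot> a \<in> carrier M"
    and ract_add_left:
      "\<lbrakk>v \<in> carrier M; w \<in> carrier M; a \<in> carrier A\<rbrakk> \<Longrightarrow> (v \<oplus> w) \<cdot> a = (v \<cdot> a) \<oplus> (w \<cdot> a)"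
    and ract_add_right:
      "\<lbrakk>v \<in> carrier M; a \<in> carrier A; b \<in> carrier A\<rbrakk> \<Longrightarrow> v \<cdot> (a \<oplus>\<^bsub>A\<^esub> b) = (v \<cdot> a) \<oplus> (v \<cdot> b)"
    and ract_smult_left:
      "\<lbrakk>v \<in> carrier M; a \<in> carrier A\<rbrakk> \<Longrightarrow> (c \<odot> v) \<cdot> a = c \<odot> (v \<cdot> a)"
    and ract_smult_right:
      "\<lbrakk>v \<in> carrier M; a \<in> carrier A\<rbrakk> \<Longrightarrow> v \<cdot> (c \<odot>\<^bsub>A\<^esub> a) = c \<odot> (v \<cdot> a)"
    and ract_one: "v \<in> carrier M \<Longrightarrow> v \<cdot> \<one>\<^bsub>A\<^esub> = v"
    and ract_mult:
      "\<lbrakk>v \<in> carrier M; a \<in> carrier A; b \<in> carrier A\<rbrakk> \<Longrightarrow> v \<cdot> (a \<otimes>\<^bsub>A\<^esub> b) = (v \<cdot> a) \<cdot> b"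

definition right_module_iso ::
    "(complex, 'a) module \<Rightarrow> ('a, 'v) rmodule \<Rightarrow> ('a, 'w) rmodule \<Rightarrow> bool" where
  "right_module_iso A M N \<longleftrightarrow> right_module A M \<and> right_module A N \<and>
     (\<exists>\<phi>. bij_betw \<phi> (carrier M) (carrier N) \<and>
        (\<forall>v\<in>carrier M. \<forall>w\<in>carrier M. \<phi> (v \<oplus>\<^bsub>M\<^esub> w) = \<phi> v \<oplus>\<^bsub>N\<^esub> \<phi> w) \<and>
        (\<forall>c. \<forall>v\<in>carrier M. \<phi> (c \<odot>\<^bsub>M\<^esub> v) = c \<odot>\<^bsub>N\<^esub> \<phi> v) \<and>
        (\<forall>v\<in>carrier M. \<forall>a\<in>carrier A. \<phi> (v \<cdot>\<^bsub>M\<^esub> a) = \<phi> v \<cdot>\<^bsub>N\<^esub> a))"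

definition restrict_module :: "('b \<Rightarrow> 'a) \<Rightarrow> ('a, 'v) rmodule \<Rightarrow> ('b, 'v) rmodule" where
  "restrict_module \<iota> M =
     \<lparr>carrier = carrier M, monoid.mult = monoid.mult M, one = one M, zero = zero M, add = add M,
      module.smult = module.smult M, ract = (\<lambda>v b. v \<cdot>\<^bsub>M\<^esub> \<iota> b)\<rparr>"

definition direct_sum_module :: "'i set \<Rightarrow> ('i \<Rightarrow> ('a, 'v) rmodule) \<Rightarrow> ('a, 'i \<Rightarrow> 'v) rmodule" where
  "direct_sum_module I M =
     \<lparr>carrier = {f \<in> \<Pi>\<^sub>E i\<in>I. carrier (M i). finite {i\<in>I. f i \<noteq> \<zero>\<^bsub>M i\<^esub>}},
      monoid.mult = undefined, one = undefined,
      zero = (\<lambda>i\<in>I. \<zero>\<^bsub>M i\<^esub>), add = (\<lambda>f g. \<lambda>i\<in>I. f i \<oplus>\<^bsub>M i\<^esub> g i),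
      module.smult = (\<lambda>c f. \<lambda>i\<in>I. c \<odot>\<^bsub>M i\<^esub> f i), ract = (\<lambda>f a. \<lambda>i\<in>I. f i \<cdot>\<^bsub>M i\<^esub> a)\<rparr>"

section \<open>Free vector spaces, monoid algebras and their quotients\<close>

definition pm_scale :: "complex \<Rightarrow> ('x \<Rightarrow>\<^sub>0 complex) \<Rightarrow> ('x \<Rightarrow>\<^sub>0 complex)" where
  "pm_scale c f = Poly_Mapping.map ((*) c) f"

definition linear_ext :: "('x \<Rightarrow> ('y \<Rightarrow>\<^sub>0 complex)) \<Rightarrow> ('x \<Rightarrow>\<^sub>0 complex) \<Rightarrow> ('y \<Rightarrow>\<^sub>0 complex)" where
  "linear_ext h f = (\<Sum>x\<in>Poly_Mapping.keys f. pm_scale (Poly_Mapping.lookup f x) (h x))"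

definition bilinear_ext ::
    "('x \<Rightarrow> 'y \<Rightarrow> 'z) \<Rightarrow> ('x \<Rightarrow>\<^sub>0 complex) \<Rightarrow> ('y \<Rightarrow>\<^sub>0 complex) \<Rightarrow> ('z \<Rightarrow>\<^sub>0 complex)" where
  "bilinear_ext h f g = (\<Sum>x\<in>Poly_Mapping.keys f. \<Sum>y\<in>Poly_Mapping.keys g.
     Poly_Mapping.single (h x y) (Poly_Mapping.lookup f x * Poly_Mapping.lookup g y))"

definition monoid_algebra :: "('x, 'r) monoid_scheme \<Rightarrow> (complex, 'x \<Rightarrow>\<^sub>0 complex) module" where
  "monoid_algebra G =
     \<lparr>carrier = {f. Poly_Mapping.keys f \<subseteq> carrier G}, monoid.mult = bilinear_ext (monoid.mult G),
      one = Poly_Mapping.single \<one>\<^bsub>G\<^esub> 1, zero = 0, add = (+), module.smult = pm_scale\<rparr>"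

definition quotient_algebra :: "(complex, 'a) module \<Rightarrow> 'a set \<Rightarrow> (complex, 'a set) module" where
  "quotient_algebra A I =
     ring.extend (A Quot I) (module.fields (\<lambda>c S. \<Union>x\<in>S. I +>\<^bsub>A\<^esub> (c \<odot>\<^bsub>A\<^esub> x)))"

section \<open>Tensor products over the complex numbers\<close>

definition bilinear_relations ::
    "(complex, 'v, 'r) module_scheme \<Rightarrow> (complex, 'w, 's) module_scheme \<Rightarrow> ('v \<times> 'w \<Rightarrow>\<^sub>0 complex) set"
  where
  "bilinear_relations V W = (let e = (\<lambda>v w. Poly_Mapping.single (v, w) (1::complex)) in
     {e (v \<oplus>\<^bsub>V\<^esub> v') w - e v w - e v' w |v v' w. v \<in> carrier V \<and> v' \<in> carrier V \<and> w \<in> carrier W} \<union>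
     {e v (w \<oplus>\<^bsub>W\<^esub> w') - e v w - e v w' |v w w'. v \<in> carrier V \<and> w \<in> carrier W \<and> w' \<in> carrier W} \<union>
     {e (c \<odot>\<^bsub>V\<^esub> v) w - pm_scale c (e v w) |c v w. v \<in> carrier V \<and> w \<in> carrier W} \<union>
     {e v (c \<odot>\<^bsub>W\<^esub> w) - pm_scale c (e v w) |c v w. v \<in> carrier V \<and> w \<in> carrier W})"

definition bilinear_span ::
    "(complex, 'v, 'r) module_scheme \<Rightarrow> (complex, 'w, 's) module_scheme \<Rightarrow> ('v \<times> 'w \<Rightarrow>\<^sub>0 complex) set"
  where
  "bilinear_span V W =
     \<Inter>{N. submodule N CC (monoid_algebra (V \<times>\<times> W)) \<and> bilinear_relations V W \<subseteq> N}"

text \<open>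
  The free vector space on \<open>V \<times> W\<close> modulo the bilinearity relations.  If \<open>V\<close> and \<open>W\<close> are
  algebras, the multiplication is \<open>(a \<otimes> b)(a' \<otimes> b') = aa' \<otimes> bb'\<close>.
\<close>

definition tensor ::
    "(complex, 'v, 'r) module_scheme \<Rightarrow> (complex, 'w, 's) module_scheme
      \<Rightarrow> (complex, ('v \<times> 'w \<Rightarrow>\<^sub>0 complex) set) module" where
  "tensor V W = quotient_algebra (monoid_algebra (V \<times>\<times> W)) (bilinear_span V W)"

text \<open>The action of \<open>A \<otimes> B\<close> is \<open>(v \<otimes> w) \<cdot> (a \<otimes> b) = (v \<cdot> a) \<otimes> (w \<cdot> b)\<close>.\<close>

definition tensor_module ::
    "('a, 'v) rmodule \<Rightarrow> ('b, 'w) rmodule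
      \<Rightarrow> (('a \<times> 'b \<Rightarrow>\<^sub>0 complex) set, ('v \<times> 'w \<Rightarrow>\<^sub>0 complex) set) rmodule" where
  "tensor_module M N = module.extend (tensor M N) (rmodule.fields
     (\<lambda>S T. \<Union>f\<in>S. \<Union>g\<in>T. bilinear_span M N +>\<^bsub>monoid_algebra (M \<times>\<times> N)\<^esub>
        bilinear_ext (\<lambda>(v, w) (a, b). (v \<cdot>\<^bsub>M\<^esub> a, w \<cdot>\<^bsub>N\<^esub> b)) f g))"

section \<open>The 0-Hecke algebra\<close>

text \<open>The free algebra on \<open>1, \<dots>, n - 1\<close>: linear combinations of words in these letters.\<close>

definition free_algebra :: "nat \<Rightarrow> (complex, nat list \<Rightarrow>\<^sub>0 complex) module" where
  "free_algebra n = monoid_algebra \<lparr>carrier = lists {1..<n}, monoid.mult = (@), one = []\<rparr>"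

definition hecke_relations :: "nat \<Rightarrow> (nat list \<Rightarrow>\<^sub>0 complex) set" where
  "hecke_relations n = (let word = (\<lambda>w. Poly_Mapping.single w (1::complex)) in
     {word [i, i] + word [i] |i. i \<in> {1..<n}} \<union>
     {word [i, i+1, i] - word [i+1, i, i+1] |i. i \<in> {1..<n} \<and> i+1 \<in> {1..<n}} \<union>
     {word [i, j] - word [j, i] |i j. i \<in> {1..<n} \<and> j \<in> {1..<n} \<and> \<bar>int i - int j\<bar> \<ge> 2})"

definition hecke_ideal :: "nat \<Rightarrow> (nat list \<Rightarrow>\<^sub>0 complex) set" where
  "hecke_ideal n = Idl\<^bsub>free_algebra n\<^esub> (hecke_relations n)"

definition hecke :: "nat \<Rightarrow> (complex, (nat list \<Rightarrow>\<^sub>0 complex) set) module" where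
  "hecke n = quotient_algebra (free_algebra n) (hecke_ideal n)"

definition hecke_gen :: "nat \<Rightarrow> nat \<Rightarrow> (nat list \<Rightarrow>\<^sub>0 complex) set" where
  "hecke_gen n i = hecke_ideal n +>\<^bsub>free_algebra n\<^esub> Poly_Mapping.single [i] 1"

text \<open>
  For \<open>g\<close> satisfying the relations of a 0-Hecke algebra, \<open>hecke_lift A g\<close> is the homomorphism
  from it to \<open>A\<close> sending the \<open>i\<close>-th generator to \<open>g i\<close>; all elements of a coset
  have the same value under \<open>word_eval A g\<close>.
\<close>

definition word_eval :: "(complex, 'a) module \<Rightarrow> (nat \<Rightarrow> 'a) \<Rightarrow> (nat list \<Rightarrow>\<^sub>0 complex) \<Rightarrow> 'a" where
  "word_eval A g f = (\<Oplus>\<^bsub>A\<^esub> w\<in>Poly_Mapping.keys f.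
     Poly_Mapping.lookup f w \<odot>\<^bsub>A\<^esub> foldr (\<lambda>i a. g i \<otimes>\<^bsub>A\<^esub> a) w \<one>\<^bsub>A\<^esub>)"

definition hecke_lift :: "(complex, 'a) module \<Rightarrow> (nat \<Rightarrow> 'a) \<Rightarrow> (nat list \<Rightarrow>\<^sub>0 complex) set \<Rightarrow> 'a" where
  "hecke_lift A g S = the_elem (word_eval A g ` S)"

text \<open>
  The identification of \<open>H\<^sub>m(0) \<otimes> H\<^sub>n\<^sub>-\<^sub>m(0)\<close> with a subalgebra of \<open>H\<^sub>n(0)\<close>: the
  linear map with \<open>a \<otimes> b \<mapsto> \<alpha>(a) \<beta>(b)\<close>, where \<open>\<alpha>\<close> and \<open>\<beta>\<close> are the homomorphisms with
  \<open>\<alpha>(\<pi>\<^sub>i) = \<pi>\<^sub>i\<close> and \<open>\<beta>(\<pi>\<^sub>i) = \<pi>\<^sub>m\<^sub>+\<^sub>i\<close>.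
\<close>

definition hecke_embed ::
    "nat \<Rightarrow> nat \<Rightarrow> ((nat list \<Rightarrow>\<^sub>0 complex) set \<times> (nat list \<Rightarrow>\<^sub>0 complex) set \<Rightarrow>\<^sub>0 complex) set
      \<Rightarrow> (nat list \<Rightarrow>\<^sub>0 complex) set" where
  "hecke_embed n m S = the_elem ((\<lambda>f. \<Oplus>\<^bsub>hecke n\<^esub> p\<in>Poly_Mapping.keys f.
     Poly_Mapping.lookup f p \<odot>\<^bsub>hecke n\<^esub>
       (hecke_lift (hecke n) (hecke_gen n) (fst p) \<otimes>\<^bsub>hecke n\<^esub>
        hecke_lift (hecke n) (\<lambda>i. hecke_gen n (m + i)) (snd p))) ` S)"

section \<open>Permutations and posets\<close>

text \<open>
  Permutations of \<open>[n]\<close> are the functions \<open>\<sigma>\<close> with \<open>\<sigma> permutes {1..n}\<close>, and a poset is the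
  relation \<open>{(i, j). i \<preceq> j}\<close>; by reflexivity its underlying set is its \<^const>\<open>Field\<close>.
\<close>

definition adj_transp :: "nat \<Rightarrow> nat \<Rightarrow> nat" where
  "adj_transp i = Transposition.transpose i (i + 1)"

definition perm_length :: "nat \<Rightarrow> (nat \<Rightarrow> nat) \<Rightarrow> nat" where
  "perm_length n \<sigma> = (LEAST k. \<exists>w. length w = k \<and> set w \<subseteq> {1..<n} \<and>
     \<sigma> = foldr (\<lambda>i \<tau>. adj_transp i \<circ> \<tau>) w id)"

definition right_descents :: "nat \<Rightarrow> (nat \<Rightarrow> nat) \<Rightarrow> nat set" where
  "right_descents n \<gamma> =
     {i \<in> {1..<n}. perm_length n (\<gamma> \<circ> adj_transp i) < perm_length n \<gamma>}"

definition Sigma_R :: "nat \<Rightarrow> nat rel \<Rightarrow> (nat \<Rightarrow> nat) set" where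
  "Sigma_R n P = {\<sigma>. \<sigma> permutes {1..n} \<and>
     (\<forall>i j. (i, j) \<in> P \<and> i \<noteq> j \<longrightarrow> inv_into UNIV \<sigma> i < inv_into UNIV \<sigma> j)}"

definition lower_subposets :: "'a rel \<Rightarrow> nat \<Rightarrow> 'a rel set" where
  "lower_subposets P m = {Restr P D |D. D \<subseteq> Field P \<and> card D = m \<and>
     (\<forall>x y. x \<in> D \<and> (y, x) \<in> P \<longrightarrow> y \<in> D)}"

definition poset_diff :: "'a rel \<Rightarrow> 'a rel \<Rightarrow> 'a rel" where
  "poset_diff P Q = Restr P (Field P - Field Q)"

text \<open>\<open>k i\<close> is the \<open>i\<close>-th smallest element of \<open>Q\<close>, counted from \<open>1\<close>; lists are indexed from \<open>0\<close>.\<close>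

definition standardize :: "nat rel \<Rightarrow> nat rel" where
  "standardize Q = (let k = (\<lambda>i. sorted_list_of_set (Field Q) ! (i - 1)) in
     {(i, j). i \<in> {1..card (Field Q)} \<and> j \<in> {1..card (Field Q)} \<and> (k i, k j) \<in> Q})"

section \<open>Poset modules\<close>

definition gen_act :: "nat \<Rightarrow> nat rel \<Rightarrow> nat \<Rightarrow> (nat \<Rightarrow> nat) \<Rightarrow> ((nat \<Rightarrow> nat) \<Rightarrow>\<^sub>0 complex)" where
  "gen_act n P i \<gamma> =
     (if i \<in> right_descents n \<gamma> then - Poly_Mapping.single \<gamma> 1
      else if \<gamma> \<circ> adj_transp i \<notin> Sigma_R n P then 0
      else Poly_Mapping.single (\<gamma> \<circ> adj_transp i) 1)"

text \<open>
  A word \<open>i\<^sub>1 \<dots> i\<^sub>k\<close> acts by its letters from left to right.  The action of an element of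
  \<open>H\<^sub>n(0)\<close> is that of any linear combination of words representing it.
\<close>

definition word_act ::
    "nat \<Rightarrow> nat rel \<Rightarrow> ((nat \<Rightarrow> nat) \<Rightarrow>\<^sub>0 complex) \<Rightarrow> nat list \<Rightarrow> ((nat \<Rightarrow> nat) \<Rightarrow>\<^sub>0 complex)" where
  "word_act n P v w = foldl (\<lambda>u i. linear_ext (gen_act n P i) u) v w"

definition poset_module ::
    "nat \<Rightarrow> nat rel \<Rightarrow> ((nat list \<Rightarrow>\<^sub>0 complex) set, (nat \<Rightarrow> nat) \<Rightarrow>\<^sub>0 complex) rmodule" where
  "poset_module n P =
     \<lparr>carrier = {v. Poly_Mapping.keys v \<subseteq> Sigma_R n P}, monoid.mult = undefined, one = undefined,
      zero = 0, add = (+), module.smult = pm_scale,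
      ract = (\<lambda>v S. the_elem ((\<lambda>f. linear_ext (word_act n P v) f) ` S))\<rparr>"

end

theory Submission
  imports Defs
begin

text \<open>
  Reading the one-line notation of a linear extension \<open>\<gamma>\<close> of \<open>P\<close> up to position \<open>m\<close> lists a lower
  set \<open>D = \<gamma>({1, \<dots>, m})\<close>, and standardizing the two parts of \<open>\<gamma>\<close> gives linear extensions of
  \<open>st(D)\<close> and \<open>st(P - D)\<close>; conversely any two such linear extensions can be glued.  Since
  \<open>\<pi>\<^sub>i\<close> only compares the values of \<open>\<gamma>\<close> at the positions \<open>i\<close> and \<open>i + 1\<close>, in the order of the
  integers and in \<open>P\<close>, for \<open>i \<noteq> m\<close> it preserves \<open>D\<close> and acts on one of the two parts only.
  Hence \<open>\<gamma> \<mapsto> \<gamma>\<^sub>1 \<otimes> \<gamma>\<^sub>2\<close> extends to the required isomorphism; on the summand of \<open>D\<close> its inverse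
  is the bilinear extension of gluing, which annihilates the bilinearity relations.
\<close>

section \<open>Linear algebra in free vector spaces\<close>

text \<open>Tensor products, the algebra and its embedding are all given by cosets, so every map has
  to be built on representatives. Splitting takes values in the free vector space on pairs of
  vectors; splitting after gluing is the identity only modulo the bilinearity relations, and so is
  the compatibility of splitting with the actions. Two devices keep this manageable. Linear maps
  between free vector spaces are written as \<open>linear_ext\<close> of their values on a basis, so
  identities reduce to basis elements; and quotient structures inherit their laws along surjections
  from free structures, where bilinearity is automatic. The summands are separated by the set
  \<gamma>({1, ..., m}): all lower sets concerned have m elements, so splitting at D annihilates
  whatever was glued at another one. The module laws of the restriction are pulled back from the
  direct sum along the bijection.\<close>

abbreviation basis :: "'x \<Rightarrow> ('x \<Rightarrow>\<^sub>0 complex)" where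
  "basis x \<equiv> Poly_Mapping.single x 1"

lemma lookup_pm_scale [simp]: "Poly_Mapping.lookup (pm_scale c f) x = c * Poly_Mapping.lookup f x"
  by (simp add: pm_scale_def Poly_Mapping.map.rep_eq when_def)

interpretation pm: vector_space pm_scale
  by unfold_locales
    (auto intro!: poly_mapping_eqI simp: lookup_add algebra_simps)

lemma pm_scale_single [simp]: "pm_scale c (Poly_Mapping.single x d) = Poly_Mapping.single x (c * d)"
  by (rule poly_mapping_eqI) (simp add: lookup_single when_def)

lemma keys_pm_scale: "Poly_Mapping.keys (pm_scale c f) \<subseteq> Poly_Mapping.keys f"
  by (auto simp: in_keys_iff)

lemma keys_sum_subset: "Poly_Mapping.keys (\<Sum>i\<in>I. h i) \<subseteq> (\<Union>i\<in>I. Poly_Mapping.keys (h i))"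
proof (induction I rule: infinite_finite_induct)
  case (insert i I)
  then show ?case
    using keys_add[of "h i" "sum h I"] by auto
qed auto

lemma subspace_keys: "pm.subspace {f. Poly_Mapping.keys f \<subseteq> S}"
  using keys_pm_scale by (intro pm.subspaceI) (auto dest!: subsetD[OF keys_add] subsetD[OF keys_pm_scale])

text \<open>Cancellation can make the keys of \<open>f + g\<close> smaller than the union of the
  keys; summing over a common finite superset lets additivity be checked termwise.\<close>

lemma linear_ext_superset:
  assumes "finite S" "Poly_Mapping.keys f \<subseteq> S"
  shows "linear_ext h f = (\<Sum>x\<in>S. pm_scale (Poly_Mapping.lookup f x) (h x))"
  unfolding linear_ext_def
  by (rule sum.mono_neutral_left) (use assms in \<open>auto simp: in_keys_iff\<close>)

lemma linear_ext_add: "linear_ext h (f + g) = linear_ext h f + linear_ext h g"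
proof -
  let ?S = "Poly_Mapping.keys f \<union> Poly_Mapping.keys g"
  have "linear_ext h k = (\<Sum>x\<in>?S. pm_scale (Poly_Mapping.lookup k x) (h x))"
    if "k \<in> {f, g, f + g}" for k
    by (rule linear_ext_superset) (use that keys_add[of f g] in auto)
  then show ?thesis
    by (simp add: lookup_add pm.scale_left_distrib sum.distrib)
qed

lemma linear_ext_scale: "linear_ext h (pm_scale c f) = pm_scale c (linear_ext h f)"
  using linear_ext_superset[OF finite_keys keys_pm_scale, of h c f]
  by (simp add: linear_ext_def pm.scale_sum_right)

lemma linear_ext_zero [simp]: "linear_ext h 0 = 0"
  by (simp add: linear_ext_def)

lemma linear_ext_uminus: "linear_ext h (- f) = - linear_ext h f"
  using linear_ext_scale[of h "-1" f] by simp

lemma linear_ext_diff: "linear_ext h (f - g) = linear_ext h f - linear_ext h g"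
  using linear_ext_add[of h f "- g"] by (simp add: linear_ext_uminus)

lemma linear_ext_single [simp]: "linear_ext h (Poly_Mapping.single x c) = pm_scale c (h x)"
  by (cases "c = 0") (simp_all add: linear_ext_def)

lemma linear_ext_sum: "linear_ext h (\<Sum>i\<in>I. f i) = (\<Sum>i\<in>I. linear_ext h (f i))"
  by (induction I rule: infinite_finite_induct) (simp_all add: linear_ext_add)

lemma linear_ext_fun_diff: "linear_ext (\<lambda>x. h x - k x) f = linear_ext h f - linear_ext k f"
  by (simp add: linear_ext_def pm.scale_right_diff_distrib sum_subtractf)

lemma linear_ext_fun_zero [simp]: "linear_ext (\<lambda>x. 0) f = 0"
  by (simp add: linear_ext_def)

text \<open>The Kleisli law of the free vector space: a composite of linear extensions is again one,
  hence determined by its values on basis elements. Later identities are reduced to generators by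
  this rule and \<open>linear_ext_cong\<close>.\<close>

lemma linear_ext_comp: "linear_ext h (linear_ext k f) = linear_ext (\<lambda>x. linear_ext h (k x)) f"
  by (simp add: linear_ext_def[of k f] linear_ext_def[of "\<lambda>x. linear_ext h (k x)"]
      linear_ext_sum linear_ext_scale)

text \<open>Fubini for finite sums. It yields the two iterated forms of \<open>bilinear_ext\<close>,
  each of which makes linearity in one argument a case of linearity of
  \<open>linear_ext\<close>.\<close>

lemma linear_ext_swap:
  "linear_ext (\<lambda>x. linear_ext (\<lambda>y. h x y) g) f = linear_ext (\<lambda>y. linear_ext (\<lambda>x. h x y) f) g"
  unfolding linear_ext_def pm.scale_sum_right
  by (subst sum.swap) (simp add: mult.commute)

lemma linear_ext_cong:
  "(\<And>x. x \<in> Poly_Mapping.keys f \<Longrightarrow> h x = k x) \<Longrightarrow> linear_ext h f = linear_ext k f"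
  by (simp add: linear_ext_def)

lemma linear_ext_basis [simp]: "linear_ext basis f = f"
  by (rule poly_mapping_eqI)
    (simp add: linear_ext_def lookup_sum lookup_single when_def in_keys_iff)

lemma linear_ext_in_subspace:
  assumes "pm.subspace S" "\<And>x. x \<in> Poly_Mapping.keys f \<Longrightarrow> h x \<in> S"
  shows "linear_ext h f \<in> S"
  unfolding linear_ext_def
  using assms by (intro pm.subspace_sum pm.subspace_scale)

lemma keys_linear_ext:
  "(\<And>x. x \<in> Poly_Mapping.keys f \<Longrightarrow> Poly_Mapping.keys (h x) \<subseteq> S)
    \<Longrightarrow> Poly_Mapping.keys (linear_ext h f) \<subseteq> S"
  using linear_ext_in_subspace[OF subspace_keys, of f h S] by simp

lemma bilinear_ext_conv:
  "bilinear_ext h f g = linear_ext (\<lambda>x. linear_ext (\<lambda>y. basis (h x y)) g) f"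
  by (simp add: bilinear_ext_def linear_ext_def pm.scale_sum_right)

lemma bilinear_ext_conv':
  "bilinear_ext h f g = linear_ext (\<lambda>y. linear_ext (\<lambda>x. basis (h x y)) f) g"
  unfolding bilinear_ext_conv by (rule linear_ext_swap)

lemma bilinear_ext_single [simp]:
  "bilinear_ext h (Poly_Mapping.single x c) (Poly_Mapping.single y d) =
    Poly_Mapping.single (h x y) (c * d)"
  by (simp add: bilinear_ext_conv)

lemma bilinear_ext_add_left: "bilinear_ext h (f + f') g = bilinear_ext h f g + bilinear_ext h f' g"
  by (simp add: bilinear_ext_conv linear_ext_add)

lemma bilinear_ext_add_right: "bilinear_ext h f (g + g') = bilinear_ext h f g + bilinear_ext h f g'"
  by (simp add: bilinear_ext_conv' linear_ext_add)

lemma bilinear_ext_diff_left: "bilinear_ext h (f - f') g = bilinear_ext h f g - bilinear_ext h f' g"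
  by (simp add: bilinear_ext_conv linear_ext_diff)

lemma bilinear_ext_diff_right: "bilinear_ext h f (g - g') = bilinear_ext h f g - bilinear_ext h f g'"
  by (simp add: bilinear_ext_conv' linear_ext_diff)

lemma bilinear_ext_scale_left: "bilinear_ext h (pm_scale c f) g = pm_scale c (bilinear_ext h f g)"
  by (simp add: bilinear_ext_conv linear_ext_scale)

lemma bilinear_ext_scale_right: "bilinear_ext h f (pm_scale c g) = pm_scale c (bilinear_ext h f g)"
  by (simp add: bilinear_ext_conv' linear_ext_scale)

lemma keys_bilinear_ext:
  "(\<And>x y. x \<in> Poly_Mapping.keys f \<Longrightarrow> y \<in> Poly_Mapping.keys g \<Longrightarrow> h x y \<in> S)
    \<Longrightarrow> Poly_Mapping.keys (bilinear_ext h f g) \<subseteq> S"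
  unfolding bilinear_ext_conv by (intro keys_linear_ext) auto

text \<open>Four separate operations are allowed, so that one lemma covers associativity of a monoid
  algebra as well as the law v(ab) = (va)b for an action on pairs.\<close>

lemma bilinear_ext_assoc:
  assumes "\<And>x a b. x \<in> Poly_Mapping.keys f \<Longrightarrow> a \<in> Poly_Mapping.keys g \<Longrightarrow> b \<in> Poly_Mapping.keys k
      \<Longrightarrow> p (q x a) b = r x (s a b)"
  shows "bilinear_ext p (bilinear_ext q f g) k = bilinear_ext r f (bilinear_ext s g k)"
proof -
  have "bilinear_ext p (bilinear_ext q f g) k =
      linear_ext (\<lambda>x. linear_ext (\<lambda>a. linear_ext (\<lambda>b. basis (p (q x a) b)) k) g) f"
    by (simp add: bilinear_ext_conv linear_ext_comp)
  also have "\<dots> = linear_ext (\<lambda>x. linear_ext (\<lambda>a. linear_ext (\<lambda>b. basis (r x (s a b))) k) g) f"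
    by (intro linear_ext_cong) (simp add: assms)
  also have "\<dots> = bilinear_ext r f (bilinear_ext s g k)"
    by (simp add: bilinear_ext_conv linear_ext_comp)
  finally show ?thesis .
qed

lemma bilinear_ext_linear_left:
  "bilinear_ext h (linear_ext g f) w = linear_ext (\<lambda>x. bilinear_ext h (g x) w) f"
  by (simp add: bilinear_ext_conv linear_ext_comp)

lemma bilinear_ext_linear_right:
  "bilinear_ext h v (linear_ext g f) = linear_ext (\<lambda>x. bilinear_ext h v (g x)) f"
  by (simp add: bilinear_ext_conv' linear_ext_comp)

lemma linear_ext_bilinear:
  "linear_ext g (bilinear_ext h v w) = linear_ext (\<lambda>x. linear_ext (\<lambda>y. g (h x y)) w) v"
  by (simp add: bilinear_ext_conv linear_ext_comp)

lemma bilinear_ext_expand: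
  "bilinear_ext h v w = linear_ext (\<lambda>x. bilinear_ext h (basis x) w) v"
  "bilinear_ext h v w = linear_ext (\<lambda>y. bilinear_ext h v (basis y)) w"
  by (simp add: bilinear_ext_conv) (simp add: bilinear_ext_conv')

text \<open>The map is the projection onto the span of the basis elements satisfying
  \<open>C\<close>. Gluing after splitting has this form, and injectivity of the isomorphism is read
  off its coefficients.\<close>

lemma lookup_linear_ext_filter:
  "Poly_Mapping.lookup (linear_ext (\<lambda>x. if C x then basis x else 0) f) y =
    (if C y then Poly_Mapping.lookup f y else 0)"
proof -
  have "Poly_Mapping.lookup (linear_ext (\<lambda>x. if C x then basis x else 0) f) y =
      (\<Sum>x\<in>Poly_Mapping.keys f. if x = y then (if C y then Poly_Mapping.lookup f y else 0) else 0)"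
    unfolding linear_ext_def lookup_sum
    by (rule sum.cong) (auto simp: lookup_single when_def)
  then show ?thesis
    by (auto simp: in_keys_iff)
qed

section \<open>Transfer of algebra and module structures along surjections\<close>

lemma CC_simps [simp]:
  "carrier CC = UNIV" "x \<oplus>\<^bsub>CC\<^esub> y = x + y" "x \<otimes>\<^bsub>CC\<^esub> y = x * y" "\<one>\<^bsub>CC\<^esub> = 1" "\<zero>\<^bsub>CC\<^esub> = 0"
  by (simp_all add: ring_of_type_algebra_def)

lemma cring_CC: "cring CC"
  by (rule cring_from_type_algebra)

lemma CC_moduleI:
  fixes M (structure)
  assumes "abelian_group M"
    and "\<And>c x. x \<in> carrier M \<Longrightarrow> c \<odot> x \<in> carrier M"
    and "\<And>a b x. x \<in> carrier M \<Longrightarrow> (a + b) \<odot> x = a \<odot> x \<oplus> b \<odot> x"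
    and "\<And>a x y. x \<in> carrier M \<Longrightarrow> y \<in> carrier M \<Longrightarrow> a \<odot> (x \<oplus> y) = a \<odot> x \<oplus> a \<odot> y"
    and "\<And>a b x. x \<in> carrier M \<Longrightarrow> (a * b) \<odot> x = a \<odot> (b \<odot> x)"
    and "\<And>x. x \<in> carrier M \<Longrightarrow> 1 \<odot> x = x"
  shows "module CC M"
  by (rule moduleI) (simp_all add: cring_CC assms)

lemma CC_moduleD:
  fixes M (structure)
  assumes "module CC M"
  shows "abelian_group M"
    and "\<And>c x. x \<in> carrier M \<Longrightarrow> c \<odot> x \<in> carrier M"
    and "\<And>a b x. x \<in> carrier M \<Longrightarrow> (a + b) \<odot> x = a \<odot> x \<oplus> b \<odot> x"
    and "\<And>a x y. x \<in> carrier M \<Longrightarrow> y \<in> carrier M \<Longrightarrow> a \<odot> (x \<oplus> y) = a \<odot> x \<oplus> a \<odot> y"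
    and "\<And>a b x. x \<in> carrier M \<Longrightarrow> (a * b) \<odot> x = a \<odot> (b \<odot> x)"
    and "\<And>x. x \<in> carrier M \<Longrightarrow> 1 \<odot> x = x"
    and "\<And>x. x \<in> carrier M \<Longrightarrow> 0 \<odot> x = \<zero>"
    and "\<And>a. a \<odot> \<zero> = \<zero>"
proof -
  interpret module CC M by fact
  show "abelian_group M" by unfold_locales
  show "\<And>c x. x \<in> carrier M \<Longrightarrow> c \<odot> x \<in> carrier M" by simp
  show "\<And>a b x. x \<in> carrier M \<Longrightarrow> (a + b) \<odot> x = a \<odot> x \<oplus> b \<odot> x"
    using smult_l_distr by simp
  show "\<And>a x y. x \<in> carrier M \<Longrightarrow> y \<in> carrier M \<Longrightarrow> a \<odot> (x \<oplus> y) = a \<odot> x \<oplus> a \<odot> y"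
    using smult_r_distr by simp
  show "\<And>a b x. x \<in> carrier M \<Longrightarrow> (a * b) \<odot> x = a \<odot> (b \<odot> x)"
    using smult_assoc1 by simp
  show "\<And>x. x \<in> carrier M \<Longrightarrow> 1 \<odot> x = x"
    using smult_one by simp
  show "\<And>x. x \<in> carrier M \<Longrightarrow> 0 \<odot> x = \<zero>"
    using smult_l_null by simp
  show "\<And>a. a \<odot> \<zero> = \<zero>"
    using smult_r_null by simp
qed

text \<open>Elements of \<open>N\<close> have preimages, and the hypotheses compute in
  \<open>N\<close> through preimages, so each law of \<open>M\<close> passes to \<open>N\<close>.
  Used with \<open>q\<close> a coset map for quotients, and with the identity when only other record
  fields change.\<close>

lemma module_surj:
  fixes M :: "(complex, 'v, 'r) module_scheme" and N :: "(complex, 'w, 's) module_scheme"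
  assumes M: "module CC M"
    and surj: "q ` carrier M = carrier N"
    and zero: "\<zero>\<^bsub>N\<^esub> = q \<zero>\<^bsub>M\<^esub>"
    and add: "\<And>v w. v \<in> carrier M \<Longrightarrow> w \<in> carrier M \<Longrightarrow> q v \<oplus>\<^bsub>N\<^esub> q w = q (v \<oplus>\<^bsub>M\<^esub> w)"
    and smult: "\<And>c v. v \<in> carrier M \<Longrightarrow> c \<odot>\<^bsub>N\<^esub> q v = q (c \<odot>\<^bsub>M\<^esub> v)"
  shows "module CC N"
proof -
  interpret M: module CC M by fact
  note D = CC_moduleD[OF M]
  have *: "\<exists>v\<in>carrier M. x = q v" if "x \<in> carrier N" for x
    using that surj by blast
  have closed: "q v \<in> carrier N" if "v \<in> carrier M" for v
    using that surj by blast
  have "abelian_group N"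
  proof (rule abelian_groupI)
    show "\<exists>y\<in>carrier N. y \<oplus>\<^bsub>N\<^esub> x = \<zero>\<^bsub>N\<^esub>" if "x \<in> carrier N" for x
    proof -
      from * that obtain v where v: "v \<in> carrier M" "x = q v" by blast
      then have "q (\<ominus>\<^bsub>M\<^esub> v) \<oplus>\<^bsub>N\<^esub> x = \<zero>\<^bsub>N\<^esub>"
        by (simp add: add zero M.M.l_neg)
      with v closed show ?thesis by blast
    qed
    show "x \<oplus>\<^bsub>N\<^esub> y \<oplus>\<^bsub>N\<^esub> z = x \<oplus>\<^bsub>N\<^esub> (y \<oplus>\<^bsub>N\<^esub> z)"
      if "x \<in> carrier N" "y \<in> carrier N" "z \<in> carrier N" for x y z
      using that by (auto dest!: * simp: add M.M.a_assoc)
    show "x \<oplus>\<^bsub>N\<^esub> y = y \<oplus>\<^bsub>N\<^esub> x" if "x \<in> carrier N" "y \<in> carrier N" for x y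
      using that by (auto dest!: * simp: add M.M.a_comm)
  qed (auto dest!: * simp: add zero closed)
  then show ?thesis
    by (rule CC_moduleI) (auto dest!: * simp: add smult closed D)
qed

lemma complex_algebraD:
  fixes A (structure)
  assumes "complex_algebra A"
  shows "module CC A" "ring A"
    "\<And>c x y. x \<in> carrier A \<Longrightarrow> y \<in> carrier A \<Longrightarrow> (c \<odot> x) \<otimes> y = c \<odot> (x \<otimes> y)"
    "\<And>c x y. x \<in> carrier A \<Longrightarrow> y \<in> carrier A \<Longrightarrow> x \<otimes> (c \<odot> y) = c \<odot> (x \<otimes> y)"
  using assms unfolding complex_algebra_def complex_algebra_axioms_def by auto

lemma complex_algebra_surj:
  assumes A: "complex_algebra A"
    and surj: "p ` carrier A = carrier B"
    and zero: "\<zero>\<^bsub>B\<^esub> = p \<zero>\<^bsub>A\<^esub>" and one: "\<one>\<^bsub>B\<^esub> = p \<one>\<^bsub>A\<^esub>"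
    and add: "\<And>a b. a \<in> carrier A \<Longrightarrow> b \<in> carrier A \<Longrightarrow> p a \<oplus>\<^bsub>B\<^esub> p b = p (a \<oplus>\<^bsub>A\<^esub> b)"
    and mult: "\<And>a b. a \<in> carrier A \<Longrightarrow> b \<in> carrier A \<Longrightarrow> p a \<otimes>\<^bsub>B\<^esub> p b = p (a \<otimes>\<^bsub>A\<^esub> b)"
    and smult: "\<And>c a. a \<in> carrier A \<Longrightarrow> c \<odot>\<^bsub>B\<^esub> p a = p (c \<odot>\<^bsub>A\<^esub> a)"
  shows "complex_algebra B"
proof -
  interpret A: complex_algebra A by fact
  have B: "module CC B"
    using A.module_axioms surj zero add smult by (rule module_surj)
  then interpret B: module CC B .
  have *: "\<exists>a\<in>carrier A. x = p a" if "x \<in> carrier B" for x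
    using that surj by blast
  have closed: "p a \<in> carrier B" if "a \<in> carrier A" for a
    using that surj by blast
  have "ring B"
  proof (rule ringI)
    show "abelian_group B" by unfold_locales
    show "monoid B"
      by (rule monoidI) (auto dest!: * simp: closed mult one A.m_assoc)
  qed (auto dest!: * simp: closed mult add A.l_distr A.r_distr)
  moreover have "complex_algebra_axioms B"
    by unfold_locales
      (auto dest!: * simp: closed mult smult CC_moduleD(2)[OF complex_algebraD(1)[OF A]]
        A.smult_mult_left A.smult_mult_right)
  ultimately show ?thesis
    using B by (simp add: complex_algebra_def)
qed

text \<open>Algebra and module change together, as the action on a tensor product is defined on
  cosets in both arguments. With \<open>p = id\<close> the lemma transports a module structure along
  a map of modules.\<close>

lemma right_module_surj:
  assumes M: "right_module A M" and B: "complex_algebra B"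
    and p_surj: "p ` carrier A = carrier B"
    and p_one: "\<one>\<^bsub>B\<^esub> = p \<one>\<^bsub>A\<^esub>"
    and p_add: "\<And>a b. a \<in> carrier A \<Longrightarrow> b \<in> carrier A \<Longrightarrow> p a \<oplus>\<^bsub>B\<^esub> p b = p (a \<oplus>\<^bsub>A\<^esub> b)"
    and p_mult: "\<And>a b. a \<in> carrier A \<Longrightarrow> b \<in> carrier A \<Longrightarrow> p a \<otimes>\<^bsub>B\<^esub> p b = p (a \<otimes>\<^bsub>A\<^esub> b)"
    and p_smult: "\<And>c a. a \<in> carrier A \<Longrightarrow> c \<odot>\<^bsub>B\<^esub> p a = p (c \<odot>\<^bsub>A\<^esub> a)"
    and q_surj: "q ` carrier M = carrier N"
    and q_zero: "\<zero>\<^bsub>N\<^esub> = q \<zero>\<^bsub>M\<^esub>"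
    and q_add: "\<And>v w. v \<in> carrier M \<Longrightarrow> w \<in> carrier M \<Longrightarrow> q v \<oplus>\<^bsub>N\<^esub> q w = q (v \<oplus>\<^bsub>M\<^esub> w)"
    and q_smult: "\<And>c v. v \<in> carrier M \<Longrightarrow> c \<odot>\<^bsub>N\<^esub> q v = q (c \<odot>\<^bsub>M\<^esub> v)"
    and act: "\<And>v a. v \<in> carrier M \<Longrightarrow> a \<in> carrier A \<Longrightarrow> q v \<cdot>\<^bsub>N\<^esub> p a = q (v \<cdot>\<^bsub>M\<^esub> a)"
  shows "right_module B N"
proof -
  interpret M: right_module A M by fact
  have N: "module CC N"
    using M.module_axioms q_surj q_zero q_add q_smult by (rule module_surj)
  have *: "\<exists>a\<in>carrier A. x = p a" if "x \<in> carrier B" for x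
    using that p_surj by blast
  have **: "\<exists>v\<in>carrier M. x = q v" if "x \<in> carrier N" for x
    using that q_surj by blast
  have closed: "p a \<in> carrier B" if "a \<in> carrier A" for a
    using that p_surj by blast
  have closed': "q v \<in> carrier N" if "v \<in> carrier M" for v
    using that q_surj by blast
  note D = CC_moduleD(2)[OF M.module_axioms] CC_moduleD(2)[OF complex_algebraD(1)[OF M.A.complex_algebra_axioms]]
  have "right_module_axioms B N"
    by unfold_locales
      (auto dest!: * ** simp: closed closed' p_one p_add p_mult p_smult q_add q_smult act D M.ract_closed
        M.ract_add_left M.ract_add_right M.ract_smult_left M.ract_smult_right M.ract_one M.ract_mult)
  with B N show ?thesis
    by (simp add: right_module_def)
qed

text \<open>The laws of \<open>M\<close> are pulled back from \<open>N\<close> along the inverse of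
  \<phi>. Thus the restricted module gets its laws from the direct sum rather than from
  multiplicativity of \<open>hecke_embed\<close>.\<close>

lemma right_module_isoI:
  assumes N: "right_module A N" and bij: "bij_betw \<phi> (carrier M) (carrier N)"
    and zero: "\<zero>\<^bsub>M\<^esub> \<in> carrier M" "\<phi> \<zero>\<^bsub>M\<^esub> = \<zero>\<^bsub>N\<^esub>"
    and closed: "\<And>v w. v \<in> carrier M \<Longrightarrow> w \<in> carrier M \<Longrightarrow> v \<oplus>\<^bsub>M\<^esub> w \<in> carrier M"
      "\<And>c v. v \<in> carrier M \<Longrightarrow> c \<odot>\<^bsub>M\<^esub> v \<in> carrier M"
      "\<And>v a. v \<in> carrier M \<Longrightarrow> a \<in> carrier A \<Longrightarrow> v \<cdot>\<^bsub>M\<^esub> a \<in> carrier M"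
    and hom: "\<And>v w. v \<in> carrier M \<Longrightarrow> w \<in> carrier M \<Longrightarrow> \<phi> (v \<oplus>\<^bsub>M\<^esub> w) = \<phi> v \<oplus>\<^bsub>N\<^esub> \<phi> w"
      "\<And>c v. v \<in> carrier M \<Longrightarrow> \<phi> (c \<odot>\<^bsub>M\<^esub> v) = c \<odot>\<^bsub>N\<^esub> \<phi> v"
      "\<And>v a. v \<in> carrier M \<Longrightarrow> a \<in> carrier A \<Longrightarrow> \<phi> (v \<cdot>\<^bsub>M\<^esub> a) = \<phi> v \<cdot>\<^bsub>N\<^esub> a"
  shows "right_module_iso A M N"
proof -
  let ?q = "inv_into (carrier M) \<phi>"
  note inj = bij_betw_imp_inj_on[OF bij]
  have q: "?q (\<phi> v) = v" if "v \<in> carrier M" for v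
    using inj that by (rule inv_into_f_f)
  have N_conv: "\<exists>v\<in>carrier M. x = \<phi> v" if "x \<in> carrier N" for x
    using that bij_betw_imp_surj_on[OF bij] by blast
  have A: "complex_algebra A"
    using N by (simp add: right_module_def)
  have "right_module A M"
  proof (rule right_module_surj[OF N A, where p = id and q = ?q])
    show "?q ` carrier N = carrier M"
      using bij_betw_imp_surj_on[OF bij_betw_inv_into[OF bij]] .
    show "\<zero>\<^bsub>M\<^esub> = ?q \<zero>\<^bsub>N\<^esub>"
      using q[OF zero(1)] zero(2) by simp
    show "?q v \<oplus>\<^bsub>M\<^esub> ?q w = ?q (v \<oplus>\<^bsub>N\<^esub> w)" if "v \<in> carrier N" "w \<in> carrier N" for v w
      using that by (auto dest!: N_conv simp: q closed simp flip: hom)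
    show "c \<odot>\<^bsub>M\<^esub> ?q v = ?q (c \<odot>\<^bsub>N\<^esub> v)" if "v \<in> carrier N" for c v
      using that by (auto dest!: N_conv simp: q closed simp flip: hom)
    show "?q v \<cdot>\<^bsub>M\<^esub> id a = ?q (v \<cdot>\<^bsub>N\<^esub> a)" if "v \<in> carrier N" "a \<in> carrier A" for v a
      using that by (auto dest!: N_conv simp: q closed simp flip: hom)
  qed simp_all
  with N bij hom show ?thesis
    unfolding right_module_iso_def by blast
qed

section \<open>Quotients\<close>

text \<open>Agrees with the library coset \<open>I +> f\<close> of a monoid algebra, where the
  addition of the record is the type-class addition, so membership becomes a statement about
  differences.\<close>

definition coset :: "('x \<Rightarrow>\<^sub>0 complex) set \<Rightarrow> ('x \<Rightarrow>\<^sub>0 complex) \<Rightarrow> ('x \<Rightarrow>\<^sub>0 complex) set" where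
  "coset I f = (\<lambda>x. x + f) ` I"

lemma mem_coset_iff: "g \<in> coset I f \<longleftrightarrow> g - f \<in> I"
proof
  assume "g - f \<in> I"
  then have "(g - f) + f \<in> coset I f"
    unfolding coset_def by (rule imageI)
  then show "g \<in> coset I f" by simp
qed (auto simp: coset_def)

lemma coset_eq_iff:
  assumes "pm.subspace I"
  shows "coset I f = coset I g \<longleftrightarrow> f - g \<in> I"
proof
  assume "coset I f = coset I g"
  moreover have "f \<in> coset I f"
    by (simp add: mem_coset_iff pm.subspace_0 assms)
  ultimately show "f - g \<in> I"
    by (simp add: mem_coset_iff)
next
  assume fg: "f - g \<in> I"
  have "h - f \<in> I \<longleftrightarrow> h - g \<in> I" for h
    using pm.subspace_add[OF assms, of "h - f" "f - g"] pm.subspace_diff[OF assms, of "h - g" "f - g"] fg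
    by auto
  then show "coset I f = coset I g"
    by (auto simp: mem_coset_iff)
qed

lemma coset_self: "pm.subspace I \<Longrightarrow> f \<in> coset I f"
  by (simp add: mem_coset_iff pm.subspace_0)

lemma coset_zero: "coset I 0 = I"
  by (simp add: coset_def)

text \<open>The operations on quotients are unions over representatives; if all representatives give
  the same coset, the union is that coset, because the index set contains \<open>f\<close>.\<close>

lemma coset_UN:
  assumes "pm.subspace I" and "\<And>x. x \<in> coset I f \<Longrightarrow> F x = C"
  shows "(\<Union>x\<in>coset I f. F x) = C"
  using assms(2) coset_self[OF assms(1), of f] by auto

lemma monoid_algebra_simps [simp]:
  "carrier (monoid_algebra G) = {f. Poly_Mapping.keys f \<subseteq> carrier G}"
  "x \<oplus>\<^bsub>monoid_algebra G\<^esub> y = x + y"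
  "x \<otimes>\<^bsub>monoid_algebra G\<^esub> y = bilinear_ext (monoid.mult G) x y"
  "\<zero>\<^bsub>monoid_algebra G\<^esub> = 0" "\<one>\<^bsub>monoid_algebra G\<^esub> = basis \<one>\<^bsub>G\<^esub>"
  "c \<odot>\<^bsub>monoid_algebra G\<^esub> x = pm_scale c x"
  by (simp_all add: monoid_algebra_def)

lemma keys_closed:
  "Poly_Mapping.keys f \<subseteq> S \<Longrightarrow> Poly_Mapping.keys g \<subseteq> S \<Longrightarrow> Poly_Mapping.keys (f + g) \<subseteq> S"
  "Poly_Mapping.keys f \<subseteq> S \<Longrightarrow> Poly_Mapping.keys g \<subseteq> S \<Longrightarrow> Poly_Mapping.keys (f - g) \<subseteq> S"
  "Poly_Mapping.keys f \<subseteq> S \<Longrightarrow> Poly_Mapping.keys (- f) \<subseteq> S"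
  "Poly_Mapping.keys f \<subseteq> S \<Longrightarrow> Poly_Mapping.keys (pm_scale c f) \<subseteq> S"
  using pm.subspace_add[OF subspace_keys, of f S g] pm.subspace_diff[OF subspace_keys, of f S g]
    pm.subspace_neg[OF subspace_keys, of f S] pm.subspace_scale[OF subspace_keys, of f S c]
  by simp_all

lemma module_monoid_algebra: "module CC (monoid_algebra G)"
proof (rule CC_moduleI)
  show "abelian_group (monoid_algebra G)"
  proof (rule abelian_groupI)
    show "\<exists>y\<in>carrier (monoid_algebra G). y \<oplus>\<^bsub>monoid_algebra G\<^esub> x = \<zero>\<^bsub>monoid_algebra G\<^esub>"
      if "x \<in> carrier (monoid_algebra G)" for x
      using that by (intro bexI[of _ "- x"]) (simp_all add: keys_closed)
  qed (simp_all add: keys_closed add_ac)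
qed (simp_all add: keys_closed pm.scale_left_distrib pm.scale_right_distrib)

lemma complex_algebra_monoid_algebra:
  assumes "Group.monoid G"
  shows "complex_algebra (monoid_algebra G)"
proof -
  interpret G: Group.monoid G by fact
  interpret M: module CC "monoid_algebra G" by (rule module_monoid_algebra)
  have closed: "Poly_Mapping.keys (bilinear_ext (monoid.mult G) x y) \<subseteq> carrier G"
    if "Poly_Mapping.keys x \<subseteq> carrier G" "Poly_Mapping.keys y \<subseteq> carrier G" for x y
    using that by (intro keys_bilinear_ext) auto
  have one_left: "bilinear_ext (monoid.mult G) (basis \<one>\<^bsub>G\<^esub>) x = x"
    if "Poly_Mapping.keys x \<subseteq> carrier G" for x
  proof -
    have "linear_ext (\<lambda>y. basis (\<one>\<^bsub>G\<^esub> \<otimes>\<^bsub>G\<^esub> y)) x = linear_ext basis x"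
      using that by (intro linear_ext_cong) auto
    then show ?thesis by (simp add: bilinear_ext_conv)
  qed
  have one_right: "bilinear_ext (monoid.mult G) x (basis \<one>\<^bsub>G\<^esub>) = x"
    if "Poly_Mapping.keys x \<subseteq> carrier G" for x
  proof -
    have "linear_ext (\<lambda>y. basis (y \<otimes>\<^bsub>G\<^esub> \<one>\<^bsub>G\<^esub>)) x = linear_ext basis x"
      using that by (intro linear_ext_cong) auto
    then show ?thesis by (simp add: bilinear_ext_conv')
  qed
  have "ring (monoid_algebra G)"
  proof (rule ringI)
    show "abelian_group (monoid_algebra G)" by unfold_locales
    show "Group.monoid (monoid_algebra G)"
    proof (rule monoidI)
      fix x y z
      assume *: "x \<in> carrier (monoid_algebra G)" "y \<in> carrier (monoid_algebra G)"
        "z \<in> carrier (monoid_algebra G)"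
      show "x \<otimes>\<^bsub>monoid_algebra G\<^esub> y \<otimes>\<^bsub>monoid_algebra G\<^esub> z =
          x \<otimes>\<^bsub>monoid_algebra G\<^esub> (y \<otimes>\<^bsub>monoid_algebra G\<^esub> z)"
        using * by (auto intro!: bilinear_ext_assoc G.m_assoc)
    qed (simp_all add: closed one_left one_right)
  qed (simp_all add: bilinear_ext_add_left bilinear_ext_add_right)
  moreover have "complex_algebra_axioms (monoid_algebra G)"
    by unfold_locales (simp_all add: bilinear_ext_scale_left bilinear_ext_scale_right)
  ultimately show ?thesis
    using M.module_axioms by (simp add: complex_algebra_def)
qed

lemma a_r_coset_monoid_algebra [simp]: "I +>\<^bsub>monoid_algebra G\<^esub> f = coset I f"
  by (auto simp: a_r_coset_def r_coset_def coset_def)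

lemma quotient_algebra_simps:
  fixes G (structure)
  shows "carrier (quotient_algebra (monoid_algebra G) I) = coset I ` {f. Poly_Mapping.keys f \<subseteq> carrier G}"
    "\<zero>\<^bsub>quotient_algebra (monoid_algebra G) I\<^esub> = coset I 0"
    "\<one>\<^bsub>quotient_algebra (monoid_algebra G) I\<^esub> = coset I (basis \<one>)"
  by (auto simp: quotient_algebra_def ring.defs module.defs FactRing_def A_RCOSETS_def' coset_zero)

lemma quotient_algebra_add:
  assumes I: "pm.subspace I"
  shows "coset I f \<oplus>\<^bsub>quotient_algebra (monoid_algebra G) I\<^esub> coset I g = coset I (f + g)"
proof -
  have "coset I f \<oplus>\<^bsub>quotient_algebra (monoid_algebra G) I\<^esub> coset I g =
      (\<Union>x\<in>coset I f. \<Union>y\<in>coset I g. {x + y})"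
    by (simp add: quotient_algebra_def ring.defs FactRing_def set_add_def' )
  also have "\<dots> = coset I (f + g)"
  proof safe
    fix x y assume "x \<in> coset I f" "y \<in> coset I g"
    then show "x + y \<in> coset I (f + g)"
      using pm.subspace_add[OF I, of "x - f" "y - g"] by (simp add: mem_coset_iff algebra_simps)
  next
    fix z assume "z \<in> coset I (f + g)"
    then have "z - g \<in> coset I f" by (simp add: mem_coset_iff algebra_simps)
    then show "z \<in> (\<Union>x\<in>coset I f. \<Union>y\<in>coset I g. {x + y})"
      using coset_self[OF I, of g] by (intro UN_I[of "z - g"] UN_I[of g]) auto
  qed
  finally show ?thesis .
qed

lemma quotient_algebra_smult:
  assumes I: "pm.subspace I"
  shows "c \<odot>\<^bsub>quotient_algebra (monoid_algebra G) I\<^esub> coset I f = coset I (pm_scale c f)"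
proof -
  have "c \<odot>\<^bsub>quotient_algebra (monoid_algebra G) I\<^esub> coset I f = (\<Union>x\<in>coset I f. coset I (pm_scale c x))"
    by (simp add: quotient_algebra_def ring.defs module.defs)
  also have "\<dots> = coset I (pm_scale c f)"
    by (rule coset_UN[OF I])
      (auto simp: coset_eq_iff[OF I] mem_coset_iff pm.subspace_scale[OF I]
        simp flip: pm.scale_right_diff_distrib)
  finally show ?thesis .
qed

text \<open>Well-definedness of a bilinear operation on cosets. With \<open>I\<close>,
  \<open>J\<close>, \<open>K\<close> the same ideal it gives multiplication in a quotient algebra;
  with \<open>I = K\<close> and \<open>J\<close> bilinearity spans it gives the action on a tensor
  product.\<close>

lemma coset_UN_bilinear:
  assumes "pm.subspace I" "pm.subspace J" "pm.subspace K"
    and "\<And>x y. x \<in> I \<Longrightarrow> Poly_Mapping.keys y \<subseteq> T \<Longrightarrow> bilinear_ext h x y \<in> K"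
    and "\<And>x y. Poly_Mapping.keys x \<subseteq> S \<Longrightarrow> y \<in> J \<Longrightarrow> bilinear_ext h x y \<in> K"
    and "I \<subseteq> {f. Poly_Mapping.keys f \<subseteq> S}"
    and "Poly_Mapping.keys f \<subseteq> S" "Poly_Mapping.keys g \<subseteq> T"
  shows "(\<Union>x\<in>coset I f. \<Union>y\<in>coset J g. coset K (bilinear_ext h x y)) = coset K (bilinear_ext h f g)"
proof (intro coset_UN assms)
  fix x y assume xy: "x \<in> coset I f" "y \<in> coset J g"
  then have "Poly_Mapping.keys x \<subseteq> S"
    using assms(6,7) keys_closed(1)[of "x - f" S f] by (auto simp: mem_coset_iff)
  \<comment> \<open>The representatives are replaced one at a time: h(x, y) - h(f, g) = h(x - f, g)
    + h(x, y - g). The second term requires the support of \<open>x\<close> to lie in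
    \<open>S\<close>.\<close>
  then have "bilinear_ext h (x - f) g + bilinear_ext h x (y - g) \<in> K"
    using xy assms by (intro pm.subspace_add) (auto simp: mem_coset_iff)
  then show "coset K (bilinear_ext h x y) = coset K (bilinear_ext h f g)"
    by (simp add: coset_eq_iff assms bilinear_ext_diff_left bilinear_ext_diff_right)
qed

text \<open>A ring ideal is an additive subgroup closed under multiplication; closure under scalars
  comes from c x = (c 1) x.\<close>

lemma ideal_subspace:
  assumes "Group.monoid G" "ideal I (monoid_algebra G)"
  shows "pm.subspace I"
proof -
  interpret G: Group.monoid G by fact
  interpret ideal I "monoid_algebra G" by fact
  interpret C: complex_algebra "monoid_algebra G"
    by (rule complex_algebra_monoid_algebra) fact
  show ?thesis
  proof (rule pm.subspaceI)
    show "0 \<in> I" using additive_subgroup.zero_closed[OF additive_subgroup_axioms] by simp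
    show "x + y \<in> I" if "x \<in> I" "y \<in> I" for x y
      using additive_subgroup.a_closed[OF additive_subgroup_axioms that] by simp
    show "pm_scale c x \<in> I" if "x \<in> I" for c x
    proof -
      have x: "x \<in> carrier (monoid_algebra G)"
        using that by (rule a_Hcarr)
      have "pm_scale c (basis \<one>\<^bsub>G\<^esub>) \<otimes>\<^bsub>monoid_algebra G\<^esub> x \<in> I"
        using that by (intro I_l_closed) auto
      moreover have "\<one>\<^bsub>monoid_algebra G\<^esub> \<otimes>\<^bsub>monoid_algebra G\<^esub> x = x"
        using x by (intro Group.monoid.l_one ring.is_monoid complex_algebraD
            complex_algebra_monoid_algebra assms(1))
      ultimately show ?thesis
        unfolding monoid_algebra_simps bilinear_ext_scale_left by simp
    qed
  qed
qed

lemma quotient_algebra_mult: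
  fixes G (structure)
  assumes "Group.monoid G" "ideal I (monoid_algebra G)"
    and "Poly_Mapping.keys f \<subseteq> carrier G" "Poly_Mapping.keys g \<subseteq> carrier G"
  shows "coset I f \<otimes>\<^bsub>quotient_algebra (monoid_algebra G) I\<^esub> coset I g = coset I (bilinear_ext (monoid.mult G) f g)"
proof -
  have sub: "pm.subspace I"
    using assms(1,2) by (rule ideal_subspace)
  have "coset I f \<otimes>\<^bsub>quotient_algebra (monoid_algebra G) I\<^esub> coset I g =
      (\<Union>x\<in>coset I f. \<Union>y\<in>coset I g. coset I (bilinear_ext (monoid.mult G) x y))"
    by (simp add: quotient_algebra_def ring.defs FactRing_def rcoset_mult_def)
  also have "\<dots> = coset I (bilinear_ext (monoid.mult G) f g)"
    using sub sub sub ideal.I_r_closed[OF assms(2)] ideal.I_l_closed[OF assms(2)]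
      additive_subgroup.a_subset[OF ideal.axioms(1)[OF assms(2)]] assms(3,4)
    by (intro coset_UN_bilinear[where S = "carrier G" and T = "carrier G"]) auto
  finally show ?thesis .
qed

lemma module_quotient:
  assumes I: "pm.subspace I"
  shows "module CC (quotient_algebra (monoid_algebra G) I)"
  using module_monoid_algebra
  by (rule module_surj[where q = "coset I" and M = "monoid_algebra G"])
    (simp_all add: quotient_algebra_simps quotient_algebra_add[OF I] quotient_algebra_smult[OF I])

lemma complex_algebra_quotient:
  assumes G: "Group.monoid G" and I: "ideal I (monoid_algebra G)"
  shows "complex_algebra (quotient_algebra (monoid_algebra G) I)"
  using complex_algebra_monoid_algebra[OF G]
  by (rule complex_algebra_surj[where p = "coset I"])
    (simp_all add: quotient_algebra_simps quotient_algebra_add[OF ideal_subspace[OF G I]]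
      quotient_algebra_smult[OF ideal_subspace[OF G I]] quotient_algebra_mult[OF G I])

text \<open>Turns the ring-theoretic sums in \<open>word_eval\<close> and \<open>hecke_embed\<close>
  into the coset of one ordinary sum of representatives.\<close>

lemma finsum_quotient:
  assumes I: "pm.subspace I" and "finite S" "\<And>x. x \<in> S \<Longrightarrow> Poly_Mapping.keys (h x) \<subseteq> carrier G"
  shows "finsum (quotient_algebra (monoid_algebra G) I) (\<lambda>x. coset I (h x)) S = coset I (\<Sum>x\<in>S. h x)"
proof -
  interpret module CC "quotient_algebra (monoid_algebra G) I"
    by (rule module_quotient) fact
  show ?thesis
    using assms(2,3)
  proof (induction S rule: finite_induct)
    case empty
    then show ?case by (simp add: quotient_algebra_simps)
  next
    case (insert x S)
    then have "finsum (quotient_algebra (monoid_algebra G) I) (\<lambda>x. coset I (h x)) (insert x S) =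
        coset I (h x) \<oplus>\<^bsub>quotient_algebra (monoid_algebra G) I\<^esub>
        finsum (quotient_algebra (monoid_algebra G) I) (\<lambda>x. coset I (h x)) S"
      by (intro M.finsum_insert) (auto simp: quotient_algebra_simps)
    with insert show ?case
      by (simp add: quotient_algebra_add[OF I])
  qed
qed

section \<open>Tensor products\<close>

lemma bilinear_relations_subset:
  assumes "module CC V" "module CC W"
  shows "bilinear_relations V W \<subseteq> {f. Poly_Mapping.keys f \<subseteq> carrier V \<times> carrier W}"
proof -
  interpret V: module CC V by fact
  interpret W: module CC W by fact
  note D = CC_moduleD(2)[OF assms(1)] CC_moduleD(2)[OF assms(2)]
  show ?thesis
    unfolding bilinear_relations_def Let_def
    by (intro Un_least subsetI; elim CollectE exE conjE; hypsubst; intro CollectI keys_closed;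
        simp add: D V.M.a_closed W.M.a_closed)
qed

text \<open>Bridges two notions of linear subspace: \<open>bilinear_span\<close> is an intersection
  of library submodules, while spans and their minimality come from the vector space interpretation
  \<open>pm\<close>.\<close>

lemma submodule_monoid_algebra_iff:
  "submodule N CC (monoid_algebra G) \<longleftrightarrow> pm.subspace N \<and> N \<subseteq> {f. Poly_Mapping.keys f \<subseteq> carrier G}"
proof -
  interpret module CC "monoid_algebra G" by (rule module_monoid_algebra)
  show ?thesis
  proof safe
    assume N: "submodule N CC (monoid_algebra G)"
    note E = submoduleE[OF N]
    from E(2) obtain x where "x \<in> N" by blast
    then have "pm_scale 0 x \<in> N"
      using E(4)[of 0 x] by simp
    then show "pm.subspace N"
      using E(4) E(5) by (intro pm.subspaceI) auto
    show "x \<in> carrier G" if "f \<in> N" "x \<in> Poly_Mapping.keys f" for f x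
      using E(1) that by auto
  next
    assume N: "pm.subspace N" "N \<subseteq> {f. Poly_Mapping.keys f \<subseteq> carrier G}"
    have "\<ominus>\<^bsub>monoid_algebra G\<^esub> f = - f" if "f \<in> N" for f
      using that N by (intro M.minus_equality) (auto simp: keys_closed)
    with N show "submodule N CC (monoid_algebra G)"
      by (intro submoduleI) (auto simp: pm.subspace_0 pm.subspace_add pm.subspace_neg pm.subspace_scale)
  qed
qed

lemma bilinear_span_eq_span:
  assumes "module CC V" "module CC W"
  shows "bilinear_span V W = pm.span (bilinear_relations V W)"
proof -
  have "pm.span (bilinear_relations V W) \<subseteq> {f. Poly_Mapping.keys f \<subseteq> carrier V \<times> carrier W}"
    using bilinear_relations_subset[OF assms] subspace_keys by (rule pm.span_minimal)
  then show ?thesis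
    unfolding bilinear_span_def submodule_monoid_algebra_iff
    by (intro equalityI Inter_lower Inter_greatest CollectI conjI pm.subspace_span pm.span_superset)
      (auto intro: pm.span_minimal[THEN subsetD])
qed

lemma
  assumes "module CC V" "module CC W"
  shows subspace_bilinear_span: "pm.subspace (bilinear_span V W)"
    and bilinear_span_subset:
      "bilinear_span V W \<subseteq> {f. Poly_Mapping.keys f \<subseteq> carrier V \<times> carrier W}"
  using pm.span_minimal[OF bilinear_relations_subset[OF assms] subspace_keys]
  by (simp_all add: bilinear_span_eq_span[OF assms])

lemma bilinear_span_relations:
  assumes "module CC V" "module CC W"
  shows "v \<in> carrier V \<Longrightarrow> v' \<in> carrier V \<Longrightarrow> w \<in> carrier W \<Longrightarrow>
      basis (v \<oplus>\<^bsub>V\<^esub> v', w) - basis (v, w) - basis (v', w) \<in> bilinear_span V W"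
    and "v \<in> carrier V \<Longrightarrow> w \<in> carrier W \<Longrightarrow> w' \<in> carrier W \<Longrightarrow>
      basis (v, w \<oplus>\<^bsub>W\<^esub> w') - basis (v, w) - basis (v, w') \<in> bilinear_span V W"
    and "v \<in> carrier V \<Longrightarrow> w \<in> carrier W \<Longrightarrow>
      basis (c \<odot>\<^bsub>V\<^esub> v, w) - pm_scale c (basis (v, w)) \<in> bilinear_span V W"
    and "v \<in> carrier V \<Longrightarrow> w \<in> carrier W \<Longrightarrow>
      basis (v, c \<odot>\<^bsub>W\<^esub> w) - pm_scale c (basis (v, w)) \<in> bilinear_span V W"
  unfolding bilinear_span_eq_span[OF assms] bilinear_relations_def Let_def
  by (rule pm.span_base, rule UnI1, rule UnI1, rule UnI1, rule CollectI, intro exI conjI, rule refl, assumption+)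
    (rule pm.span_base, rule UnI1, rule UnI1, rule UnI2, rule CollectI, intro exI conjI, rule refl, assumption+,
     rule pm.span_base, rule UnI1, rule UnI2, rule CollectI, intro exI conjI, rule refl, assumption+,
     rule pm.span_base, rule UnI2, rule CollectI, intro exI conjI, rule refl, assumption+)

text \<open>The universal property of the tensor product in relative form: a map on pairs that is
  bilinear modulo \<open>K\<close> sends the bilinearity span into \<open>K\<close>. The choices
  \<open>{0}\<close>, a Hecke ideal and a bilinearity span all occur for \<open>K\<close>.\<close>

lemma bilinear_span_linear_ext:
  assumes "module CC V" "module CC W" and K: "pm.subspace K"
    and "\<And>v v' w. v \<in> carrier V \<Longrightarrow> v' \<in> carrier V \<Longrightarrow> w \<in> carrier W \<Longrightarrow>
      h (v \<oplus>\<^bsub>V\<^esub> v', w) - h (v, w) - h (v', w) \<in> K"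
    and "\<And>v w w'. v \<in> carrier V \<Longrightarrow> w \<in> carrier W \<Longrightarrow> w' \<in> carrier W \<Longrightarrow>
      h (v, w \<oplus>\<^bsub>W\<^esub> w') - h (v, w) - h (v, w') \<in> K"
    and "\<And>c v w. v \<in> carrier V \<Longrightarrow> w \<in> carrier W \<Longrightarrow> h (c \<odot>\<^bsub>V\<^esub> v, w) - pm_scale c (h (v, w)) \<in> K"
    and "\<And>c v w. v \<in> carrier V \<Longrightarrow> w \<in> carrier W \<Longrightarrow> h (v, c \<odot>\<^bsub>W\<^esub> w) - pm_scale c (h (v, w)) \<in> K"
    and "f \<in> bilinear_span V W"
  shows "linear_ext h f \<in> K"
proof -
  have sub: "pm.subspace {f. linear_ext h f \<in> K}"
    by (rule pm.subspaceI)
      (auto simp: linear_ext_add linear_ext_scale pm.subspace_0[OF K] pm.subspace_add[OF K]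
        pm.subspace_scale[OF K])
  have "bilinear_relations V W \<subseteq> {f. linear_ext h f \<in> K}"
    using assms(4-7)
    by (auto simp: bilinear_relations_def linear_ext_diff simp del: pm_scale_single
        simp: linear_ext_scale)
  with sub have "pm.span (bilinear_relations V W) \<subseteq> {f. linear_ext h f \<in> K}"
    by (intro pm.span_minimal)
  with assms(8) show ?thesis
    by (auto simp: bilinear_span_eq_span[OF assms(1,2)])
qed

text \<open>Multiplication of an algebra and the action on a module both have this form, so the
  ideal property of \<open>bilinear_span\<close> and the well-definedness of tensor actions share
  their proofs.\<close>

definition biaction ::
    "(complex, 'v, 'r) module_scheme \<Rightarrow> (complex, 'a, 's) module_scheme \<Rightarrow> ('v \<Rightarrow> 'a \<Rightarrow> 'v) \<Rightarrow> bool"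
  where
  "biaction V A \<alpha> \<longleftrightarrow> (\<forall>v\<in>carrier V. \<forall>a\<in>carrier A. \<alpha> v a \<in> carrier V \<and>
     (\<forall>w\<in>carrier V. \<alpha> (v \<oplus>\<^bsub>V\<^esub> w) a = \<alpha> v a \<oplus>\<^bsub>V\<^esub> \<alpha> w a) \<and>
     (\<forall>b\<in>carrier A. \<alpha> v (a \<oplus>\<^bsub>A\<^esub> b) = \<alpha> v a \<oplus>\<^bsub>V\<^esub> \<alpha> v b) \<and>
     (\<forall>c. \<alpha> (c \<odot>\<^bsub>V\<^esub> v) a = c \<odot>\<^bsub>V\<^esub> \<alpha> v a \<and> \<alpha> v (c \<odot>\<^bsub>A\<^esub> a) = c \<odot>\<^bsub>V\<^esub> \<alpha> v a))"

lemma biaction_mult: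
  assumes "complex_algebra A"
  shows "biaction A A (monoid.mult A)"
proof -
  interpret A: complex_algebra A by fact
  show ?thesis
    unfolding biaction_def
    by (auto simp: A.l_distr A.r_distr A.smult_mult_left A.smult_mult_right)
qed

lemma biaction_ract:
  assumes "right_module A M"
  shows "biaction M A (ract M)"
proof -
  interpret right_module A M by fact
  show ?thesis
    unfolding biaction_def
    by (auto simp: ract_closed ract_add_left ract_add_right ract_smult_left ract_smult_right)
qed

abbreviation pair_act :: "('v \<Rightarrow> 'a \<Rightarrow> 'v) \<Rightarrow> ('w \<Rightarrow> 'b \<Rightarrow> 'w) \<Rightarrow> 'v \<times> 'w \<Rightarrow> 'a \<times> 'b \<Rightarrow> 'v \<times> 'w" where
  "pair_act \<alpha> \<beta> \<equiv> \<lambda>(v, w) (a, b). (\<alpha> v a, \<beta> w b)"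

text \<open>By linearity in \<open>g\<close> a single pair (a, b) suffices, and (v, w) \<mapsto>
  (va, wb) is bilinear modulo the span because both actions are linear.\<close>

lemma bilinear_span_act_left:
  assumes V: "module CC V" and W: "module CC W"
    and \<alpha>: "biaction V A \<alpha>" and \<beta>: "biaction W B \<beta>"
    and f: "f \<in> bilinear_span V W" and g: "Poly_Mapping.keys g \<subseteq> carrier A \<times> carrier B"
  shows "bilinear_ext (pair_act \<alpha> \<beta>) f g \<in> bilinear_span V W"
  unfolding bilinear_ext_conv'
proof (rule linear_ext_in_subspace[OF subspace_bilinear_span[OF V W]])
  fix y assume "y \<in> Poly_Mapping.keys g"
  with g obtain a b where [simp]: "y = (a, b)" and ab: "a \<in> carrier A" "b \<in> carrier B" by auto
  note [simp] = \<alpha>[unfolded biaction_def, rule_format, OF _ ab(1)]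
    \<beta>[unfolded biaction_def, rule_format, OF _ ab(2)]
  show "linear_ext (\<lambda>x. basis (pair_act \<alpha> \<beta> x y)) f \<in> bilinear_span V W"
    by (rule bilinear_span_linear_ext[OF V W subspace_bilinear_span[OF V W] _ _ _ _ f])
      (simp_all add: ab bilinear_span_relations[OF V W] del: pm_scale_single)
qed

lemma bilinear_span_act_right:
  assumes V: "module CC V" and W: "module CC W" and A: "module CC A" and B: "module CC B"
    and \<alpha>: "biaction V A \<alpha>" and \<beta>: "biaction W B \<beta>"
    and f: "Poly_Mapping.keys f \<subseteq> carrier V \<times> carrier W" and g: "g \<in> bilinear_span A B"
  shows "bilinear_ext (pair_act \<alpha> \<beta>) f g \<in> bilinear_span V W"
  unfolding bilinear_ext_conv
proof (rule linear_ext_in_subspace[OF subspace_bilinear_span[OF V W]])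
  fix x assume "x \<in> Poly_Mapping.keys f"
  with f obtain v w where [simp]: "x = (v, w)" and vw: "v \<in> carrier V" "w \<in> carrier W" by auto
  note [simp] = \<alpha>[unfolded biaction_def, rule_format, OF vw(1)]
    \<beta>[unfolded biaction_def, rule_format, OF vw(2)]
  show "linear_ext (\<lambda>y. basis (pair_act \<alpha> \<beta> x y)) g \<in> bilinear_span V W"
    by (rule bilinear_span_linear_ext[OF A B subspace_bilinear_span[OF V W] _ _ _ _ g])
      (simp_all add: vw bilinear_span_relations[OF V W] del: pm_scale_single)
qed

lemma ideal_monoid_algebraI:
  assumes G: "Group.monoid G" and J: "pm.subspace J" "J \<subseteq> {f. Poly_Mapping.keys f \<subseteq> carrier G}"
    and l: "\<And>f g. f \<in> J \<Longrightarrow> Poly_Mapping.keys g \<subseteq> carrier G \<Longrightarrow> bilinear_ext (monoid.mult G) g f \<in> J"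
    and r: "\<And>f g. f \<in> J \<Longrightarrow> Poly_Mapping.keys g \<subseteq> carrier G \<Longrightarrow> bilinear_ext (monoid.mult G) f g \<in> J"
  shows "ideal J (monoid_algebra G)"
proof (rule idealI)
  show "ring (monoid_algebra G)"
    by (intro complex_algebraD(2) complex_algebra_monoid_algebra G)
  show "subgroup J (add_monoid (monoid_algebra G))"
    using J by (intro submodule.axioms(1)[where R = CC]) (simp add: submodule_monoid_algebra_iff)
qed (simp_all add: l r)

lemma DirProd_complex_algebra:
  "complex_algebra A \<Longrightarrow> complex_algebra B \<Longrightarrow> Group.monoid (A \<times>\<times> B)"
  by (intro DirProd_monoid ring.is_monoid complex_algebraD(2))

text \<open>Multiplication of pairs is \<open>pair_act\<close> for the two regular actions, so the
  absorption properties are \<open>bilinear_span_act_left\<close> and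
  \<open>bilinear_span_act_right\<close> with \<open>V = A\<close> and \<open>W = B\<close>.\<close>

lemma ideal_bilinear_span:
  assumes A: "complex_algebra A" and B: "complex_algebra B"
  shows "ideal (bilinear_span A B) (monoid_algebra (A \<times>\<times> B))"
proof -
  note A' = complex_algebraD(1)[OF A] and B' = complex_algebraD(1)[OF B]
  note \<alpha> = biaction_mult[OF A] and \<beta> = biaction_mult[OF B]
  have mult: "monoid.mult (A \<times>\<times> B) = pair_act (monoid.mult A) (monoid.mult B)"
    by (simp add: DirProd_def)
  show ?thesis
    using DirProd_complex_algebra[OF A B] subspace_bilinear_span[OF A' B'] bilinear_span_subset[OF A' B']
      bilinear_span_act_right[OF A' B' A' B' \<alpha> \<beta>] bilinear_span_act_left[OF A' B' \<alpha> \<beta>]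
    by (intro ideal_monoid_algebraI) (simp_all add: mult)
qed

lemma complex_algebra_tensor:
  assumes "complex_algebra A" "complex_algebra B"
  shows "complex_algebra (tensor A B)"
  unfolding tensor_def
  by (intro complex_algebra_quotient DirProd_complex_algebra ideal_bilinear_span assms)

lemma tensor_module_simps:
  "carrier (tensor_module M N) = carrier (tensor M N)"
  "\<zero>\<^bsub>tensor_module M N\<^esub> = \<zero>\<^bsub>tensor M N\<^esub>"
  "x \<oplus>\<^bsub>tensor_module M N\<^esub> y = x \<oplus>\<^bsub>tensor M N\<^esub> y"
  "c \<odot>\<^bsub>tensor_module M N\<^esub> x = c \<odot>\<^bsub>tensor M N\<^esub> x"
  by (simp_all add: tensor_module_def module.defs rmodule.defs)

lemma tensor_module_ract:
  assumes M: "right_module A M" and N: "right_module B N"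
    and f: "Poly_Mapping.keys f \<subseteq> carrier M \<times> carrier N"
    and g: "Poly_Mapping.keys g \<subseteq> carrier A \<times> carrier B"
  shows "coset (bilinear_span M N) f \<cdot>\<^bsub>tensor_module M N\<^esub> coset (bilinear_span A B) g =
    coset (bilinear_span M N) (bilinear_ext (pair_act (ract M) (ract N)) f g)"
proof -
  interpret M: right_module A M by fact
  interpret N: right_module B N by fact
  note mods = M.module_axioms N.module_axioms M.A.module_axioms N.A.module_axioms
  have "coset (bilinear_span M N) f \<cdot>\<^bsub>tensor_module M N\<^esub> coset (bilinear_span A B) g =
    (\<Union>x\<in>coset (bilinear_span M N) f. \<Union>y\<in>coset (bilinear_span A B) g.
      coset (bilinear_span M N) (bilinear_ext (pair_act (ract M) (ract N)) x y))"
    by (simp add: tensor_module_def module.defs rmodule.defs)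
  also have "\<dots> = coset (bilinear_span M N) (bilinear_ext (pair_act (ract M) (ract N)) f g)"
    by (intro coset_UN_bilinear[where S = "carrier M \<times> carrier N" and T = "carrier A \<times> carrier B"]
        subspace_bilinear_span bilinear_span_subset bilinear_span_act_left[where A = A and B = B]
        bilinear_span_act_right[where A = A and B = B] biaction_ract M N mods f g)
  finally show ?thesis .
qed

text \<open>The laws are first checked on the free vector space of pairs, where linearity in both
  arguments holds by construction and closure, unit and associativity come from the factors. Passing
  to cosets on both sides is then a case of \<open>right_module_surj\<close>.\<close>

lemma right_module_tensor:
  assumes M: "right_module A M" and N: "right_module B N"
  shows "right_module (tensor A B) (tensor_module M N)"
proof -
  interpret M: right_module A M by fact
  interpret N: right_module B N by fact
  note A = M.A.complex_algebra_axioms and B = N.A.complex_algebra_axioms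
  note mods = M.module_axioms N.module_axioms
  let ?act = "bilinear_ext (pair_act (ract M) (ract N))"
  define F where "F = module.extend (monoid_algebra (M \<times>\<times> N)) (rmodule.fields ?act)"
  have F_simps [simp]: "carrier F = {f. Poly_Mapping.keys f \<subseteq> carrier M \<times> carrier N}"
    "\<zero>\<^bsub>F\<^esub> = 0" "x \<oplus>\<^bsub>F\<^esub> y = x + y" "c \<odot>\<^bsub>F\<^esub> x = pm_scale c x" "x \<cdot>\<^bsub>F\<^esub> a = ?act x a" for x y c a
    by (simp_all add: F_def module.defs rmodule.defs)
  have alg: "complex_algebra (monoid_algebra (A \<times>\<times> B))"
    using A B by (intro complex_algebra_monoid_algebra DirProd_complex_algebra)
  have "module CC F"
    using module_monoid_algebra[of "M \<times>\<times> N"]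
    by (rule module_surj[where q = id]) simp_all
  moreover have "right_module_axioms (monoid_algebra (A \<times>\<times> B)) F"
  proof
    fix x a b
    assume x: "x \<in> carrier F"
    show "x \<cdot>\<^bsub>F\<^esub> \<one>\<^bsub>monoid_algebra (A \<times>\<times> B)\<^esub> = x"
    proof -
      have "linear_ext (\<lambda>y. basis (pair_act (ract M) (ract N) y (\<one>\<^bsub>A\<^esub>, \<one>\<^bsub>B\<^esub>))) x = linear_ext basis x"
        using x by (intro linear_ext_cong) (auto simp: M.ract_one N.ract_one)
      then show ?thesis by (simp add: bilinear_ext_conv' DirProd_def)
    qed
    assume a: "a \<in> carrier (monoid_algebra (A \<times>\<times> B))"
    then show "x \<cdot>\<^bsub>F\<^esub> a \<in> carrier F"
      using x by (auto intro!: keys_bilinear_ext M.ract_closed N.ract_closed)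
    assume b: "b \<in> carrier (monoid_algebra (A \<times>\<times> B))"
    have "?act (?act x a) b = ?act x (bilinear_ext (monoid.mult (A \<times>\<times> B)) a b)"
    proof (rule bilinear_ext_assoc)
      fix y c d
      assume "y \<in> Poly_Mapping.keys x" "c \<in> Poly_Mapping.keys a" "d \<in> Poly_Mapping.keys b"
      with x a b have "y \<in> carrier M \<times> carrier N" "c \<in> carrier A \<times> carrier B" "d \<in> carrier A \<times> carrier B"
        by auto
      then show "pair_act (ract M) (ract N) (pair_act (ract M) (ract N) y c) d =
          pair_act (ract M) (ract N) y (c \<otimes>\<^bsub>A \<times>\<times> B\<^esub> d)"
        by (auto simp: DirProd_def M.ract_mult N.ract_mult)
    qed
    then show "x \<cdot>\<^bsub>F\<^esub> (a \<otimes>\<^bsub>monoid_algebra (A \<times>\<times> B)\<^esub> b) = x \<cdot>\<^bsub>F\<^esub> a \<cdot>\<^bsub>F\<^esub> b"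
      by simp
  qed (simp_all add: bilinear_ext_add_left bilinear_ext_add_right bilinear_ext_scale_left
      bilinear_ext_scale_right)
  ultimately have "right_module (monoid_algebra (A \<times>\<times> B)) F"
    using alg by (simp add: right_module_def)
  moreover note complex_algebra_tensor[OF A B]
  moreover have ideal: "ideal (bilinear_span A B) (monoid_algebra (A \<times>\<times> B))"
    using A B by (rule ideal_bilinear_span)
  note sub = ideal_subspace[OF DirProd_complex_algebra[OF A B] ideal]
  note sub' = subspace_bilinear_span[OF mods]
  note simps = tensor_module_simps tensor_def quotient_algebra_simps
    quotient_algebra_add[OF sub] quotient_algebra_smult[OF sub]
    quotient_algebra_mult[OF DirProd_complex_algebra[OF A B] ideal]
    quotient_algebra_add[OF sub'] quotient_algebra_smult[OF sub']
  show ?thesis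
    by (rule right_module_surj[OF calculation,
          where p = "coset (bilinear_span A B)" and q = "coset (bilinear_span M N)"])
      (simp_all add: simps tensor_module_ract[OF M N])
qed

section \<open>Direct sums\<close>

lemma direct_sum_module_simps:
  "carrier (direct_sum_module I M) = {f \<in> \<Pi>\<^sub>E i\<in>I. carrier (M i). finite {i\<in>I. f i \<noteq> \<zero>\<^bsub>M i\<^esub>}}"
  "\<zero>\<^bsub>direct_sum_module I M\<^esub> = (\<lambda>i\<in>I. \<zero>\<^bsub>M i\<^esub>)"
  "f \<oplus>\<^bsub>direct_sum_module I M\<^esub> g = (\<lambda>i\<in>I. f i \<oplus>\<^bsub>M i\<^esub> g i)"
  "c \<odot>\<^bsub>direct_sum_module I M\<^esub> f = (\<lambda>i\<in>I. c \<odot>\<^bsub>M i\<^esub> f i)"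
  "f \<cdot>\<^bsub>direct_sum_module I M\<^esub> a = (\<lambda>i\<in>I. f i \<cdot>\<^bsub>M i\<^esub> a)"
  by (simp_all add: direct_sum_module_def)

lemma right_module_zero_ract:
  assumes "right_module A M" "a \<in> carrier A"
  shows "\<zero>\<^bsub>M\<^esub> \<cdot>\<^bsub>M\<^esub> a = \<zero>\<^bsub>M\<^esub>"
proof -
  interpret right_module A M by fact
  have "\<zero>\<^bsub>M\<^esub> \<cdot>\<^bsub>M\<^esub> a = (0 \<odot>\<^bsub>M\<^esub> \<zero>\<^bsub>M\<^esub>) \<cdot>\<^bsub>M\<^esub> a"
    by (simp add: CC_moduleD[OF module_axioms])
  also have "\<dots> = 0 \<odot>\<^bsub>M\<^esub> (\<zero>\<^bsub>M\<^esub> \<cdot>\<^bsub>M\<^esub> a)"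
    using assms(2) by (intro ract_smult_left) simp
  also have "\<dots> = \<zero>\<^bsub>M\<^esub>"
    using assms(2) by (simp add: CC_moduleD[OF module_axioms] ract_closed)
  finally show ?thesis .
qed

lemma right_module_direct_sum:
  assumes A: "complex_algebra A" and M: "\<And>i. i \<in> I \<Longrightarrow> right_module A (M i)"
  shows "right_module A (direct_sum_module I M)"
proof -
  let ?D = "direct_sum_module I M"
  have mod: "module CC (M i)" if "i \<in> I" for i
    using M[OF that] by (simp add: right_module_def)
  have grp: "abelian_group (M i)" if "i \<in> I" for i
    using mod[OF that] by (rule CC_moduleD)
  note D = CC_moduleD(2-)[OF mod]
  \<comment> \<open>Finite support is verified by naming any finite set outside which the family
    vanishes, such as the union of two supports for a sum.\<close>
  have memI: "restrict f I \<in> carrier ?D"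
    if "\<And>i. i \<in> I \<Longrightarrow> f i \<in> carrier (M i)" and "finite S"
      "\<And>i. i \<in> I \<Longrightarrow> i \<notin> S \<Longrightarrow> f i = \<zero>\<^bsub>M i\<^esub>" for f S
  proof -
    have "{i \<in> I. restrict f I i \<noteq> \<zero>\<^bsub>M i\<^esub>} \<subseteq> S" using that(3) by auto
    with that show ?thesis
      by (auto simp: direct_sum_module_simps intro: finite_subset)
  qed
  have carr: "f i \<in> carrier (M i)" if "f \<in> carrier ?D" "i \<in> I" for f i
    using that by (auto simp: direct_sum_module_simps)
  have fin: "finite {i \<in> I. f i \<noteq> \<zero>\<^bsub>M i\<^esub>}" if "f \<in> carrier ?D" for f
    using that by (auto simp: direct_sum_module_simps)
  have eqI: "restrict f I = restrict g I" if "\<And>i. i \<in> I \<Longrightarrow> f i = g i" for f g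
    using that by (auto simp: restrict_def)
  have restr: "restrict f I = f" if "f \<in> carrier ?D" for f
    using that by (auto simp: direct_sum_module_simps)
  note grp_rules = abelian_group.axioms(1)[THEN abelian_monoid.a_closed, OF grp]
    abelian_group.axioms(1)[THEN abelian_monoid.zero_closed, OF grp]
    abelian_group.axioms(1)[THEN abelian_monoid.l_zero, OF grp]
    abelian_group.axioms(1)[THEN abelian_monoid.a_assoc, OF grp]
  have add_mem: "f \<oplus>\<^bsub>?D\<^esub> g \<in> carrier ?D" if "f \<in> carrier ?D" "g \<in> carrier ?D" for f g
    unfolding direct_sum_module_simps(3)
    using that fin[OF that(1)] fin[OF that(2)]
    by (intro memI[where S = "{i \<in> I. f i \<noteq> \<zero>\<^bsub>M i\<^esub>} \<union> {i \<in> I. g i \<noteq> \<zero>\<^bsub>M i\<^esub>}"])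
      (auto simp: grp_rules carr)
  have smult_mem: "c \<odot>\<^bsub>?D\<^esub> f \<in> carrier ?D" if "f \<in> carrier ?D" for c f
    unfolding direct_sum_module_simps(4)
    using that fin[OF that] by (intro memI) (auto simp: D carr)
  have "abelian_group ?D"
  proof (rule abelian_groupI)
    show "\<zero>\<^bsub>?D\<^esub> \<in> carrier ?D"
      unfolding direct_sum_module_simps(2) by (rule memI[of _ "{}"]) (auto simp: grp_rules)
    show "\<zero>\<^bsub>?D\<^esub> \<oplus>\<^bsub>?D\<^esub> f = f" if f: "f \<in> carrier ?D" for f
    proof -
      have "\<zero>\<^bsub>?D\<^esub> \<oplus>\<^bsub>?D\<^esub> f = restrict f I"
        unfolding direct_sum_module_simps by (rule eqI) (simp add: grp_rules carr[OF f])
      with f show ?thesis by (simp add: restr)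
    qed
    show "f \<oplus>\<^bsub>?D\<^esub> g = g \<oplus>\<^bsub>?D\<^esub> f" if "f \<in> carrier ?D" "g \<in> carrier ?D" for f g
      unfolding direct_sum_module_simps
      using abelian_group.axioms(1)[THEN abelian_monoid.a_comm, OF grp] that
      by (auto intro!: eqI simp: carr)
    show "\<exists>g\<in>carrier ?D. g \<oplus>\<^bsub>?D\<^esub> f = \<zero>\<^bsub>?D\<^esub>" if f: "f \<in> carrier ?D" for f
    proof (intro bexI)
      show "(-1) \<odot>\<^bsub>?D\<^esub> f \<in> carrier ?D" using f by (rule smult_mem)
      have "(-1) \<odot>\<^bsub>M i\<^esub> f i \<oplus>\<^bsub>M i\<^esub> f i = \<zero>\<^bsub>M i\<^esub>" if "i \<in> I" for i
        using D(2)[OF that carr[OF f that], of "-1" 1] D(5)[OF that carr[OF f that]]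
          D(6)[OF that carr[OF f that]] by simp
      then show "(-1) \<odot>\<^bsub>?D\<^esub> f \<oplus>\<^bsub>?D\<^esub> f = \<zero>\<^bsub>?D\<^esub>"
        unfolding direct_sum_module_simps by (intro eqI) simp
    qed
  qed (rule add_mem, assumption, assumption, auto intro!: eqI simp: direct_sum_module_simps(3) grp_rules carr)
  then have "module CC ?D"
  proof (rule CC_moduleI)
    show "1 \<odot>\<^bsub>?D\<^esub> f = f" if f: "f \<in> carrier ?D" for f
    proof -
      have "1 \<odot>\<^bsub>?D\<^esub> f = restrict f I"
        unfolding direct_sum_module_simps by (rule eqI) (simp add: D carr[OF f])
      with f show ?thesis by (simp add: restr)
    qed
  qed (rule smult_mem, assumption, auto intro!: eqI simp: direct_sum_module_simps(3,4) D carr)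
  moreover have "right_module_axioms A ?D"
  proof
    fix f a b
    assume f: "f \<in> carrier ?D"
    note R = M[unfolded right_module_def right_module_axioms_def]
    show "f \<cdot>\<^bsub>?D\<^esub> \<one>\<^bsub>A\<^esub> = f"
    proof -
      have "f \<cdot>\<^bsub>?D\<^esub> \<one>\<^bsub>A\<^esub> = restrict f I"
        unfolding direct_sum_module_simps using R by (intro eqI) (simp add: carr[OF f])
      with f show ?thesis by (simp add: restr)
    qed
    assume a: "a \<in> carrier A"
    show "f \<cdot>\<^bsub>?D\<^esub> a \<in> carrier ?D"
      unfolding direct_sum_module_simps(5)
      using R a f fin[OF f] by (intro memI) (auto simp: carr right_module_zero_ract[OF M])
    show "c \<odot>\<^bsub>?D\<^esub> f \<cdot>\<^bsub>?D\<^esub> a = c \<odot>\<^bsub>?D\<^esub> (f \<cdot>\<^bsub>?D\<^esub> a)" "f \<cdot>\<^bsub>?D\<^esub> (c \<odot>\<^bsub>A\<^esub> a) = c \<odot>\<^bsub>?D\<^esub> (f \<cdot>\<^bsub>?D\<^esub> a)" for c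
      unfolding direct_sum_module_simps(4,5) using R a f by (auto intro!: eqI simp: carr)
    show "(f \<oplus>\<^bsub>?D\<^esub> g) \<cdot>\<^bsub>?D\<^esub> a = f \<cdot>\<^bsub>?D\<^esub> a \<oplus>\<^bsub>?D\<^esub> g \<cdot>\<^bsub>?D\<^esub> a" if "g \<in> carrier ?D" for g
      unfolding direct_sum_module_simps(3,5) using R a f that by (auto intro!: eqI simp: carr)
    assume b: "b \<in> carrier A"
    show "f \<cdot>\<^bsub>?D\<^esub> (a \<oplus>\<^bsub>A\<^esub> b) = f \<cdot>\<^bsub>?D\<^esub> a \<oplus>\<^bsub>?D\<^esub> f \<cdot>\<^bsub>?D\<^esub> b"
      unfolding direct_sum_module_simps(3,5) using R a b f by (auto intro!: eqI simp: carr)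
    show "f \<cdot>\<^bsub>?D\<^esub> (a \<otimes>\<^bsub>A\<^esub> b) = f \<cdot>\<^bsub>?D\<^esub> a \<cdot>\<^bsub>?D\<^esub> b"
      unfolding direct_sum_module_simps(5) using R a b f by (auto intro!: eqI simp: carr)
  qed
  ultimately show ?thesis
    using A by (simp add: right_module_def)
qed

section \<open>Length and descents of permutations\<close>

lemma adj_transp_simps [simp]:
  "adj_transp i i = Suc i" "adj_transp i (Suc i) = i"
  "j \<noteq> i \<Longrightarrow> j \<noteq> Suc i \<Longrightarrow> adj_transp i j = j"
  by (simp_all add: adj_transp_def transpose_def)

lemma adj_transp_involutory [simp]: "adj_transp i (adj_transp i j) = j"
  by (simp add: adj_transp_def)

lemma adj_transp_comp_self [simp]: "adj_transp i \<circ> adj_transp i = id"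
  by (simp add: fun_eq_iff)

lemma adj_transp_eq_iff [simp]: "adj_transp i a = adj_transp i b \<longleftrightarrow> a = b"
  by (metis adj_transp_involutory)

lemma adj_transp_permutes: "i \<in> {1..<n} \<Longrightarrow> adj_transp i permutes {1..n}"
  unfolding adj_transp_def by (rule permutes_swap_id) auto

text \<open>An adjacent transposition reverses the order of one pair only. Both the count of
  inversions and the stability of linear extensions under swaps rest on this.\<close>

lemma adj_transp_less: "a < b \<Longrightarrow> (a, b) \<noteq> (i, Suc i) \<Longrightarrow> adj_transp i a < adj_transp i b"
  by (auto simp: adj_transp_def transpose_def)

definition inversions :: "nat \<Rightarrow> (nat \<Rightarrow> nat) \<Rightarrow> (nat \<times> nat) set" where
  "inversions n \<sigma> = {(a, b) \<in> {1..n} \<times> {1..n}. a < b \<and> \<sigma> b < \<sigma> a}"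

lemma finite_inversions: "finite (inversions n \<sigma>)"
  by (rule finite_subset[of _ "{1..n} \<times> {1..n}"]) (auto simp: inversions_def)

text \<open>Apart from the new pair (i, i + 1), the inversions of \<sigma> s_i are those of \<sigma>
  with both positions moved by s_i; they stay increasing pairs because (i, i + 1) is not an
  inversion of \<sigma>.\<close>

lemma card_inversions_ascent:
  assumes i: "i \<in> {1..<n}" and asc: "\<sigma> i < \<sigma> (Suc i)"
  shows "card (inversions n (\<sigma> \<circ> adj_transp i)) = Suc (card (inversions n \<sigma>))"
proof -
  let ?s = "adj_transp i"
  let ?f = "map_prod ?s ?s"
  have s: "?s x \<in> {1..n} \<longleftrightarrow> x \<in> {1..n}" for x
    using permutes_in_image[OF adj_transp_permutes[OF i]] .
  have "inversions n (\<sigma> \<circ> ?s) = insert (i, Suc i) (?f ` inversions n \<sigma>)"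
  proof (intro equalityI subsetI)
    fix p assume p: "p \<in> inversions n (\<sigma> \<circ> ?s)"
    obtain a b where ab: "p = (a, b)" by fastforce
    show "p \<in> insert (i, Suc i) (?f ` inversions n \<sigma>)"
    proof (cases "(a, b) = (i, Suc i)")
      case False
      then have "(?s a, ?s b) \<in> inversions n \<sigma>"
        using p ab adj_transp_less[of a b i] by (auto simp: inversions_def simp del: atLeastAtMost_iff One_nat_def simp: s)
      then have "?f (?s a, ?s b) \<in> ?f ` inversions n \<sigma>" by (rule imageI)
      with ab show ?thesis by simp
    qed (simp add: ab)
  next
    fix p assume "p \<in> insert (i, Suc i) (?f ` inversions n \<sigma>)"
    then show "p \<in> inversions n (\<sigma> \<circ> ?s)"
    proof
      assume "p = (i, Suc i)"
      with i asc show ?thesis by (auto simp: inversions_def)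
    next
      assume "p \<in> ?f ` inversions n \<sigma>"
      then obtain a b where "p = (?s a, ?s b)" "(a, b) \<in> inversions n \<sigma>" by auto
      moreover from this(2) asc have "(a, b) \<noteq> (i, Suc i)" "a < b"
        by (auto simp: inversions_def)
      ultimately show ?thesis
        using adj_transp_less[of a b i]
        by (auto simp: inversions_def simp del: atLeastAtMost_iff One_nat_def simp: s)
    qed
  qed
  moreover have "(i, Suc i) \<notin> ?f ` inversions n \<sigma>"
  proof
    assume "(i, Suc i) \<in> ?f ` inversions n \<sigma>"
    then obtain a b where ab: "i = ?s a" "Suc i = ?s b" "a < b"
      by (auto simp: inversions_def)
    have "a = ?s (?s a)" "b = ?s (?s b)" by simp_all
    then have "a = Suc i" "b = i"
      unfolding ab(1,2)[symmetric] by simp_all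
    with ab(3) show False by simp
  qed
  moreover have "inj_on ?f (inversions n \<sigma>)"
    by (auto simp: inj_on_def)
  ultimately show ?thesis
    using finite_inversions[of n \<sigma>] by (simp add: card_image)
qed

lemma card_inversions_descent:
  assumes i: "i \<in> {1..<n}" and desc: "\<sigma> (Suc i) < \<sigma> i"
  shows "card (inversions n \<sigma>) = Suc (card (inversions n (\<sigma> \<circ> adj_transp i)))"
  using card_inversions_ascent[OF i, of "\<sigma> \<circ> adj_transp i"] desc by (simp add: o_assoc[symmetric])

definition word_perm :: "nat list \<Rightarrow> nat \<Rightarrow> nat" where
  "word_perm w = foldr (\<lambda>i \<tau>. adj_transp i \<circ> \<tau>) w id"

lemma word_perm_simps [simp]: "word_perm [] = id" "word_perm (i # w) = adj_transp i \<circ> word_perm w"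
  by (simp_all add: word_perm_def)

lemma word_perm_append: "word_perm (w @ [i]) = word_perm w \<circ> adj_transp i"
  by (induction w) (simp_all add: o_assoc)

lemma word_perm_permutes: "set w \<subseteq> {1..<n} \<Longrightarrow> word_perm w permutes {1..n}"
proof (induction w)
  case (Cons i w)
  then have "word_perm w permutes {1..n}" "i \<in> {1..<n}" by auto
  then show ?case
    unfolding word_perm_simps by (intro permutes_compose adj_transp_permutes)
qed (simp add: permutes_id)

lemma permutes_adj_neq: "\<sigma> permutes S \<Longrightarrow> \<sigma> (Suc i) \<noteq> \<sigma> i"
  by (metis permutes_inj injD n_not_Suc_n)

text \<open>The lower bound for the length: one more letter on the right changes the number of
  inversions by exactly one. Hence the induction from the right end.\<close>

lemma inversions_word_perm_le:
  "set w \<subseteq> {1..<n} \<Longrightarrow> card (inversions n (word_perm w)) \<le> length w"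
proof (induction w rule: rev_induct)
  case Nil
  have "inversions n id = {}" by (auto simp: inversions_def)
  then show ?case by (simp add: id_def)
next
  case (snoc i w)
  then have i: "i \<in> {1..<n}" and w: "set w \<subseteq> {1..<n}" by auto
  have "word_perm w (Suc i) \<noteq> word_perm w i"
    using word_perm_permutes[OF w] by (rule permutes_adj_neq)
  then have "card (inversions n (word_perm w \<circ> adj_transp i)) \<le> Suc (length w)"
    using card_inversions_ascent[OF i, of "word_perm w"] card_inversions_descent[OF i, of "word_perm w"]
      snoc.IH[OF w]
    by (cases "word_perm w i < word_perm w (Suc i)") auto
  then show ?case
    by (simp add: word_perm_append o_def)
qed

text \<open>The upper bound: as long as there is a descent, multiplying by that transposition
  removes one inversion; a permutation without descents is the identity.\<close>

lemma word_perm_reduced: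
  assumes "\<sigma> permutes {1..n}"
  shows "\<exists>w. length w = card (inversions n \<sigma>) \<and> set w \<subseteq> {1..<n} \<and> \<sigma> = word_perm w"
  using assms
proof (induction "card (inversions n \<sigma>)" arbitrary: \<sigma> rule: less_induct)
  case less
  show ?case
  proof (cases "\<exists>i\<in>{1..<n}. \<sigma> (Suc i) < \<sigma> i")
    case True
    then obtain i where i: "i \<in> {1..<n}" "\<sigma> (Suc i) < \<sigma> i" by blast
    let ?\<tau> = "\<sigma> \<circ> adj_transp i"
    have "?\<tau> permutes {1..n}"
      using adj_transp_permutes[OF i(1)] less.prems by (rule permutes_compose)
    then obtain w where "length w = card (inversions n ?\<tau>)" "set w \<subseteq> {1..<n}" "?\<tau> = word_perm w"
      using less.hyps[of ?\<tau>] card_inversions_descent[of i n \<sigma>, OF i] by auto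
    moreover from this(3) have "\<sigma> = word_perm (w @ [i])"
      unfolding word_perm_append by (metis adj_transp_comp_self comp_id o_assoc)
    ultimately show ?thesis
      using card_inversions_descent[of i n \<sigma>, OF i] i
      by (intro exI[of _ "w @ [i]"]) simp
  next
    case False
    \<comment> \<open>Without descents \<sigma> is increasing on [n], so \<sigma>(i) \<ge> i by
      induction from \<sigma>(1) \<ge> 1; this forces a permutation of [n] to be the
      identity.\<close>
    have "i \<le> \<sigma> i" if "i \<in> {1..n}" for i
    proof -
      from that have "1 \<le> i" "i \<le> n" by auto
      then show ?thesis
      proof (induction i rule: dec_induct)
        case base
        then show ?case
          using permutes_in_image[OF less.prems, of 1] by simp
      next
        case (step j)
        then have "\<sigma> j < \<sigma> (Suc j)"
          using False permutes_adj_neq[OF less.prems, of j]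
          by (metis atLeastLessThan_iff Suc_le_eq linorder_neqE_nat)
        with step show ?case by simp
      qed
    qed
    then have "\<sigma> = id"
      using permutes_natset_ge[OF less.prems] by blast
    moreover have "inversions n id = {}" by (auto simp: inversions_def)
    ultimately show ?thesis
      by (intro exI[of _ "[]"]) (simp add: id_def)
  qed
qed

lemma perm_length_eq:
  assumes "\<sigma> permutes {1..n}"
  shows "perm_length n \<sigma> = card (inversions n \<sigma>)"
  unfolding perm_length_def word_perm_def[symmetric]
  using word_perm_reduced[OF assms] inversions_word_perm_le by (intro Least_equality) auto

text \<open>Descents are defined through minimal word lengths; since length is the number of
  inversions, they reduce to a comparison of two neighbouring values, the form in which they enter
  the action.\<close>

lemma right_descents_iff:
  assumes \<sigma>: "\<sigma> permutes {1..n}" and i: "i \<in> {1..<n}"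
  shows "i \<in> right_descents n \<sigma> \<longleftrightarrow> \<sigma> (Suc i) < \<sigma> i"
proof -
  have "\<sigma> \<circ> adj_transp i permutes {1..n}"
    using adj_transp_permutes[OF i] \<sigma> by (rule permutes_compose)
  then have "i \<in> right_descents n \<sigma> \<longleftrightarrow>
      card (inversions n (\<sigma> \<circ> adj_transp i)) < card (inversions n \<sigma>)"
    using i by (simp add: right_descents_def perm_length_eq \<sigma> del: One_nat_def)
  then show ?thesis
    using card_inversions_ascent[OF i, of \<sigma>] card_inversions_descent[OF i, of \<sigma>]
      permutes_adj_neq[OF \<sigma>, of i]
    by (cases "\<sigma> i < \<sigma> (Suc i)") simp_all
qed

section \<open>Poset modules\<close>

text \<open>Substituting i = \<sigma>(a), j = \<sigma>(b) removes the inverse and turns the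
  condition into one on positions of the one-line notation.\<close>

lemma Sigma_R_iff:
  "\<sigma> \<in> Sigma_R n P \<longleftrightarrow> \<sigma> permutes {1..n} \<and> (\<forall>a b. (\<sigma> a, \<sigma> b) \<in> P \<and> a \<noteq> b \<longrightarrow> a < b)"
proof (cases "\<sigma> permutes {1..n}")
  case True
  then have [simp]: "inv_into UNIV \<sigma> (\<sigma> a) = a" "\<sigma> (inv_into UNIV \<sigma> a) = a" for a
    by (simp_all add: permutes_inverses)
  show ?thesis
    unfolding Sigma_R_def using True
    by auto (metis permutes_inverses(1) permutes_inverses(2))+
qed (simp add: Sigma_R_def)

lemma Sigma_R_permutes: "\<sigma> \<in> Sigma_R n P \<Longrightarrow> \<sigma> permutes {1..n}"
  by (simp add: Sigma_R_iff)

text \<open>Only the relative order of the entries at positions i and i + 1 changes. As \<sigma> is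
  itself a linear extension, the sole possible violation is \<sigma>(i) lying below \<sigma>(i +
  1).\<close>

lemma Sigma_R_adj_transp_iff:
  assumes \<sigma>: "\<sigma> \<in> Sigma_R n P" and i: "i \<in> {1..<n}"
  shows "\<sigma> \<circ> adj_transp i \<in> Sigma_R n P \<longleftrightarrow> (\<sigma> i, \<sigma> (Suc i)) \<notin> P"
proof
  assume *: "\<sigma> \<circ> adj_transp i \<in> Sigma_R n P"
  show "(\<sigma> i, \<sigma> (Suc i)) \<notin> P"
  proof
    assume "(\<sigma> i, \<sigma> (Suc i)) \<in> P"
    then have "((\<sigma> \<circ> adj_transp i) (Suc i), (\<sigma> \<circ> adj_transp i) i) \<in> P" by simp
    with * have "Suc i < i" unfolding Sigma_R_iff by fastforce
    then show False by simp
  qed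
next
  assume *: "(\<sigma> i, \<sigma> (Suc i)) \<notin> P"
  have "a < b" if "(\<sigma> (adj_transp i a), \<sigma> (adj_transp i b)) \<in> P" "a \<noteq> b" for a b
  proof -
    have less: "adj_transp i a < adj_transp i b"
      using \<sigma> that unfolding Sigma_R_iff by auto
    have "adj_transp i (adj_transp i a) < adj_transp i (adj_transp i b)"
      by (rule adj_transp_less[OF less]) (use that * in auto)
    then show ?thesis by simp
  qed
  moreover have "\<sigma> \<circ> adj_transp i permutes {1..n}"
    using adj_transp_permutes[OF i] Sigma_R_permutes[OF \<sigma>] by (rule permutes_compose)
  ultimately show "\<sigma> \<circ> adj_transp i \<in> Sigma_R n P"
    by (auto simp: Sigma_R_iff)
qed

text \<open>The case distinction now sees only the values at positions i and i + 1, which is why the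
  action is compatible with standardization.\<close>

lemma gen_act_eq:
  assumes \<sigma>: "\<sigma> \<in> Sigma_R n P" and i: "i \<in> {1..<n}"
  shows "gen_act n P i \<sigma> = (if \<sigma> (Suc i) < \<sigma> i then - basis \<sigma>
    else if (\<sigma> i, \<sigma> (Suc i)) \<in> P then 0 else basis (\<sigma> \<circ> adj_transp i))"
  by (simp add: gen_act_def right_descents_iff[OF Sigma_R_permutes[OF \<sigma>] i]
      Sigma_R_adj_transp_iff[OF \<sigma> i])

lemma gen_act_keys: "\<sigma> \<in> Sigma_R n P \<Longrightarrow> Poly_Mapping.keys (gen_act n P i \<sigma>) \<subseteq> Sigma_R n P"
  by (auto simp: gen_act_def keys_closed split: if_splits)

text \<open>After a swap at an ascent, i has become a descent, which produces the sign of the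
  relation; a blocked swap gives zero on both sides.\<close>

lemma gen_act_square:
  assumes \<sigma>: "\<sigma> \<in> Sigma_R n P" and i: "i \<in> {1..<n}"
  shows "linear_ext (gen_act n P i) (gen_act n P i \<sigma>) = - gen_act n P i \<sigma>"
proof -
  note simps = gen_act_eq Sigma_R_adj_transp_iff linear_ext_uminus assms
  show ?thesis
    using permutes_adj_neq[OF Sigma_R_permutes[OF \<sigma>], of i] by (simp add: simps del: One_nat_def atLeastLessThan_iff)
qed

text \<open>Generators that are far apart look at disjoint pairs of positions, so neither affects
  the case distinction of the other.\<close>

lemma gen_act_commute:
  assumes \<sigma>: "\<sigma> \<in> Sigma_R n P" and i: "i \<in> {1..<n}" "j \<in> {1..<n}"
    and ij: "2 \<le> \<bar>int i - int j\<bar>"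
  shows "linear_ext (gen_act n P j) (gen_act n P i \<sigma>) = linear_ext (gen_act n P i) (gen_act n P j \<sigma>)"
proof -
  have ne: "i \<noteq> j" "Suc i \<noteq> j" "i \<noteq> Suc j"
    using ij by auto
  have "\<sigma> \<circ> adj_transp i \<circ> adj_transp j = \<sigma> \<circ> adj_transp j \<circ> adj_transp i"
    using ne by (auto simp: fun_eq_iff adj_transp_def transpose_def)
  moreover note simps = gen_act_eq Sigma_R_adj_transp_iff linear_ext_uminus \<sigma> i ne ne[symmetric]
  ultimately show ?thesis
    by (simp add: simps del: One_nat_def atLeastLessThan_iff)
qed

text \<open>Unless blocked, both words bring the three values at positions i, i + 1, i + 2 into
  decreasing order, swapping each pair not yet inverted and picking up one sign for each inverted
  pair. So the signs agree, and both sides vanish as soon as \<open>P\<close> blocks one of the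
  swaps.\<close>

lemma gen_act_braid:
  assumes \<sigma>: "\<sigma> \<in> Sigma_R n P" and i: "i \<in> {1..<n}" "Suc i \<in> {1..<n}"
  shows "linear_ext (gen_act n P i) (linear_ext (gen_act n P (Suc i)) (gen_act n P i \<sigma>)) =
    linear_ext (gen_act n P (Suc i)) (linear_ext (gen_act n P i) (gen_act n P (Suc i) \<sigma>))"
proof -
  let ?s = "adj_transp i" and ?t = "adj_transp (Suc i)"
  have braid: "\<sigma> \<circ> ?s \<circ> ?t \<circ> ?s = \<sigma> \<circ> ?t \<circ> ?s \<circ> ?t"
    by (auto simp: fun_eq_iff adj_transp_def transpose_def)
  have "inj \<sigma>"
    using Sigma_R_permutes[OF \<sigma>] by (rule permutes_inj)
  then have ne: "\<sigma> i \<noteq> \<sigma> (Suc i)" "\<sigma> i \<noteq> \<sigma> (Suc (Suc i))" "\<sigma> (Suc i) \<noteq> \<sigma> (Suc (Suc i))"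
    by (simp_all add: inj_eq)
  have [simp]: "\<And>\<tau>. \<tau> \<circ> ?s \<circ> ?s = \<tau>" "\<And>\<tau>. \<tau> \<circ> ?t \<circ> ?t = \<tau>"
    by (simp_all add: o_assoc[symmetric])
  \<comment> \<open>Conditional rewrite rules in place of \<open>gen_act_eq\<close>: their premises
    are comparisons of values, which the simplifier can decide for every permutation arising along
    the two words.\<close>
  have gen: "gen_act n P k \<tau> = - basis \<tau>" if "\<tau> (Suc k) < \<tau> k" "\<tau> \<in> Sigma_R n P" "k \<in> {i, Suc i}" for k \<tau>
    using gen_act_eq[of \<tau> n P k] that i by auto
  have gen0: "gen_act n P k \<tau> = 0"
    if "\<tau> k < \<tau> (Suc k)" "(\<tau> k, \<tau> (Suc k)) \<in> P" "\<tau> \<in> Sigma_R n P" "k \<in> {i, Suc i}" for k \<tau>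
    using gen_act_eq[of \<tau> n P k] that i by auto
  have gen1: "gen_act n P k \<tau> = basis (\<tau> \<circ> adj_transp k)"
    if "\<tau> k < \<tau> (Suc k)" "(\<tau> k, \<tau> (Suc k)) \<notin> P" "\<tau> \<in> Sigma_R n P" "k \<in> {i, Suc i}" for k \<tau>
    using gen_act_eq[of \<tau> n P k] that i by auto
  have mem: "\<tau> \<circ> adj_transp k \<in> Sigma_R n P"
    if "(\<tau> k, \<tau> (Suc k)) \<notin> P" "\<tau> \<in> Sigma_R n P" "k \<in> {i, Suc i}" for k \<tau>
    using Sigma_R_adj_transp_iff[of \<tau> n P k] that i by auto
  note simps = gen gen0 gen1 mem \<sigma> linear_ext_uminus
  \<comment> \<open>The six relative orders of three distinct values; within each, membership of the
    three pairs in \<open>P\<close> decides which swaps are blocked.\<close>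
  from ne consider
    "\<sigma> i < \<sigma> (Suc i)" "\<sigma> (Suc i) < \<sigma> (Suc (Suc i))"
    | "\<sigma> i < \<sigma> (Suc (Suc i))" "\<sigma> (Suc (Suc i)) < \<sigma> (Suc i)"
    | "\<sigma> (Suc i) < \<sigma> i" "\<sigma> i < \<sigma> (Suc (Suc i))"
    | "\<sigma> (Suc i) < \<sigma> (Suc (Suc i))" "\<sigma> (Suc (Suc i)) < \<sigma> i"
    | "\<sigma> (Suc (Suc i)) < \<sigma> i" "\<sigma> i < \<sigma> (Suc i)"
    | "\<sigma> (Suc (Suc i)) < \<sigma> (Suc i)" "\<sigma> (Suc i) < \<sigma> i"
    by linarith
  then show ?thesis
    by cases
      (cases "(\<sigma> i, \<sigma> (Suc i)) \<in> P"; cases "(\<sigma> (Suc i), \<sigma> (Suc (Suc i))) \<in> P";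
        cases "(\<sigma> i, \<sigma> (Suc (Suc i))) \<in> P"; simp add: simps braid)+
qed

section \<open>The 0-Hecke algebra\<close>

definition word_set :: "nat \<Rightarrow> nat list set" where
  "word_set n = lists {1..<n}"

lemma word_set_simps [simp]:
  "[] \<in> word_set n" "i # w \<in> word_set n \<longleftrightarrow> i \<in> {1..<n} \<and> w \<in> word_set n"
  "w @ w' \<in> word_set n \<longleftrightarrow> w \<in> word_set n \<and> w' \<in> word_set n"
  by (auto simp: word_set_def)

abbreviation words :: "nat \<Rightarrow> nat list monoid" where
  "words n \<equiv> \<lparr>carrier = word_set n, monoid.mult = (@), one = []\<rparr>"

lemma monoid_words: "Group.monoid (words n)"
  by unfold_locales auto

lemma free_algebra_conv: "free_algebra n = monoid_algebra (words n)"
  by (simp add: free_algebra_def word_set_def)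

lemma keys_append_word_set:
  "Poly_Mapping.keys f \<subseteq> word_set n \<Longrightarrow> Poly_Mapping.keys g \<subseteq> word_set n \<Longrightarrow>
    Poly_Mapping.keys (bilinear_ext (@) f g) \<subseteq> word_set n"
  by (rule keys_bilinear_ext) auto

lemma hecke_relations_cases:
  assumes "f \<in> hecke_relations n"
  obtains i where "i \<in> {1..<n}" "f = basis [i, i] + basis [i]"
  | i where "i \<in> {1..<n}" "Suc i \<in> {1..<n}" "f = basis [i, Suc i, i] - basis [Suc i, i, Suc i]"
  | i j where "i \<in> {1..<n}" "j \<in> {1..<n}" "2 \<le> \<bar>int i - int j\<bar>" "f = basis [i, j] - basis [j, i]"
  using assms unfolding hecke_relations_def Let_def Suc_eq_plus1 by blast

lemma hecke_relationsI:
  "i \<in> {1..<n} \<Longrightarrow> basis [i, i] + basis [i] \<in> hecke_relations n"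
  "i \<in> {1..<n} \<Longrightarrow> Suc i \<in> {1..<n} \<Longrightarrow> basis [i, Suc i, i] - basis [Suc i, i, Suc i] \<in> hecke_relations n"
  "i \<in> {1..<n} \<Longrightarrow> j \<in> {1..<n} \<Longrightarrow> 2 \<le> \<bar>int i - int j\<bar> \<Longrightarrow> basis [i, j] - basis [j, i] \<in> hecke_relations n"
  unfolding hecke_relations_def Let_def Suc_eq_plus1 by blast+

lemma hecke_relations_subset: "hecke_relations n \<subseteq> {f. Poly_Mapping.keys f \<subseteq> word_set n}"
proof
  fix f assume "f \<in> hecke_relations n"
  then show "f \<in> {f. Poly_Mapping.keys f \<subseteq> word_set n}"
    by (cases rule: hecke_relations_cases) (simp_all add: keys_closed)
qed

lemma hecke_ideal_ideal: "ideal (hecke_ideal n) (monoid_algebra (words n))"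
  unfolding hecke_ideal_def free_algebra_conv
  using hecke_relations_subset
  by (intro ring.genideal_ideal complex_algebraD(2) complex_algebra_monoid_algebra monoid_words) simp

lemma hecke_relations_ideal: "hecke_relations n \<subseteq> hecke_ideal n"
  unfolding hecke_ideal_def free_algebra_conv
  using hecke_relations_subset
  by (intro ring.genideal_self complex_algebraD(2) complex_algebra_monoid_algebra monoid_words) simp

lemma hecke_ideal_minimal:
  assumes "ideal J (monoid_algebra (words n))" "hecke_relations n \<subseteq> J"
  shows "hecke_ideal n \<subseteq> J"
  unfolding hecke_ideal_def free_algebra_conv
  using assms
  by (intro ring.genideal_minimal complex_algebraD(2) complex_algebra_monoid_algebra monoid_words)

lemma hecke_ideal_subset: "hecke_ideal n \<subseteq> {f. Poly_Mapping.keys f \<subseteq> word_set n}"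
  using additive_subgroup.a_subset[OF ideal.axioms(1)[OF hecke_ideal_ideal]] by simp

lemma subspace_hecke_ideal: "pm.subspace (hecke_ideal n)"
  using monoid_words hecke_ideal_ideal by (rule ideal_subspace)

lemma hecke_ideal_mult:
  assumes "f \<in> hecke_ideal n" "Poly_Mapping.keys g \<subseteq> word_set n"
  shows "bilinear_ext (@) f g \<in> hecke_ideal n" "bilinear_ext (@) g f \<in> hecke_ideal n"
  using ideal.I_r_closed[OF hecke_ideal_ideal, of f n g] ideal.I_l_closed[OF hecke_ideal_ideal, of f n g] assms
  by simp_all

lemma hecke_conv: "hecke n = quotient_algebra (monoid_algebra (words n)) (hecke_ideal n)"
  by (simp add: hecke_def free_algebra_conv)

lemma complex_algebra_hecke: "complex_algebra (hecke n)"
  unfolding hecke_conv by (rule complex_algebra_quotient[OF monoid_words hecke_ideal_ideal])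

lemma hecke_simps:
  "carrier (hecke n) = coset (hecke_ideal n) ` {f. Poly_Mapping.keys f \<subseteq> word_set n}"
  "\<one>\<^bsub>hecke n\<^esub> = coset (hecke_ideal n) (basis [])"
  "coset (hecke_ideal n) f \<oplus>\<^bsub>hecke n\<^esub> coset (hecke_ideal n) g = coset (hecke_ideal n) (f + g)"
  "c \<odot>\<^bsub>hecke n\<^esub> coset (hecke_ideal n) f = coset (hecke_ideal n) (pm_scale c f)"
  by (simp_all add: hecke_conv quotient_algebra_simps quotient_algebra_add quotient_algebra_smult
      subspace_hecke_ideal)

lemma hecke_mult:
  "Poly_Mapping.keys f \<subseteq> word_set n \<Longrightarrow> Poly_Mapping.keys g \<subseteq> word_set n \<Longrightarrow>
    coset (hecke_ideal n) f \<otimes>\<^bsub>hecke n\<^esub> coset (hecke_ideal n) g = coset (hecke_ideal n) (bilinear_ext (@) f g)"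
  unfolding hecke_conv by (subst quotient_algebra_mult[OF monoid_words hecke_ideal_ideal]) simp_all

section \<open>Poset modules over the 0-Hecke algebra\<close>

lemma word_act_Nil [simp]: "word_act n P v [] = v"
  by (simp add: word_act_def)

lemma word_act_Cons [simp]: "word_act n P v (i # w) = word_act n P (linear_ext (gen_act n P i) v) w"
  by (simp add: word_act_def)

lemma word_act_append: "word_act n P v (w @ w') = word_act n P (word_act n P v w) w'"
  by (simp add: word_act_def)

lemma word_act_linear: "word_act n P v w = linear_ext (\<lambda>\<gamma>. word_act n P (basis \<gamma>) w) v"
proof (induction w arbitrary: v)
  case (Cons i w)
  show ?case
  proof -
    have "word_act n P v (i # w) = linear_ext (\<lambda>\<gamma>. word_act n P (basis \<gamma>) w) (linear_ext (gen_act n P i) v)"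
      unfolding word_act_Cons by (rule Cons)
    also have "\<dots> = linear_ext (\<lambda>\<gamma>. linear_ext (\<lambda>\<delta>. word_act n P (basis \<delta>) w) (gen_act n P i \<gamma>)) v"
      by (rule linear_ext_comp)
    also have "\<dots> = linear_ext (\<lambda>\<gamma>. word_act n P (gen_act n P i \<gamma>) w) v"
      by (simp only: Cons[symmetric])
    finally show ?thesis by simp
  qed
qed simp

text \<open>The action is bilinear in vector and algebra element. This form exhibits linearity in
  \<open>v\<close>, which the definition as a fold over letters hides.\<close>

lemma linear_ext_word_act:
  "linear_ext (word_act n P v) f = linear_ext (\<lambda>\<gamma>. linear_ext (word_act n P (basis \<gamma>)) f) v"
proof -
  have "linear_ext (word_act n P v) f = linear_ext (\<lambda>w. linear_ext (\<lambda>\<gamma>. word_act n P (basis \<gamma>) w) v) f"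
    by (rule linear_ext_cong) (rule word_act_linear)
  then show ?thesis
    by (simp add: linear_ext_swap[of _ v])
qed

lemma word_act_keys:
  "Poly_Mapping.keys v \<subseteq> Sigma_R n P \<Longrightarrow> Poly_Mapping.keys (word_act n P v w) \<subseteq> Sigma_R n P"
proof (induction w arbitrary: v)
  case (Cons i w)
  then have "Poly_Mapping.keys (linear_ext (gen_act n P i) v) \<subseteq> Sigma_R n P"
    by (intro keys_linear_ext gen_act_keys) auto
  with Cons.IH show ?case by simp
qed simp

text \<open>Concatenated words act by composition; the action of \<open>f\<close> is pulled inside
  by linearity of the action of \<open>g\<close> in the vector.\<close>

lemma word_act_mult:
  "linear_ext (word_act n P v) (bilinear_ext (@) f g) =
    linear_ext (word_act n P (linear_ext (word_act n P v) f)) g"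
proof -
  have "linear_ext (word_act n P v) (bilinear_ext (@) f g) =
      linear_ext (\<lambda>w. linear_ext (word_act n P (word_act n P v w)) g) f"
    by (simp add: bilinear_ext_conv linear_ext_comp word_act_append)
  also have "\<dots> = linear_ext (\<lambda>w. linear_ext (\<lambda>\<gamma>. linear_ext (word_act n P (basis \<gamma>)) g) (word_act n P v w)) f"
    by (rule linear_ext_cong) (rule linear_ext_word_act)
  also have "\<dots> = linear_ext (\<lambda>\<gamma>. linear_ext (word_act n P (basis \<gamma>)) g) (linear_ext (word_act n P v) f)"
    by (simp add: linear_ext_comp)
  finally show ?thesis
    by (simp flip: linear_ext_word_act)
qed

lemma hecke_relations_act:
  assumes v: "Poly_Mapping.keys v \<subseteq> Sigma_R n P" and f: "f \<in> hecke_relations n"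
  shows "linear_ext (word_act n P v) f = 0"
proof -
  have "linear_ext (word_act n P (basis \<gamma>)) f = 0" if "\<gamma> \<in> Sigma_R n P" for \<gamma>
    using f
  proof (cases rule: hecke_relations_cases)
    case (1 i)
    with gen_act_square[OF that] show ?thesis
      by (simp add: linear_ext_add)
  next
    case (2 i)
    with gen_act_braid[OF that] show ?thesis
      by (simp add: linear_ext_diff)
  next
    case (3 i j)
    with gen_act_commute[OF that] show ?thesis
      by (simp add: linear_ext_diff)
  qed
  then have "linear_ext (\<lambda>\<gamma>. linear_ext (word_act n P (basis \<gamma>)) f) v = linear_ext (\<lambda>\<gamma>. 0) v"
    using v by (intro linear_ext_cong) auto
  then show ?thesis
    by (subst linear_ext_word_act) simp
qed

text \<open>The elements annihilating every vector of the module form a two-sided ideal that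
  contains the defining relations, hence also the ideal generated by them.\<close>

lemma hecke_ideal_act:
  assumes v: "Poly_Mapping.keys v \<subseteq> Sigma_R n P" and f: "f \<in> hecke_ideal n"
  shows "linear_ext (word_act n P v) f = 0"
proof -
  \<comment> \<open>All vectors are quantified over, not just the given one: closure under left
    multiplication by \<open>g\<close> applies the property to the image of \<open>v\<close> under
    \<open>g\<close>.\<close>
  let ?J = "{f. Poly_Mapping.keys f \<subseteq> word_set n \<and>
    (\<forall>v. Poly_Mapping.keys v \<subseteq> Sigma_R n P \<longrightarrow> linear_ext (word_act n P v) f = 0)}"
  have "ideal ?J (monoid_algebra (words n))"
  proof (rule ideal_monoid_algebraI[OF monoid_words])
    show "pm.subspace ?J"
      by (rule pm.subspaceI) (simp_all add: keys_closed linear_ext_add linear_ext_scale)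
    fix f g :: "nat list \<Rightarrow>\<^sub>0 complex"
    assume fg: "f \<in> ?J" "Poly_Mapping.keys g \<subseteq> carrier (words n)"
    have keys: "Poly_Mapping.keys (linear_ext (word_act n P v) g) \<subseteq> Sigma_R n P"
      if "Poly_Mapping.keys v \<subseteq> Sigma_R n P" for v
      using word_act_keys[OF that] by (intro keys_linear_ext)
    have "Poly_Mapping.keys (bilinear_ext (@) f g) \<subseteq> word_set n"
      "Poly_Mapping.keys (bilinear_ext (@) g f) \<subseteq> word_set n"
      using fg by (simp_all add: keys_append_word_set)
    moreover have "word_act n P 0 = (\<lambda>w. 0)"
      by (rule ext, subst word_act_linear) simp
    ultimately show "bilinear_ext (monoid.mult (words n)) g f \<in> ?J"
      "bilinear_ext (monoid.mult (words n)) f g \<in> ?J"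
      using fg keys by (simp_all add: word_act_mult)
  qed auto
  then have "hecke_ideal n \<subseteq> ?J"
    using hecke_relations_subset hecke_relations_act by (intro hecke_ideal_minimal) auto
  with v f show ?thesis by blast
qed

lemma poset_module_simps:
  "carrier (poset_module n P) = {v. Poly_Mapping.keys v \<subseteq> Sigma_R n P}"
  "\<zero>\<^bsub>poset_module n P\<^esub> = 0" "v \<oplus>\<^bsub>poset_module n P\<^esub> w = v + w" "c \<odot>\<^bsub>poset_module n P\<^esub> v = pm_scale c v"
  by (simp_all add: poset_module_def)

lemma the_elem_image: "x \<in> S \<Longrightarrow> (\<And>y. y \<in> S \<Longrightarrow> F y = F x) \<Longrightarrow> the_elem (F ` S) = F x"
  by (metis the_elem_image_unique empty_iff)

text \<open>\<open>the_elem\<close> has a unique value because representatives of a coset differ by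
  an element of the Hecke ideal, which acts as zero.\<close>

lemma poset_module_ract:
  assumes v: "Poly_Mapping.keys v \<subseteq> Sigma_R n P"
  shows "v \<cdot>\<^bsub>poset_module n P\<^esub> coset (hecke_ideal n) f = linear_ext (word_act n P v) f"
proof -
  have "linear_ext (word_act n P v) x = linear_ext (word_act n P v) f" if "x \<in> coset (hecke_ideal n) f" for x
    using hecke_ideal_act[OF v, of "x - f"] that by (simp add: mem_coset_iff linear_ext_diff)
  then have "the_elem (linear_ext (word_act n P v) ` coset (hecke_ideal n) f) = linear_ext (word_act n P v) f"
    by (intro the_elem_image coset_self[OF subspace_hecke_ideal])
  then show ?thesis
    by (simp add: poset_module_def)
qed

lemma module_poset_module: "module CC (poset_module n P)"
  using module_monoid_algebra[of "\<lparr>carrier = Sigma_R n P, monoid.mult = undefined, one = undefined\<rparr>"]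
  by (rule module_surj[where q = id]) (simp_all add: poset_module_simps)

lemma word_act_module_laws:
  "linear_ext (word_act n P (v + w)) f = linear_ext (word_act n P v) f + linear_ext (word_act n P w) f"
  "linear_ext (word_act n P (pm_scale c v)) f = pm_scale c (linear_ext (word_act n P v) f)"
  by (subst (1 2 3) linear_ext_word_act, rule linear_ext_add)
    (subst (1 2) linear_ext_word_act, rule linear_ext_scale)

lemma right_module_poset_module: "right_module (hecke n) (poset_module n P)"
proof -
  have "right_module_axioms (hecke n) (poset_module n P)"
  proof
    fix v a b
    assume v: "v \<in> carrier (poset_module n P)"
    then have v': "Poly_Mapping.keys v \<subseteq> Sigma_R n P" by (simp add: poset_module_simps)
    show "v \<cdot>\<^bsub>poset_module n P\<^esub> \<one>\<^bsub>hecke n\<^esub> = v"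
      by (simp add: hecke_simps poset_module_ract[OF v'])
    assume "a \<in> carrier (hecke n)"
    then obtain f where f: "a = coset (hecke_ideal n) f" "Poly_Mapping.keys f \<subseteq> word_set n"
      by (auto simp: hecke_simps)
    have vf: "Poly_Mapping.keys (linear_ext (word_act n P v) f) \<subseteq> Sigma_R n P"
      using word_act_keys[OF v'] by (rule keys_linear_ext)
    then show "v \<cdot>\<^bsub>poset_module n P\<^esub> a \<in> carrier (poset_module n P)"
      by (simp add: f poset_module_ract[OF v'] poset_module_simps)
    show "(v \<oplus>\<^bsub>poset_module n P\<^esub> w) \<cdot>\<^bsub>poset_module n P\<^esub> a =
        v \<cdot>\<^bsub>poset_module n P\<^esub> a \<oplus>\<^bsub>poset_module n P\<^esub> w \<cdot>\<^bsub>poset_module n P\<^esub> a"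
      if "w \<in> carrier (poset_module n P)" for w
      using that v' by (simp add: f poset_module_simps poset_module_ract keys_closed word_act_module_laws)
    show "c \<odot>\<^bsub>poset_module n P\<^esub> v \<cdot>\<^bsub>poset_module n P\<^esub> a = c \<odot>\<^bsub>poset_module n P\<^esub> (v \<cdot>\<^bsub>poset_module n P\<^esub> a)"
      "v \<cdot>\<^bsub>poset_module n P\<^esub> (c \<odot>\<^bsub>hecke n\<^esub> a) = c \<odot>\<^bsub>poset_module n P\<^esub> (v \<cdot>\<^bsub>poset_module n P\<^esub> a)" for c
      using v' by (simp_all add: f hecke_simps poset_module_simps poset_module_ract keys_closed
          word_act_module_laws linear_ext_scale)
    assume "b \<in> carrier (hecke n)"
    then obtain g where g: "b = coset (hecke_ideal n) g" "Poly_Mapping.keys g \<subseteq> word_set n"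
      by (auto simp: hecke_simps)
    show "v \<cdot>\<^bsub>poset_module n P\<^esub> (a \<oplus>\<^bsub>hecke n\<^esub> b) =
        v \<cdot>\<^bsub>poset_module n P\<^esub> a \<oplus>\<^bsub>poset_module n P\<^esub> v \<cdot>\<^bsub>poset_module n P\<^esub> b"
      using v' by (simp add: f g hecke_simps poset_module_simps poset_module_ract linear_ext_add)
    show "v \<cdot>\<^bsub>poset_module n P\<^esub> (a \<otimes>\<^bsub>hecke n\<^esub> b) = v \<cdot>\<^bsub>poset_module n P\<^esub> a \<cdot>\<^bsub>poset_module n P\<^esub> b"
      using v' vf by (simp add: f g hecke_mult poset_module_ract word_act_mult)
  qed
  then show ?thesis
    by (simp add: right_module_def complex_algebra_hecke module_poset_module)
qed

section \<open>Parabolic subalgebras of the 0-Hecke algebra\<close>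

text \<open>The homomorphism \<pi>_i \<mapsto> \<pi>_(d + i) on free algebras. Shifting by 0 changes
  nothing, so both tensor factors are handled by the same lemmas, with d = 0 and d = m.\<close>

definition shift :: "nat \<Rightarrow> (nat list \<Rightarrow>\<^sub>0 complex) \<Rightarrow> (nat list \<Rightarrow>\<^sub>0 complex)" where
  "shift d = linear_ext (\<lambda>w. basis (map ((+) d) w))"

lemma shift_simps [simp]: "shift d (basis w) = basis (map ((+) d) w)" "shift 0 f = f"
proof -
  have "map ((+) 0) w = w" for w :: "nat list"
    by (simp add: map_idI)
  then show "shift d (basis w) = basis (map ((+) d) w)" "shift 0 f = f"
    by (simp_all add: shift_def)
qed

lemma shift_linear:
  "shift d (f + g) = shift d f + shift d g" "shift d (f - g) = shift d f - shift d g"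
  "shift d (pm_scale c f) = pm_scale c (shift d f)" "shift d 0 = 0"
  by (simp_all add: shift_def linear_ext_add linear_ext_diff linear_ext_scale)

lemma map_add_word_set: "w \<in> word_set k \<Longrightarrow> d + k \<le> n \<Longrightarrow> map ((+) d) w \<in> word_set n"
  by (induction w) auto

lemma shift_keys:
  "Poly_Mapping.keys f \<subseteq> word_set k \<Longrightarrow> d + k \<le> n \<Longrightarrow> Poly_Mapping.keys (shift d f) \<subseteq> word_set n"
  unfolding shift_def
proof (rule keys_linear_ext)
  fix w assume "Poly_Mapping.keys f \<subseteq> word_set k" "d + k \<le> n" "w \<in> Poly_Mapping.keys f"
  then have "map ((+) d) w \<in> word_set n"
    by (intro map_add_word_set[of w k]) auto
  then show "Poly_Mapping.keys (basis (map ((+) d) w)) \<subseteq> word_set n" by simp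
qed

lemma shift_mult: "shift d (bilinear_ext (@) f g) = bilinear_ext (@) (shift d f) (shift d g)"
  by (simp add: shift_def bilinear_ext_conv linear_ext_comp)

text \<open>The preimage of the large ideal under the shift is an ideal of the small free algebra.
  It contains the relations because shifting preserves differences of indices and d + k \<le> n
  keeps the shifted letters in range.\<close>

lemma shift_hecke_ideal:
  assumes dk: "d + k \<le> n" and f: "f \<in> hecke_ideal k"
  shows "shift d f \<in> hecke_ideal n"
proof -
  let ?J = "{f. Poly_Mapping.keys f \<subseteq> word_set k \<and> shift d f \<in> hecke_ideal n}"
  have "ideal ?J (monoid_algebra (words k))"
  proof (rule ideal_monoid_algebraI[OF monoid_words])
    show "pm.subspace ?J"
      using subspace_hecke_ideal[of n]
      by (intro pm.subspaceI)
        (simp_all add: keys_closed shift_linear pm.subspace_0 pm.subspace_add pm.subspace_scale)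
    fix f g :: "nat list \<Rightarrow>\<^sub>0 complex"
    assume fg: "f \<in> ?J" "Poly_Mapping.keys g \<subseteq> carrier (words k)"
    then have "Poly_Mapping.keys (shift d g) \<subseteq> word_set n"
      using dk by (intro shift_keys) auto
    moreover have "Poly_Mapping.keys (bilinear_ext (@) f g) \<subseteq> word_set k"
      "Poly_Mapping.keys (bilinear_ext (@) g f) \<subseteq> word_set k"
      using fg by (simp_all add: keys_append_word_set)
    ultimately show "bilinear_ext (monoid.mult (words k)) g f \<in> ?J"
      "bilinear_ext (monoid.mult (words k)) f g \<in> ?J"
      using fg by (simp_all add: shift_mult hecke_ideal_mult)
  qed auto
  moreover have "shift d f \<in> hecke_relations n" if "f \<in> hecke_relations k" for f
    using that
  proof (cases rule: hecke_relations_cases)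
    case (1 i)
    with dk hecke_relationsI(1)[of "d + i" n] show ?thesis by (simp add: shift_linear)
  next
    case (2 i)
    with dk hecke_relationsI(2)[of "d + i" n] show ?thesis by (simp add: shift_linear)
  next
    case (3 i j)
    with dk hecke_relationsI(3)[of "d + i" n "d + j"] show ?thesis by (simp add: shift_linear)
  qed
  ultimately have "hecke_ideal k \<subseteq> ?J"
    using hecke_relations_subset hecke_relations_ideal by (intro hecke_ideal_minimal) blast+
  with f show ?thesis by blast
qed

lemma hecke_gen_word:
  assumes "w \<in> word_set k" "d + k \<le> n"
  shows "foldr (\<lambda>i a. hecke_gen n (d + i) \<otimes>\<^bsub>hecke n\<^esub> a) w \<one>\<^bsub>hecke n\<^esub> =
    coset (hecke_ideal n) (basis (map ((+) d) w))"
  using assms(1)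
proof (induction w)
  case Nil
  then show ?case by (simp add: hecke_simps)
next
  case (Cons i w)
  then have "map ((+) d) w \<in> word_set n" "[d + i] \<in> word_set n"
    using map_add_word_set[of w k d n] assms(2) by auto
  with Cons show ?case
    by (simp add: hecke_gen_def free_algebra_conv hecke_mult)
qed

lemma word_eval_hecke:
  assumes f: "Poly_Mapping.keys f \<subseteq> word_set k" and dk: "d + k \<le> n"
  shows "word_eval (hecke n) (\<lambda>i. hecke_gen n (d + i)) f = coset (hecke_ideal n) (shift d f)"
proof -
  interpret H: complex_algebra "hecke n" by (rule complex_algebra_hecke)
  have mem: "map ((+) d) w \<in> word_set n" if "w \<in> Poly_Mapping.keys f" for w
    using that f dk by (intro map_add_word_set) auto
  have "word_eval (hecke n) (\<lambda>i. hecke_gen n (d + i)) f =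
      finsum (hecke n) (\<lambda>w. coset (hecke_ideal n)
        (pm_scale (Poly_Mapping.lookup f w) (basis (map ((+) d) w)))) (Poly_Mapping.keys f)"
    unfolding word_eval_def
  proof (rule H.M.finsum_cong'[OF refl])
    show "(\<lambda>w. coset (hecke_ideal n) (pm_scale (Poly_Mapping.lookup f w) (basis (map ((+) d) w))))
        \<in> Poly_Mapping.keys f \<rightarrow> carrier (hecke n)"
      using mem by (auto simp: hecke_simps)
    fix w assume "w \<in> Poly_Mapping.keys f"
    with f have "w \<in> word_set k" by blast
    from hecke_gen_word[OF this dk]
    show "Poly_Mapping.lookup f w \<odot>\<^bsub>hecke n\<^esub>
        foldr (\<lambda>i a. hecke_gen n (d + i) \<otimes>\<^bsub>hecke n\<^esub> a) w \<one>\<^bsub>hecke n\<^esub> =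
        coset (hecke_ideal n) (pm_scale (Poly_Mapping.lookup f w) (basis (map ((+) d) w)))"
      by (simp add: hecke_simps)
  qed
  also have "\<dots> = coset (hecke_ideal n) (shift d f)"
    unfolding hecke_conv shift_def linear_ext_def
    using mem by (intro finsum_quotient subspace_hecke_ideal) auto
  finally show ?thesis .
qed

text \<open>\<open>hecke_lift\<close> is well defined since the shift maps one Hecke ideal into the
  other; it is thereby computed on representatives.\<close>

lemma hecke_lift_coset:
  assumes f: "Poly_Mapping.keys f \<subseteq> word_set k" and dk: "d + k \<le> n"
  shows "hecke_lift (hecke n) (\<lambda>i. hecke_gen n (d + i)) (coset (hecke_ideal k) f) =
    coset (hecke_ideal n) (shift d f)"
proof -
  have eval: "word_eval (hecke n) (\<lambda>i. hecke_gen n (d + i)) x = coset (hecke_ideal n) (shift d f)"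
    if "x \<in> coset (hecke_ideal k) f" for x
  proof -
    from that have x: "x - f \<in> hecke_ideal k" by (simp add: mem_coset_iff)
    then have "Poly_Mapping.keys x \<subseteq> word_set k"
      using keys_closed(1)[of "x - f" "word_set k" f] f hecke_ideal_subset[of k] by auto
    then have "word_eval (hecke n) (\<lambda>i. hecke_gen n (d + i)) x = coset (hecke_ideal n) (shift d x)"
      using dk by (rule word_eval_hecke)
    also have "\<dots> = coset (hecke_ideal n) (shift d f)"
      using shift_hecke_ideal[OF dk x] by (simp add: coset_eq_iff[OF subspace_hecke_ideal] shift_linear)
    finally show ?thesis .
  qed
  have "f \<in> coset (hecke_ideal k) f"
    using subspace_hecke_ideal by (rule coset_self)
  then show ?thesis
    unfolding hecke_lift_def using eval by (subst the_elem_image[of f]) simp_all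
qed

text \<open>Representatives of elements of the tensor product are combinations of pairs of cosets,
  whereas the action on permutations is given by words. The choice is harmless modulo the Hecke
  ideal.\<close>

definition hecke_rep :: "(nat list \<Rightarrow>\<^sub>0 complex) set \<Rightarrow> (nat list \<Rightarrow>\<^sub>0 complex)" where
  "hecke_rep a = (SOME f. f \<in> a)"

lemma hecke_rep:
  assumes "a \<in> carrier (hecke n)"
  shows "coset (hecke_ideal n) (hecke_rep a) = a" "Poly_Mapping.keys (hecke_rep a) \<subseteq> word_set n"
proof -
  from assms obtain f where f: "a = coset (hecke_ideal n) f" "Poly_Mapping.keys f \<subseteq> word_set n"
    by (auto simp: hecke_simps)
  have "hecke_rep a \<in> a"
    unfolding hecke_rep_def f using coset_self[OF subspace_hecke_ideal] by (rule someI)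
  then have *: "hecke_rep a - f \<in> hecke_ideal n"
    by (simp add: f mem_coset_iff)
  then show "coset (hecke_ideal n) (hecke_rep a) = a"
    by (simp add: f coset_eq_iff[OF subspace_hecke_ideal])
  from * show "Poly_Mapping.keys (hecke_rep a) \<subseteq> word_set n"
    using keys_closed(1)[of "hecke_rep a - f" "word_set n" f] f hecke_ideal_subset[of n] by auto
qed

text \<open>A representative in the free algebra of \<alpha>(a) \<beta>(b), the image of a \<otimes>
  b under the embedding.\<close>

definition embed_rep ::
    "nat \<Rightarrow> (nat list \<Rightarrow>\<^sub>0 complex) set \<times> (nat list \<Rightarrow>\<^sub>0 complex) set \<Rightarrow> (nat list \<Rightarrow>\<^sub>0 complex)" where
  "embed_rep m p = bilinear_ext (@) (hecke_rep (fst p)) (shift m (hecke_rep (snd p)))"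

text \<open>A choice function need not be linear, but it is so modulo the ideal, because both sides
  represent the same coset.\<close>

lemma hecke_rep_relations:
  assumes "a \<in> carrier (hecke n)" "b \<in> carrier (hecke n)"
  shows "hecke_rep (a \<oplus>\<^bsub>hecke n\<^esub> b) - hecke_rep a - hecke_rep b \<in> hecke_ideal n"
    and "hecke_rep (c \<odot>\<^bsub>hecke n\<^esub> a) - pm_scale c (hecke_rep a) \<in> hecke_ideal n"
proof -
  note D = CC_moduleD(1,2)[OF complex_algebraD(1)[OF complex_algebra_hecke[of n]]]
  note rep = hecke_rep(1)
  have "a \<oplus>\<^bsub>hecke n\<^esub> b \<in> carrier (hecke n)" "c \<odot>\<^bsub>hecke n\<^esub> a \<in> carrier (hecke n)"
    using assms D by (auto intro: abelian_monoid.a_closed[OF abelian_group.axioms(1)])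
  from this[THEN rep]
  have "coset (hecke_ideal n) (hecke_rep (a \<oplus>\<^bsub>hecke n\<^esub> b)) = coset (hecke_ideal n) (hecke_rep a + hecke_rep b)"
    "coset (hecke_ideal n) (hecke_rep (c \<odot>\<^bsub>hecke n\<^esub> a)) = coset (hecke_ideal n) (pm_scale c (hecke_rep a))"
    using rep[OF assms(1)] rep[OF assms(2)] by (metis hecke_simps(3), metis hecke_simps(4))
  then show "hecke_rep (a \<oplus>\<^bsub>hecke n\<^esub> b) - hecke_rep a - hecke_rep b \<in> hecke_ideal n"
    "hecke_rep (c \<odot>\<^bsub>hecke n\<^esub> a) - pm_scale c (hecke_rep a) \<in> hecke_ideal n"
    by (simp_all add: coset_eq_iff[OF subspace_hecke_ideal] diff_diff_eq)
qed

lemma embed_rep_keys: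
  assumes "m \<le> n" "p \<in> carrier (hecke m) \<times> carrier (hecke (n - m))"
  shows "Poly_Mapping.keys (hecke_rep (fst p)) \<subseteq> word_set n"
    "Poly_Mapping.keys (shift m (hecke_rep (snd p))) \<subseteq> word_set n"
    "Poly_Mapping.keys (embed_rep m p) \<subseteq> word_set n"
proof -
  show *: "Poly_Mapping.keys (hecke_rep (fst p)) \<subseteq> word_set n"
    using hecke_rep(2)[of "fst p" m] shift_keys[of "hecke_rep (fst p)" m 0 n] assms by auto
  show **: "Poly_Mapping.keys (shift m (hecke_rep (snd p))) \<subseteq> word_set n"
    using hecke_rep(2)[of "snd p" "n - m"] assms by (intro shift_keys[where k = "n - m"]) auto
  show "Poly_Mapping.keys (embed_rep m p) \<subseteq> word_set n"
    unfolding embed_rep_def using * ** by (rule keys_append_word_set)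
qed

text \<open>\<open>embed_rep\<close> is bilinear modulo the Hecke ideal: the defects of
  \<open>hecke_rep\<close> lie in the small ideals, are shifted into the large one and stay there
  under multiplication.\<close>

lemma embed_rep_bilinear_span:
  assumes m: "m \<le> n" and f: "f \<in> bilinear_span (hecke m) (hecke (n - m))"
  shows "linear_ext (embed_rep m) f \<in> hecke_ideal n"
proof (rule bilinear_span_linear_ext[OF _ _ subspace_hecke_ideal _ _ _ _ f])
  note mods = complex_algebraD(1)[OF complex_algebra_hecke]
  show "module CC (hecke m)" "module CC (hecke (n - m))" by (rule mods)+
  have left: "bilinear_ext (@) f (shift m (hecke_rep b)) \<in> hecke_ideal n"
    if "f \<in> hecke_ideal m" "b \<in> carrier (hecke (n - m))" for f b
    using shift_hecke_ideal[of 0 m n f] embed_rep_keys(2)[of m n "(undefined, b)"] that m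
      hecke_rep(2)[OF that(2)] shift_keys[of "hecke_rep b" "n - m" m n]
    by (intro hecke_ideal_mult) auto
  have right: "bilinear_ext (@) (hecke_rep a) (shift m f) \<in> hecke_ideal n"
    if "f \<in> hecke_ideal (n - m)" "a \<in> carrier (hecke m)" for f a
    using shift_hecke_ideal[of m "n - m" n f] that m
      hecke_rep(2)[OF that(2)] shift_keys[of "hecke_rep a" "m" 0 n]
    by (intro hecke_ideal_mult) auto
  fix a a' b b' c
  assume a: "a \<in> carrier (hecke m)" and b: "b \<in> carrier (hecke (n - m))"
  note simps = embed_rep_def shift_linear bilinear_ext_diff_left bilinear_ext_diff_right
    bilinear_ext_scale_left bilinear_ext_scale_right
  show "embed_rep m (a \<oplus>\<^bsub>hecke m\<^esub> a', b) - embed_rep m (a, b) - embed_rep m (a', b) \<in> hecke_ideal n"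
    if "a' \<in> carrier (hecke m)"
    using left[OF hecke_rep_relations(1)[OF a that] b] by (simp add: simps)
  show "embed_rep m (c \<odot>\<^bsub>hecke m\<^esub> a, b) - pm_scale c (embed_rep m (a, b)) \<in> hecke_ideal n"
    using left[OF hecke_rep_relations(2)[OF a a] b] by (simp add: simps)
  show "embed_rep m (a, b \<oplus>\<^bsub>hecke (n - m)\<^esub> b') - embed_rep m (a, b) - embed_rep m (a, b') \<in> hecke_ideal n"
    if "b' \<in> carrier (hecke (n - m))"
    using right[OF hecke_rep_relations(1)[OF b that] a] by (simp add: simps)
  show "embed_rep m (a, c \<odot>\<^bsub>hecke (n - m)\<^esub> b) - pm_scale c (embed_rep m (a, b)) \<in> hecke_ideal n"
    using right[OF hecke_rep_relations(2)[OF b b] a] by (simp add: simps)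
qed

text \<open>Shows that \<open>the_elem\<close> in the definition of the embedding has a unique
  value, and gives a representative by words through which it acts.\<close>

lemma hecke_embed_coset:
  assumes m: "m \<le> n" and g: "Poly_Mapping.keys g \<subseteq> carrier (hecke m) \<times> carrier (hecke (n - m))"
  shows "hecke_embed n m (coset (bilinear_span (hecke m) (hecke (n - m))) g) =
    coset (hecke_ideal n) (linear_ext (embed_rep m) g)"
proof -
  interpret H: complex_algebra "hecke n" by (rule complex_algebra_hecke)
  let ?S = "bilinear_span (hecke m) (hecke (n - m))"
  note mods = complex_algebraD(1)[OF complex_algebra_hecke]
  note sub = subspace_bilinear_span[OF mods mods, of m "n - m"]
  define F where "F f = finsum (hecke n) (\<lambda>p. Poly_Mapping.lookup f p \<odot>\<^bsub>hecke n\<^esub>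
    (hecke_lift (hecke n) (hecke_gen n) (fst p) \<otimes>\<^bsub>hecke n\<^esub>
     hecke_lift (hecke n) (\<lambda>i. hecke_gen n (m + i)) (snd p))) (Poly_Mapping.keys f)" for f
  have F: "F f = coset (hecke_ideal n) (linear_ext (embed_rep m) f)"
    if f: "Poly_Mapping.keys f \<subseteq> carrier (hecke m) \<times> carrier (hecke (n - m))" for f
  proof -
    have mem: "Poly_Mapping.keys (pm_scale (Poly_Mapping.lookup f p) (embed_rep m p)) \<subseteq> word_set n"
      if "p \<in> Poly_Mapping.keys f" for p
      using f that by (intro keys_closed(4) embed_rep_keys(3)[OF m]) blast
    have "F f = finsum (hecke n) (\<lambda>p. coset (hecke_ideal n)
        (pm_scale (Poly_Mapping.lookup f p) (embed_rep m p))) (Poly_Mapping.keys f)"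
      unfolding F_def
    proof (rule H.M.finsum_cong'[OF refl])
      show "(\<lambda>p. coset (hecke_ideal n) (pm_scale (Poly_Mapping.lookup f p) (embed_rep m p)))
          \<in> Poly_Mapping.keys f \<rightarrow> carrier (hecke n)"
        using mem by (simp add: hecke_simps)
      fix p assume "p \<in> Poly_Mapping.keys f"
      with f have p: "p \<in> carrier (hecke m) \<times> carrier (hecke (n - m))" by blast
      then have p': "fst p \<in> carrier (hecke m)" "snd p \<in> carrier (hecke (n - m))" by auto
      have "hecke_lift (hecke n) (hecke_gen n) (fst p) = coset (hecke_ideal n) (hecke_rep (fst p))"
        using hecke_lift_coset[of "hecke_rep (fst p)" m 0 n] hecke_rep[OF p'(1)] m by simp
      moreover have "hecke_lift (hecke n) (\<lambda>i. hecke_gen n (m + i)) (snd p) =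
          coset (hecke_ideal n) (shift m (hecke_rep (snd p)))"
        using hecke_lift_coset[of "hecke_rep (snd p)" "n - m" m n] hecke_rep[OF p'(2)] m by simp
      ultimately show "Poly_Mapping.lookup f p \<odot>\<^bsub>hecke n\<^esub> (hecke_lift (hecke n) (hecke_gen n) (fst p)
          \<otimes>\<^bsub>hecke n\<^esub> hecke_lift (hecke n) (\<lambda>i. hecke_gen n (m + i)) (snd p)) =
          coset (hecke_ideal n) (pm_scale (Poly_Mapping.lookup f p) (embed_rep m p))"
        using embed_rep_keys[OF m p] by (simp add: hecke_mult hecke_simps embed_rep_def)
    qed
    also have "\<dots> = coset (hecke_ideal n) (linear_ext (embed_rep m) f)"
      unfolding hecke_conv linear_ext_def
      using mem by (intro finsum_quotient subspace_hecke_ideal) simp_all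
    finally show ?thesis .
  qed
  have "F x = coset (hecke_ideal n) (linear_ext (embed_rep m) g)" if "x \<in> coset ?S g" for x
  proof -
    from that have x: "x - g \<in> ?S" by (simp add: mem_coset_iff)
    have "Poly_Mapping.keys x \<subseteq> carrier (hecke m) \<times> carrier (hecke (n - m))"
      using keys_closed(1)[of "x - g" _ g] g subsetD[OF bilinear_span_subset[OF mods mods] x] by auto
    then have "F x = coset (hecke_ideal n) (linear_ext (embed_rep m) x)" by (rule F)
    also have "\<dots> = coset (hecke_ideal n) (linear_ext (embed_rep m) g)"
      using embed_rep_bilinear_span[OF m x]
      by (simp add: coset_eq_iff[OF subspace_hecke_ideal] linear_ext_diff)
    finally show ?thesis .
  qed
  moreover have "hecke_embed n m (coset ?S g) = the_elem (F ` coset ?S g)"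
    by (simp add: hecke_embed_def F_def)
  ultimately show ?thesis
    using the_elem_image[of g "coset ?S g" F] coset_self[OF sub, of g] by simp
qed

section \<open>Splitting linear extensions at a lower set\<close>

definition enum :: "nat set \<Rightarrow> nat \<Rightarrow> nat" where
  "enum D i = sorted_list_of_set D ! (i - 1)"

lemma enum_bij:
  assumes "finite D"
  shows "bij_betw (enum D) {1..card D} D"
proof -
  have "bij_betw (\<lambda>i. i - 1) {1..card D} {..<card D}"
    by (rule bij_betw_byWitness[where f' = Suc]) auto
  moreover have "bij_betw ((!) (sorted_list_of_set D)) {..<card D} D"
    using assms by (intro bij_betw_nth) auto
  ultimately have "bij_betw ((!) (sorted_list_of_set D) \<circ> (\<lambda>i. i - 1)) {1..card D} D"
    by (rule bij_betw_trans)
  then show ?thesis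
    by (simp add: enum_def[abs_def] o_def)
qed

lemma enum_less_iff:
  assumes "i \<in> {1..card D}" "j \<in> {1..card D}"
  shows "enum D i < enum D j \<longleftrightarrow> i < j"
proof -
  have *: "enum D a < enum D b" if "a < b" "a \<in> {1..card D}" "b \<in> {1..card D}" for a b
    unfolding enum_def
    by (rule sorted_wrt_nth_less[OF strict_sorted_list_of_set]) (use that in auto)
  show ?thesis
    using *[of i j] *[of j i] assms by (metis linorder_neqE_nat less_asym less_irrefl)
qed

lemma standardize_iff:
  "(i, j) \<in> standardize Q \<longleftrightarrow>
    i \<in> {1..card (Field Q)} \<and> j \<in> {1..card (Field Q)} \<and> (enum (Field Q) i, enum (Field Q) j) \<in> Q"
  by (simp add: standardize_def enum_def)

text \<open>On the positions \<open>d + 1, \<dots>, d + |D|\<close> the one-line notation of \<open>\<gamma>\<close> lists \<open>D\<close>, and \<open>\<sigma>\<close> is the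
  standardization of this part.\<close>

definition arranges :: "(nat \<Rightarrow> nat) \<Rightarrow> nat \<Rightarrow> nat set \<Rightarrow> (nat \<Rightarrow> nat) \<Rightarrow> bool" where
  "arranges \<gamma> d D \<sigma> \<longleftrightarrow> finite D \<and> \<sigma> permutes {1..card D} \<and> (\<forall>i\<in>{1..card D}. \<gamma> (d + i) = enum D (\<sigma> i))"

lemma arrangesD:
  assumes "arranges \<gamma> d D \<sigma>"
  shows "finite D" "\<sigma> permutes {1..card D}" "i \<in> {1..card D} \<Longrightarrow> \<sigma> i \<in> {1..card D}"
    "i \<in> {1..card D} \<Longrightarrow> \<gamma> (d + i) = enum D (\<sigma> i)"
  using assms permutes_in_image[of \<sigma> "{1..card D}"] unfolding arranges_def by blast+

lemma arranges_bij:
  assumes "arranges \<gamma> d D \<sigma>"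
  shows "bij_betw \<gamma> {d + 1..d + card D} D"
proof -
  note D = arrangesD[OF assms]
  have "bij_betw (\<lambda>i. i - d) {d + 1..d + card D} {1..card D}"
    by (rule bij_betw_byWitness[where f' = "(+) d"]) auto
  then have "bij_betw (enum D \<circ> (\<sigma> \<circ> (\<lambda>i. i - d))) {d + 1..d + card D} D"
    using permutes_imp_bij[OF D(2)] enum_bij[OF D(1)] by (blast intro: bij_betw_trans)
  moreover have "(enum D \<circ> (\<sigma> \<circ> (\<lambda>i. i - d))) i = \<gamma> i" if "i \<in> {d + 1..d + card D}" for i
  proof -
    from that have "i - d \<in> {1..card D}" "d + (i - d) = i" by auto
    with D(4)[of "i - d"] show ?thesis by simp
  qed
  ultimately show ?thesis
    by (subst bij_betw_cong) auto
qed

text \<open>Standardization preserves comparisons because \<open>enum D\<close> is strictly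
  increasing.\<close>

lemma arranges_less_iff:
  assumes "arranges \<gamma> d D \<sigma>" "i \<in> {1..card D}" "j \<in> {1..card D}"
  shows "\<gamma> (d + i) < \<gamma> (d + j) \<longleftrightarrow> \<sigma> i < \<sigma> j"
  using arrangesD[OF assms(1)] assms(2,3) enum_less_iff by metis

lemma arranges_standardize_iff:
  assumes \<gamma>: "arranges \<gamma> d D \<sigma>" and F: "Field (Restr P D) = D" and ij: "i \<in> {1..card D}" "j \<in> {1..card D}"
  shows "(\<sigma> i, \<sigma> j) \<in> standardize (Restr P D) \<longleftrightarrow> (\<gamma> (d + i), \<gamma> (d + j)) \<in> P"
proof -
  have "enum D (\<sigma> i) \<in> D" "enum D (\<sigma> j) \<in> D"
    using bij_betwE[OF enum_bij[OF arrangesD(1)[OF \<gamma>]]] arrangesD(3)[OF \<gamma>] ij by blast+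
  with arrangesD(3,4)[OF \<gamma>] ij show ?thesis
    unfolding standardize_iff F by auto
qed

lemma arranges_Sigma_R_iff:
  assumes \<gamma>: "arranges \<gamma> d D \<sigma>" and F: "Field (Restr P D) = D"
  shows "\<sigma> \<in> Sigma_R (card D) (standardize (Restr P D)) \<longleftrightarrow>
    (\<forall>i\<in>{1..card D}. \<forall>j\<in>{1..card D}. (\<gamma> (d + i), \<gamma> (d + j)) \<in> P \<and> i \<noteq> j \<longrightarrow> i < j)"
proof -
  note D = arrangesD[OF \<gamma>]
  have "a \<in> {1..card D}" "b \<in> {1..card D}" if "(\<sigma> a, \<sigma> b) \<in> standardize (Restr P D)" for a b
    using that permutes_in_image[OF D(2)] unfolding standardize_iff F by blast+
  then show ?thesis
    unfolding Sigma_R_iff using D(2) arranges_standardize_iff[OF \<gamma> F] by metis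
qed

lemma arranges_adj_transp:
  assumes \<gamma>: "arranges \<gamma> d D \<sigma>" and i: "i \<in> {1..<card D}"
  shows "arranges (\<gamma> \<circ> adj_transp (d + i)) d D (\<sigma> \<circ> adj_transp i)"
proof -
  note D = arrangesD[OF \<gamma>]
  have s: "adj_transp i permutes {1..card D}"
    using i by (rule adj_transp_permutes)
  have "adj_transp (d + i) (d + j) = d + adj_transp i j" for j
    by (auto simp: adj_transp_def transpose_def)
  moreover have "adj_transp i j \<in> {1..card D}" if "j \<in> {1..card D}" for j
    using permutes_in_image[OF s] that by blast
  ultimately have "\<forall>j\<in>{1..card D}. (\<gamma> \<circ> adj_transp (d + i)) (d + j) = enum D ((\<sigma> \<circ> adj_transp i) j)"
    using D(4) by simp
  then show ?thesis
    unfolding arranges_def using D(1) permutes_compose[OF s D(2)] by blast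
qed

text \<open>Besides the transpositions inside the block, k = d and k = d + card D are excluded: they
  exchange an end of the block with the neighbouring position outside. For two complementary blocks
  this is the missing generator at \<open>card D\<close>.\<close>

lemma arranges_adj_transp_outside:
  assumes \<gamma>: "arranges \<gamma> d D \<sigma>" and k: "k < d \<or> d + card D < k"
  shows "arranges (\<gamma> \<circ> adj_transp k) d D \<sigma>"
proof -
  have "adj_transp k (d + j) = d + j" if "j \<in> {1..card D}" for j
    using that k by (intro adj_transp_simps(3)) auto
  then show ?thesis
    using \<gamma> unfolding arranges_def by auto
qed

text \<open>Both actions depend only on the order and the relation between two neighbouring values,
  which standardization preserves. \<open>h\<close> stands for gluing with the other part held
  fixed, so the lemma serves both tensor factors.\<close>

lemma arranges_gen_act:
  assumes \<gamma>: "arranges \<gamma> d D \<sigma>" and F: "Field (Restr P D) = D"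
    and mem: "\<gamma> \<in> Sigma_R n P" "\<sigma> \<in> Sigma_R (card D) (standardize (Restr P D))"
    and dn: "d + card D \<le> n" and i: "i \<in> {1..<card D}"
    and h: "h \<sigma> = basis \<gamma>" "h (\<sigma> \<circ> adj_transp i) = basis (\<gamma> \<circ> adj_transp (d + i))"
  shows "linear_ext h (gen_act (card D) (standardize (Restr P D)) i \<sigma>) = gen_act n P (d + i) \<gamma>"
proof -
  have i': "i \<in> {1..card D}" "Suc i \<in> {1..card D}" "d + i \<in> {1..<n}"
    using i dn by auto
  show ?thesis
    unfolding gen_act_eq[OF mem(1) i'(3)] gen_act_eq[OF mem(2) i]
    using arranges_less_iff[OF \<gamma> i'(2,1)] arranges_standardize_iff[OF \<gamma> F i'(1,2)] h
    by (simp add: linear_ext_uminus)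
qed

lemma arranges_unique:
  assumes "arranges \<gamma> d D \<sigma>" "arranges \<gamma> d D \<tau>"
  shows "\<sigma> = \<tau>"
proof
  fix i
  note D = arrangesD[OF assms(1)] and E = arrangesD[OF assms(2)]
  show "\<sigma> i = \<tau> i"
  proof (cases "i \<in> {1..card D}")
    case True
    then have "enum D (\<sigma> i) = enum D (\<tau> i)"
      using D(4) E(4) by metis
    then show ?thesis
      using bij_betw_imp_inj_on[OF enum_bij[OF D(1)]] D(3)[OF True] E(3)[OF True] by (meson inj_onD)
  next
    case False
    then show ?thesis
      using permutes_not_in[OF D(2)] permutes_not_in[OF E(2)] by metis
  qed
qed

text \<open>The standardization is the inverse of \<open>enum D\<close> after \<gamma> and the shift
  of positions, extended by the identity so as to be a permutation.\<close>

lemma arranges_exists: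
  assumes D: "finite D" and \<gamma>: "bij_betw \<gamma> {d + 1..d + card D} D"
  shows "\<exists>\<sigma>. arranges \<gamma> d D \<sigma>"
proof
  let ?e = "inv_into {1..card D} (enum D)"
  let ?\<sigma> = "\<lambda>i. if i \<in> {1..card D} then ?e (\<gamma> (d + i)) else i"
  have "bij_betw ((+) d) {1..card D} {d + 1..d + card D}"
    by (rule bij_betw_byWitness[where f' = "\<lambda>i. i - d"]) auto
  then have "bij_betw (?e \<circ> (\<gamma> \<circ> (+) d)) {1..card D} {1..card D}"
    using \<gamma> bij_betw_inv_into[OF enum_bij[OF D]] by (blast intro: bij_betw_trans)
  then have "bij_betw ?\<sigma> {1..card D} {1..card D}"
    by (subst bij_betw_cong[where g = "?e \<circ> (\<gamma> \<circ> (+) d)"]) auto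
  then have "?\<sigma> permutes {1..card D}"
    by (rule bij_imp_permutes) auto
  moreover have "enum D (?\<sigma> i) = \<gamma> (d + i)" if i: "i \<in> {1..card D}" for i
  proof -
    have "\<gamma> (d + i) \<in> D"
      using bij_betwE[OF \<gamma>] i by auto
    then show ?thesis
      using i bij_betw_inv_into_right[OF enum_bij[OF D]] by auto
  qed
  ultimately show "arranges \<gamma> d D ?\<sigma>"
    unfolding arranges_def using D by simp
qed

text \<open>The default value i outside [n] is what \<open>permutes {1..n}\<close> demands.\<close>

definition glue :: "nat \<Rightarrow> nat set \<Rightarrow> (nat \<Rightarrow> nat) \<Rightarrow> (nat \<Rightarrow> nat) \<Rightarrow> nat \<Rightarrow> nat" where
  "glue n D \<sigma> \<tau> i = (if i \<in> {1..card D} then enum D (\<sigma> i)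
     else if i \<in> {card D + 1..n} then enum ({1..n} - D) (\<tau> (i - card D)) else i)"

section \<open>Gluing two permutations along a subset of [n]\<close>

locale subset_of_interval =
  fixes n :: nat and D :: "nat set"
  assumes subset: "D \<subseteq> {1..n}"
begin

abbreviation E :: "nat set" where "E \<equiv> {1..n} - D"

lemma finite_D: "finite D"
  using subset by (rule finite_subset) simp

lemma card_le: "card D \<le> n"
  using card_mono[OF _ subset] by simp

lemma card_E: "card E = n - card D"
  using card_Diff_subset[OF finite_D subset] by simp

lemma glue_arranges:
  assumes "\<sigma> permutes {1..card D}" "\<tau> permutes {1..n - card D}"
  shows "arranges (glue n D \<sigma> \<tau>) 0 D \<sigma>" "arranges (glue n D \<sigma> \<tau>) (card D) E \<tau>"
  using assms finite_D unfolding arranges_def card_E by (auto simp: glue_def)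

text \<open>Characterizes gluing by the two standardizations, so that the gluing of modified
  permutations can be recognized from \<open>arranges\<close> facts.\<close>

lemma glue_unique:
  assumes "arranges \<gamma> 0 D \<sigma>" "arranges \<gamma> (card D) E \<tau>" "\<And>i. i \<notin> {1..n} \<Longrightarrow> \<gamma> i = i"
  shows "\<gamma> = glue n D \<sigma> \<tau>"
proof
  fix i
  consider "i \<in> {1..card D}" | "i \<in> {card D + 1..n}" | "i \<notin> {1..n}"
    by force
  then show "\<gamma> i = glue n D \<sigma> \<tau> i"
  proof cases
    case 1
    then show ?thesis
      using arrangesD(4)[OF assms(1) 1] by (simp add: glue_def)
  next
    case 2
    then have "i - card D \<in> {1..card E}" unfolding card_E by auto
    from arrangesD(4)[OF assms(2) this] 2 show ?thesis
      by (auto simp: glue_def)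
  next
    case 3
    then show ?thesis
      using assms(3)[OF 3] card_le by (auto simp: glue_def)
  qed
qed

lemma glue_permutes:
  assumes "\<sigma> permutes {1..card D}" "\<tau> permutes {1..n - card D}"
  shows "glue n D \<sigma> \<tau> permutes {1..n}"
proof (rule bij_imp_permutes)
  note arr = glue_arranges[OF assms]
  have "bij_betw (glue n D \<sigma> \<tau>) ({0 + 1..0 + card D} \<union> {card D + 1..card D + card E}) (D \<union> E)"
    using arranges_bij[OF arr(1)] arranges_bij[OF arr(2)] by (rule bij_betw_combine) auto
  moreover have "{0 + 1..0 + card D} \<union> {card D + 1..card D + card E} = {1..n}"
    unfolding card_E using card_le by auto
  moreover have "D \<union> E = {1..n}"
    using subset by auto
  ultimately show "bij_betw (glue n D \<sigma> \<tau>) {1..n} {1..n}" by simp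
qed (use card_le in \<open>auto simp: glue_def\<close>)

lemma glue_inject:
  assumes "\<sigma> permutes {1..card D}" "\<tau> permutes {1..n - card D}"
    and "\<sigma>' permutes {1..card D}" "\<tau>' permutes {1..n - card D}"
    and "glue n D \<sigma> \<tau> = glue n D \<sigma>' \<tau>'"
  shows "\<sigma> = \<sigma>'" "\<tau> = \<tau>'"
  using glue_arranges[OF assms(1,2)] glue_arranges[OF assms(3,4)] assms(5)
  by (auto intro: arranges_unique)

text \<open>The set D can be recovered from a glued permutation; this keeps the different summands
  apart.\<close>

lemma glue_image:
  assumes "\<sigma> permutes {1..card D}" "\<tau> permutes {1..n - card D}"
  shows "glue n D \<sigma> \<tau> ` {1..card D} = D"
  using bij_betw_imp_surj_on[OF arranges_bij[OF glue_arranges(1)[OF assms]]] by simp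

text \<open>By uniqueness: a transposition inside one block changes the standardization of that
  block and leaves the other one, and the points outside [n], alone.\<close>

lemma glue_adj_transp:
  assumes \<sigma>: "\<sigma> permutes {1..card D}" and \<tau>: "\<tau> permutes {1..n - card D}"
  shows "i \<in> {1..<card D} \<Longrightarrow> glue n D (\<sigma> \<circ> adj_transp i) \<tau> = glue n D \<sigma> \<tau> \<circ> adj_transp i"
    and "i \<in> {1..<n - card D} \<Longrightarrow> glue n D \<sigma> (\<tau> \<circ> adj_transp i) = glue n D \<sigma> \<tau> \<circ> adj_transp (card D + i)"
proof -
  note arr = glue_arranges[OF \<sigma> \<tau>]
  have out: "(glue n D \<sigma> \<tau> \<circ> adj_transp k) j = j" if "k \<in> {1..<n}" "j \<notin> {1..n}" for j k
  proof -
    have "glue n D \<sigma> \<tau> \<circ> adj_transp k permutes {1..n}"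
      using adj_transp_permutes[OF that(1)] glue_permutes[OF \<sigma> \<tau>] by (rule permutes_compose)
    then show ?thesis using that(2) by (rule permutes_not_in)
  qed
  show "glue n D (\<sigma> \<circ> adj_transp i) \<tau> = glue n D \<sigma> \<tau> \<circ> adj_transp i" if i: "i \<in> {1..<card D}"
  proof (rule glue_unique[symmetric])
    show "arranges (glue n D \<sigma> \<tau> \<circ> adj_transp i) 0 D (\<sigma> \<circ> adj_transp i)"
      using arranges_adj_transp[OF arr(1) i] by simp
    show "arranges (glue n D \<sigma> \<tau> \<circ> adj_transp i) (card D) E \<tau>"
      using i by (intro arranges_adj_transp_outside arr(2)) simp
  qed (rule out, use i card_le in auto)
  show "glue n D \<sigma> (\<tau> \<circ> adj_transp i) = glue n D \<sigma> \<tau> \<circ> adj_transp (card D + i)"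
    if i: "i \<in> {1..<n - card D}"
  proof (rule glue_unique[symmetric])
    show "arranges (glue n D \<sigma> \<tau> \<circ> adj_transp (card D + i)) 0 D \<sigma>"
      using i by (intro arranges_adj_transp_outside arr(1)) simp
    show "arranges (glue n D \<sigma> \<tau> \<circ> adj_transp (card D + i)) (card D) E (\<tau> \<circ> adj_transp i)"
      using i by (intro arranges_adj_transp arr(2)) (unfold card_E)
  qed (rule out, use i in auto)
qed

end

section \<open>Gluing linear extensions at a lower set\<close>

locale lower_subset = subset_of_interval +
  fixes P :: "nat rel"
  assumes order: "partial_order_on {1..n} P"
    and lower: "\<And>x y. x \<in> D \<Longrightarrow> (y, x) \<in> P \<Longrightarrow> y \<in> D"
begin

abbreviation Q1 :: "nat rel" where "Q1 \<equiv> standardize (Restr P D)"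
abbreviation Q2 :: "nat rel" where "Q2 \<equiv> standardize (Restr P E)"

lemma Field_Restr: "S \<subseteq> {1..n} \<Longrightarrow> Field (Restr P S) = S"
  using partial_order_onD(1)[OF order] by (auto simp: Field_def refl_on_def)

lemma Field_D: "Field (Restr P D) = D" and Field_E: "Field (Restr P E) = E"
  using Field_Restr subset by auto

text \<open>Pairs of positions inside one block are governed by the two standardized posets. For
  pairs across the blocks, lowerness of D excludes the wrong order, and the right order is
  automatic.\<close>

lemma glue_Sigma_R_iff:
  assumes \<sigma>: "\<sigma> permutes {1..card D}" and \<tau>: "\<tau> permutes {1..n - card D}"
  shows "glue n D \<sigma> \<tau> \<in> Sigma_R n P \<longleftrightarrow> \<sigma> \<in> Sigma_R (card D) Q1 \<and> \<tau> \<in> Sigma_R (n - card D) Q2"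
proof -
  let ?\<gamma> = "glue n D \<sigma> \<tau>"
  note arr = glue_arranges[OF \<sigma> \<tau>]
  note perm = glue_permutes[OF \<sigma> \<tau>]
  have 1: "\<sigma> \<in> Sigma_R (card D) Q1 \<longleftrightarrow>
      (\<forall>i\<in>{1..card D}. \<forall>j\<in>{1..card D}. (?\<gamma> i, ?\<gamma> j) \<in> P \<and> i \<noteq> j \<longrightarrow> i < j)"
    using arranges_Sigma_R_iff[OF arr(1) Field_D] by simp
  have 2: "\<tau> \<in> Sigma_R (n - card D) Q2 \<longleftrightarrow> (\<forall>i\<in>{1..n - card D}. \<forall>j\<in>{1..n - card D}.
      (?\<gamma> (card D + i), ?\<gamma> (card D + j)) \<in> P \<and> i \<noteq> j \<longrightarrow> i < j)"
    using arranges_Sigma_R_iff[OF arr(2) Field_E] unfolding card_E .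
  show ?thesis
  proof
    assume "?\<gamma> \<in> Sigma_R n P"
    then have less: "a < b" if "(?\<gamma> a, ?\<gamma> b) \<in> P" "a \<noteq> b" for a b
      using that unfolding Sigma_R_iff by blast
    show "\<sigma> \<in> Sigma_R (card D) Q1 \<and> \<tau> \<in> Sigma_R (n - card D) Q2"
      unfolding 1 2 using less less[of "card D + a" "card D + b" for a b] by auto
  next
    assume *: "\<sigma> \<in> Sigma_R (card D) Q1 \<and> \<tau> \<in> Sigma_R (n - card D) Q2"
    have "a < b" if ab: "(?\<gamma> a, ?\<gamma> b) \<in> P" "a \<noteq> b" for a b
    proof -
      have in_n: "a \<in> {1..n}" "b \<in> {1..n}"
        using partial_order_onD(4)[OF order] ab(1) permutes_in_image[OF perm] by blast+
      have in_D: "?\<gamma> k \<in> D \<longleftrightarrow> k \<in> {1..card D}" if "k \<in> {1..n}" for k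
      proof
        assume "?\<gamma> k \<in> D"
        then have "?\<gamma> k \<in> ?\<gamma> ` {1..card D}" unfolding glue_image[OF \<sigma> \<tau>] .
        then show "k \<in> {1..card D}"
          using permutes_inj[OF perm] by (simp add: inj_image_mem_iff)
      qed (use glue_image[OF \<sigma> \<tau>] in blast)
      show ?thesis
      proof (cases "b \<in> {1..card D}")
        case True
        \<comment> \<open>Lowerness: an element below one placed in the first block is itself placed
          there.\<close>
        then have "a \<in> {1..card D}"
          using lower ab(1) in_D in_n by blast
        with True * ab show ?thesis unfolding 1 by blast
      next
        case b: False
        show ?thesis
        proof (cases "a \<in> {1..card D}")
          case True
          with b in_n show ?thesis by auto
        next
          case False
          then have "a - card D \<in> {1..n - card D}" "b - card D \<in> {1..n - card D}"
            "card D + (a - card D) = a" "card D + (b - card D) = b" "a - card D \<noteq> b - card D"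
            using b in_n ab(2) by auto
          with * ab have "a - card D < b - card D"
            unfolding 2 by metis
          then show ?thesis by simp
        qed
      qed
    qed
    with perm show "?\<gamma> \<in> Sigma_R n P"
      by (auto simp: Sigma_R_iff)
  qed
qed

lemma glue_Sigma_R:
  "\<sigma> \<in> Sigma_R (card D) Q1 \<Longrightarrow> \<tau> \<in> Sigma_R (n - card D) Q2 \<Longrightarrow> glue n D \<sigma> \<tau> \<in> Sigma_R n P"
  using glue_Sigma_R_iff Sigma_R_permutes by blast

lemma glue_gen_act:
  assumes \<sigma>: "\<sigma> \<in> Sigma_R (card D) Q1" and \<tau>: "\<tau> \<in> Sigma_R (n - card D) Q2"
  shows "i \<in> {1..<card D} \<Longrightarrow>
      bilinear_ext (glue n D) (gen_act (card D) Q1 i \<sigma>) (basis \<tau>) = gen_act n P i (glue n D \<sigma> \<tau>)"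
    and "i \<in> {1..<n - card D} \<Longrightarrow>
      bilinear_ext (glue n D) (basis \<sigma>) (gen_act (n - card D) Q2 i \<tau>) = gen_act n P (card D + i) (glue n D \<sigma> \<tau>)"
proof -
  note perms = Sigma_R_permutes[OF \<sigma>] Sigma_R_permutes[OF \<tau>]
  note arr = glue_arranges[OF perms]
  show "bilinear_ext (glue n D) (gen_act (card D) Q1 i \<sigma>) (basis \<tau>) = gen_act n P i (glue n D \<sigma> \<tau>)"
    if i: "i \<in> {1..<card D}"
    using arranges_gen_act[OF arr(1) Field_D glue_Sigma_R[OF \<sigma> \<tau>] \<sigma> _ i, of "\<lambda>\<sigma>. basis (glue n D \<sigma> \<tau>)"]
      glue_adj_transp(1)[OF perms i] card_le
    by (simp add: bilinear_ext_conv)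
  show "bilinear_ext (glue n D) (basis \<sigma>) (gen_act (n - card D) Q2 i \<tau>) =
      gen_act n P (card D + i) (glue n D \<sigma> \<tau>)"
    if i: "i \<in> {1..<n - card D}"
    using arranges_gen_act[OF arr(2) Field_E glue_Sigma_R[OF \<sigma> \<tau>], unfolded card_E, OF \<tau> _ i,
        of "\<lambda>\<tau>. basis (glue n D \<sigma> \<tau>)"]
      glue_adj_transp(2)[OF perms i] card_le
    by (simp add: bilinear_ext_conv)
qed

end

context lower_subset
begin

abbreviation V1 where "V1 \<equiv> poset_module (card D) Q1"
abbreviation V2 where "V2 \<equiv> poset_module (n - card D) Q2"
abbreviation S1 where "S1 \<equiv> Sigma_R (card D) Q1"
abbreviation S2 where "S2 \<equiv> Sigma_R (n - card D) Q2"

lemma glue_gen_act_linear: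
  assumes v: "Poly_Mapping.keys v \<subseteq> S1" and w: "Poly_Mapping.keys w \<subseteq> S2"
  shows "i \<in> {1..<card D} \<Longrightarrow> bilinear_ext (glue n D) (linear_ext (gen_act (card D) Q1 i) v) w =
      linear_ext (gen_act n P i) (bilinear_ext (glue n D) v w)"
    and "i \<in> {1..<n - card D} \<Longrightarrow> bilinear_ext (glue n D) v (linear_ext (gen_act (n - card D) Q2 i) w) =
      linear_ext (gen_act n P (card D + i)) (bilinear_ext (glue n D) v w)"
proof -
  assume i: "i \<in> {1..<card D}"
  have "bilinear_ext (glue n D) (linear_ext (gen_act (card D) Q1 i) v) w =
      linear_ext (\<lambda>\<sigma>. linear_ext (\<lambda>\<tau>. bilinear_ext (glue n D) (gen_act (card D) Q1 i \<sigma>) (basis \<tau>)) w) v"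
    by (simp only: bilinear_ext_linear_left bilinear_ext_expand(2)[of _ _ w, symmetric])
  also have "\<dots> = linear_ext (\<lambda>\<sigma>. linear_ext (\<lambda>\<tau>. gen_act n P i (glue n D \<sigma> \<tau>)) w) v"
    using v w i by (intro linear_ext_cong glue_gen_act(1)) auto
  finally show "bilinear_ext (glue n D) (linear_ext (gen_act (card D) Q1 i) v) w =
      linear_ext (gen_act n P i) (bilinear_ext (glue n D) v w)"
    by (simp only: linear_ext_bilinear)
next
  assume i: "i \<in> {1..<n - card D}"
  have "bilinear_ext (glue n D) v (linear_ext (gen_act (n - card D) Q2 i) w) =
      linear_ext (\<lambda>\<sigma>. linear_ext (\<lambda>\<tau>. bilinear_ext (glue n D) (basis \<sigma>) (gen_act (n - card D) Q2 i \<tau>)) w) v"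
    by (simp only: bilinear_ext_linear_right bilinear_ext_expand(1)[of _ v] linear_ext_swap[of _ w v])
  also have "\<dots> = linear_ext (\<lambda>\<sigma>. linear_ext (\<lambda>\<tau>. gen_act n P (card D + i) (glue n D \<sigma> \<tau>)) w) v"
    using v w i by (intro linear_ext_cong glue_gen_act(2)) auto
  finally show "bilinear_ext (glue n D) v (linear_ext (gen_act (n - card D) Q2 i) w) =
      linear_ext (gen_act n P (card D + i)) (bilinear_ext (glue n D) v w)"
    by (simp only: linear_ext_bilinear)
qed

lemma keys_gen_act_linear:
  "Poly_Mapping.keys v \<subseteq> Sigma_R k R \<Longrightarrow> Poly_Mapping.keys (linear_ext (gen_act k R i) v) \<subseteq> Sigma_R k R"
  by (intro keys_linear_ext gen_act_keys) auto

lemma glue_word_act: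
  assumes "Poly_Mapping.keys v \<subseteq> S1" and "Poly_Mapping.keys w \<subseteq> S2"
  shows "u \<in> word_set (card D) \<Longrightarrow> bilinear_ext (glue n D) (word_act (card D) Q1 v u) w =
      word_act n P (bilinear_ext (glue n D) v w) u"
    and "u \<in> word_set (n - card D) \<Longrightarrow> bilinear_ext (glue n D) v (word_act (n - card D) Q2 w u) =
      word_act n P (bilinear_ext (glue n D) v w) (map ((+) (card D)) u)"
proof -
  show "u \<in> word_set (card D) \<Longrightarrow> bilinear_ext (glue n D) (word_act (card D) Q1 v u) w =
      word_act n P (bilinear_ext (glue n D) v w) u"
    using assms(1)
  proof (induction u arbitrary: v)
    case (Cons i u)
    then have "i \<in> {1..<card D}" by simp
    from glue_gen_act_linear(1)[OF Cons.prems(2) assms(2) this] show ?case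
      using Cons by (simp add: keys_gen_act_linear)
  qed simp
  show "u \<in> word_set (n - card D) \<Longrightarrow> bilinear_ext (glue n D) v (word_act (n - card D) Q2 w u) =
      word_act n P (bilinear_ext (glue n D) v w) (map ((+) (card D)) u)"
    using assms(2)
  proof (induction u arbitrary: w)
    case (Cons i u)
    then have "i \<in> {1..<n - card D}" by simp
    from glue_gen_act_linear(2)[OF assms(1) Cons.prems(2) this] show ?case
      using Cons by (simp add: keys_gen_act_linear)
  qed simp
qed

text \<open>Gluing intertwines the tensor action with the action through the embedding:
  \<open>f\<close> moves the left part, then the shifted \<open>g\<close> moves the right part, and
  concatenation acts by composition.\<close>

lemma glue_act:
  assumes v: "Poly_Mapping.keys v \<subseteq> S1" and w: "Poly_Mapping.keys w \<subseteq> S2"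
    and f: "Poly_Mapping.keys f \<subseteq> word_set (card D)" and g: "Poly_Mapping.keys g \<subseteq> word_set (n - card D)"
  shows "bilinear_ext (glue n D) (linear_ext (word_act (card D) Q1 v) f) (linear_ext (word_act (n - card D) Q2 w) g) =
    linear_ext (word_act n P (bilinear_ext (glue n D) v w)) (bilinear_ext (@) f (shift (card D) g))"
proof -
  let ?v = "linear_ext (word_act (card D) Q1 v) f"
  have v': "Poly_Mapping.keys ?v \<subseteq> S1"
    using word_act_keys[OF v] by (rule keys_linear_ext)
  have left: "bilinear_ext (glue n D) ?v w = linear_ext (word_act n P (bilinear_ext (glue n D) v w)) f"
    unfolding bilinear_ext_linear_left
    using f by (intro linear_ext_cong glue_word_act v w) auto
  have "bilinear_ext (glue n D) ?v (linear_ext (word_act (n - card D) Q2 w) g) =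
      linear_ext (\<lambda>u. word_act n P (bilinear_ext (glue n D) ?v w) (map ((+) (card D)) u)) g"
    unfolding bilinear_ext_linear_right
    using g by (intro linear_ext_cong glue_word_act v' w) auto
  also have "\<dots> = linear_ext (word_act n P (bilinear_ext (glue n D) ?v w)) (shift (card D) g)"
    by (simp add: shift_def linear_ext_comp)
  finally show ?thesis
    unfolding left word_act_mult .
qed

end

section \<open>Splitting and merging modulo the bilinearity relations\<close>

text \<open>In the free vector space on pairs, (v, w) is itself a generator. Expanding first in
  \<open>v\<close>, then in \<open>w\<close> expresses it modulo the relations through pairs of
  basis vectors.\<close>

lemma bilinear_span_expand:
  fixes a b :: nat and A B :: "nat rel"
  defines "S \<equiv> bilinear_span (poset_module a A) (poset_module b B)"
  assumes v: "Poly_Mapping.keys v \<subseteq> Sigma_R a A" and w: "Poly_Mapping.keys w \<subseteq> Sigma_R b B"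
  shows "basis (v, w) - bilinear_ext (\<lambda>\<sigma> \<tau>. (basis \<sigma>, basis \<tau>)) v w \<in> S"
proof -
  note mods = module_poset_module[of a A] module_poset_module[of b B]
  have S: "pm.subspace S"
    unfolding S_def using mods by (rule subspace_bilinear_span)
  note rel = bilinear_span_relations[OF mods, folded S_def, unfolded poset_module_simps mem_Collect_eq]
  \<comment> \<open>The scalar relation with c = 0 provides the start of the induction.\<close>
  have zero: "basis (0, u) \<in> S" if "Poly_Mapping.keys u \<subseteq> Sigma_R b B" for u
    using rel(3)[of 0 u 0] that by simp
  have zero': "basis (u, 0) \<in> S" if "Poly_Mapping.keys u \<subseteq> Sigma_R a A" for u
    using rel(4)[of u 0 0] that by simp
  have left: "basis (\<Sum>\<sigma>\<in>T. pm_scale (c \<sigma>) (basis \<sigma>), u) - (\<Sum>\<sigma>\<in>T. pm_scale (c \<sigma>) (basis (basis \<sigma>, u))) \<in> S"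
    if "finite T" "T \<subseteq> Sigma_R a A" "Poly_Mapping.keys u \<subseteq> Sigma_R b B" for T c u
    using that(1,2)
  proof (induction T rule: finite_induct)
    case empty
    then show ?case using that(3) by (simp add: zero)
  next
    case (insert x T)
    let ?p = "pm_scale (c x) (basis x)" and ?q = "\<Sum>\<sigma>\<in>T. pm_scale (c \<sigma>) (basis \<sigma>)"
    have "Poly_Mapping.keys ?q \<subseteq> Sigma_R a A"
      using insert.prems by (intro order.trans[OF keys_sum_subset]) auto
    moreover have "Poly_Mapping.keys (basis x) \<subseteq> Sigma_R a A"
      using insert.prems by simp
    moreover from this have "Poly_Mapping.keys ?p \<subseteq> Sigma_R a A"
      by (rule keys_closed(4))
    \<comment> \<open>The sum telescopes to the claim for the larger set: an additivity relation
      splits off one summand, a scalar relation treats it, and the rest is the induction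
      hypothesis.\<close>
    ultimately have "(basis (?p + ?q, u) - basis (?p, u) - basis (?q, u)) +
        (basis (?p, u) - pm_scale (c x) (basis (basis x, u))) +
        (basis (?q, u) - (\<Sum>\<sigma>\<in>T. pm_scale (c \<sigma>) (basis (basis \<sigma>, u)))) \<in> S"
      using insert that(3) by (intro pm.subspace_add[OF S] rel) auto
    with insert.hyps show ?case
      by (simp add: algebra_simps del: pm_scale_single)
  qed
  have right: "basis (u, \<Sum>\<sigma>\<in>T. pm_scale (c \<sigma>) (basis \<sigma>)) - (\<Sum>\<sigma>\<in>T. pm_scale (c \<sigma>) (basis (u, basis \<sigma>))) \<in> S"
    if "finite T" "T \<subseteq> Sigma_R b B" "Poly_Mapping.keys u \<subseteq> Sigma_R a A" for T c u
    using that(1,2)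
  proof (induction T rule: finite_induct)
    case empty
    then show ?case using that(3) by (simp add: zero')
  next
    case (insert x T)
    let ?p = "pm_scale (c x) (basis x)" and ?q = "\<Sum>\<sigma>\<in>T. pm_scale (c \<sigma>) (basis \<sigma>)"
    have "Poly_Mapping.keys ?q \<subseteq> Sigma_R b B"
      using insert.prems by (intro order.trans[OF keys_sum_subset]) auto
    moreover have "Poly_Mapping.keys (basis x) \<subseteq> Sigma_R b B"
      using insert.prems by simp
    moreover from this have "Poly_Mapping.keys ?p \<subseteq> Sigma_R b B"
      by (rule keys_closed(4))
    ultimately have "(basis (u, ?p + ?q) - basis (u, ?p) - basis (u, ?q)) +
        (basis (u, ?p) - pm_scale (c x) (basis (u, basis x))) +
        (basis (u, ?q) - (\<Sum>\<sigma>\<in>T. pm_scale (c \<sigma>) (basis (u, basis \<sigma>)))) \<in> S"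
      using insert that(3) by (intro pm.subspace_add[OF S] rel) auto
    with insert.hyps show ?case
      by (simp add: algebra_simps del: pm_scale_single)
  qed
  have "basis (v, w) - linear_ext (\<lambda>\<sigma>. basis (basis \<sigma>, w)) v \<in> S"
    using left[OF finite_keys v w, of "Poly_Mapping.lookup v"]
    by (simp add: linear_ext_def[symmetric] del: pm_scale_single)
  moreover have "basis (basis \<sigma>, w) - linear_ext (\<lambda>\<tau>. basis (basis \<sigma>, basis \<tau>)) w \<in> S"
    if "\<sigma> \<in> Sigma_R a A" for \<sigma>
    using right[OF finite_keys w, of "basis \<sigma>" "Poly_Mapping.lookup w"] that
    by (simp add: linear_ext_def[symmetric] del: pm_scale_single)
  then have "linear_ext (\<lambda>\<sigma>. basis (basis \<sigma>, w) - linear_ext (\<lambda>\<tau>. basis (basis \<sigma>, basis \<tau>)) w) v \<in> S"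
    using v by (intro linear_ext_in_subspace S) auto
  ultimately have "(basis (v, w) - linear_ext (\<lambda>\<sigma>. basis (basis \<sigma>, w)) v) +
      linear_ext (\<lambda>\<sigma>. basis (basis \<sigma>, w) - linear_ext (\<lambda>\<tau>. basis (basis \<sigma>, basis \<tau>)) w) v \<in> S"
    by (rule pm.subspace_add[OF S])
  then show ?thesis
    by (simp add: bilinear_ext_conv linear_ext_fun_diff)
qed

context lower_subset
begin

abbreviation S where "S \<equiv> bilinear_span V1 V2"

lemma subspace_S: "pm.subspace S"
  by (intro subspace_bilinear_span module_poset_module)

text \<open>The value is a representative of \<sigma> \<otimes> \<tau> in the free vector space on
  pairs. The default 0 makes the map defined on the whole poset module; \<open>inv_into\<close> is
  meaningful since gluing is a bijection onto the linear extensions mapping the first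
  \<open>card D\<close> positions onto D.\<close>

definition split_basis where
  "split_basis \<gamma> = (if \<gamma> ` {1..card D} = D
     then basis (map_prod basis basis (inv_into (S1 \<times> S2) (\<lambda>(\<sigma>, \<tau>). glue n D \<sigma> \<tau>) \<gamma>)) else 0)"

text \<open>Defined on representatives; it descends to the tensor product by
  \<open>merge_bilinear_span\<close>.\<close>

definition merge where
  "merge = linear_ext (\<lambda>(v, w). bilinear_ext (glue n D) v w)"

lemma split_basis_glue:
  assumes "\<sigma> \<in> S1" "\<tau> \<in> S2"
  shows "split_basis (glue n D \<sigma> \<tau>) = basis (basis \<sigma>, basis \<tau>)"
proof -
  have "inj_on (\<lambda>(\<sigma>, \<tau>). glue n D \<sigma> \<tau>) (S1 \<times> S2)"
    using glue_inject Sigma_R_permutes by (auto intro!: inj_onI) metis+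
  then have "inv_into (S1 \<times> S2) (\<lambda>(\<sigma>, \<tau>). glue n D \<sigma> \<tau>) (case (\<sigma>, \<tau>) of (\<sigma>, \<tau>) \<Rightarrow> glue n D \<sigma> \<tau>) = (\<sigma>, \<tau>)"
    using assms by (intro inv_into_f_f) auto
  then show ?thesis
    using glue_image[OF Sigma_R_permutes[OF assms(1)] Sigma_R_permutes[OF assms(2)]]
    by (simp add: split_basis_def)
qed

text \<open>Both standardizations exist: as \<gamma> maps the first \<open>card D\<close> positions
  onto D, it maps the remaining ones onto the complement.\<close>

lemma glue_surj:
  assumes \<gamma>: "\<gamma> \<in> Sigma_R n P" and D: "\<gamma> ` {1..card D} = D"
  shows "\<exists>\<sigma>\<in>S1. \<exists>\<tau>\<in>S2. \<gamma> = glue n D \<sigma> \<tau>"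
proof -
  note perm = Sigma_R_permutes[OF \<gamma>]
  have "\<gamma> ` {1..n} = {1..n}" using permutes_image[OF perm] .
  moreover have "{1..n} - {1..card D} = {card D + 1..card D + card E}"
    unfolding card_E using card_le by auto
  ultimately have "\<gamma> ` {card D + 1..card D + card E} = E"
    using D image_set_diff[OF permutes_inj[OF perm], of "{1..n}" "{1..card D}"] by simp
  then have "bij_betw \<gamma> {0 + 1..0 + card D} D" "bij_betw \<gamma> {card D + 1..card D + card E} E"
    using D permutes_inj_on[OF perm] by (simp_all add: bij_betw_def)
  then obtain \<sigma> \<tau> where arr: "arranges \<gamma> 0 D \<sigma>" "arranges \<gamma> (card D) E \<tau>"
    using arranges_exists finite_D finite_Diff[OF finite_atLeastAtMost] by metis
  then have eq: "\<gamma> = glue n D \<sigma> \<tau>"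
    using permutes_not_in[OF perm] by (intro glue_unique)
  have "\<sigma> permutes {1..card D}" "\<tau> permutes {1..n - card D}"
    using arrangesD(2)[OF arr(1)] arrangesD(2)[OF arr(2)] unfolding card_E .
  with eq \<gamma> show ?thesis
    using glue_Sigma_R_iff by blast
qed

lemma split_basis_keys:
  assumes "\<gamma> \<in> Sigma_R n P"
  shows "Poly_Mapping.keys (split_basis \<gamma>) \<subseteq> carrier V1 \<times> carrier V2"
proof (cases "\<gamma> ` {1..card D} = D")
  case True
  then obtain \<sigma> \<tau> where "\<sigma> \<in> S1" "\<tau> \<in> S2" "\<gamma> = glue n D \<sigma> \<tau>"
    using glue_surj[OF assms] by blast
  then show ?thesis
    by (simp add: split_basis_glue poset_module_simps)
qed (simp add: split_basis_def)

text \<open>Only modulo the relations: splitting returns pairs of basis vectors, while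
  \<open>f\<close> may involve arbitrary pairs of vectors.\<close>

lemma split_merge:
  assumes f: "Poly_Mapping.keys f \<subseteq> carrier V1 \<times> carrier V2"
  shows "f - linear_ext split_basis (merge f) \<in> S"
proof -
  have "basis (v, w) - linear_ext split_basis (bilinear_ext (glue n D) v w) \<in> S"
    if vw: "Poly_Mapping.keys v \<subseteq> S1" "Poly_Mapping.keys w \<subseteq> S2" for v w
  proof -
    have "linear_ext split_basis (bilinear_ext (glue n D) v w) =
        linear_ext (\<lambda>\<sigma>. linear_ext (\<lambda>\<tau>. basis (basis \<sigma>, basis \<tau>)) w) v"
      unfolding linear_ext_bilinear using vw
      by (intro linear_ext_cong split_basis_glue) auto
    then show ?thesis
      using bilinear_span_expand[OF vw] by (simp add: bilinear_ext_conv)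
  qed
  then have "linear_ext (\<lambda>x. basis x - linear_ext split_basis (case x of (v, w) \<Rightarrow> bilinear_ext (glue n D) v w)) f \<in> S"
    using f by (intro linear_ext_in_subspace subspace_S) (auto simp: poset_module_simps)
  then show ?thesis
    by (simp add: linear_ext_fun_diff merge_def linear_ext_comp)
qed

lemma merge_bilinear_span:
  assumes "f \<in> S"
  shows "merge f = 0"
proof -
  have "merge f \<in> {0}"
    unfolding merge_def
    by (rule bilinear_span_linear_ext[OF module_poset_module module_poset_module _ _ _ _ _ assms])
      (simp_all add: poset_module_simps bilinear_ext_add_left bilinear_ext_add_right
        bilinear_ext_scale_left bilinear_ext_scale_right)
  then show ?thesis by simp
qed

lemma keys_glue:
  assumes "Poly_Mapping.keys v \<subseteq> S1" "Poly_Mapping.keys w \<subseteq> S2"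
  shows "Poly_Mapping.keys (bilinear_ext (glue n D) v w) \<subseteq> Sigma_R n P"
  using assms by (intro keys_bilinear_ext glue_Sigma_R) auto

lemma keys_merge:
  assumes "Poly_Mapping.keys f \<subseteq> carrier V1 \<times> carrier V2"
  shows "Poly_Mapping.keys (merge f) \<subseteq> Sigma_R n P"
  unfolding merge_def
proof (rule keys_linear_ext)
  fix x assume "x \<in> Poly_Mapping.keys f"
  with assms obtain v w where "x = (v, w)" "Poly_Mapping.keys v \<subseteq> S1" "Poly_Mapping.keys w \<subseteq> S2"
    unfolding poset_module_simps by blast
  then show "Poly_Mapping.keys (case x of (v, w) \<Rightarrow> bilinear_ext (glue n D) v w) \<subseteq> Sigma_R n P"
    using keys_glue by simp
qed

text \<open>A permutation glued at \<open>D'\<close> maps the first positions onto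
  \<open>D'\<close>; equal cardinality makes these the positions that \<open>split_basis\<close>
  inspects.\<close>

lemma split_glue_other:
  assumes D': "lower_subset n D' P" "card D' = card D" "D' \<noteq> D"
    and v: "Poly_Mapping.keys v \<subseteq> Sigma_R (card D') (standardize (Restr P D'))"
    and w: "Poly_Mapping.keys w \<subseteq> Sigma_R (n - card D') (standardize (Restr P ({1..n} - D')))"
  shows "linear_ext split_basis (bilinear_ext (glue n D') v w) = 0"
proof -
  interpret D': lower_subset n D' P by fact
  have "linear_ext split_basis (bilinear_ext (glue n D') v w) = linear_ext (\<lambda>\<sigma>. linear_ext (\<lambda>\<tau>. 0) w) v"
    unfolding linear_ext_bilinear
  proof (intro linear_ext_cong)
    fix \<sigma> \<tau> assume "\<sigma> \<in> Poly_Mapping.keys v" "\<tau> \<in> Poly_Mapping.keys w"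
    then have "\<sigma> permutes {1..card D'}" "\<tau> permutes {1..n - card D'}"
      using v w by (auto intro!: Sigma_R_permutes simp del: One_nat_def)
    from D'.glue_image[OF this] D'(2,3) show "split_basis (glue n D' \<sigma> \<tau>) = 0"
      by (simp add: split_basis_def)
  qed
  then show ?thesis by simp
qed

lemma split_merge_other:
  assumes D': "lower_subset n D' P" "card D' = card D" "D' \<noteq> D"
    and f: "Poly_Mapping.keys f \<subseteq> carrier (poset_module (card D') (standardize (Restr P D'))) \<times>
      carrier (poset_module (n - card D') (standardize (Restr P ({1..n} - D'))))"
  shows "linear_ext split_basis (linear_ext (\<lambda>(v, w). bilinear_ext (glue n D') v w) f) = 0"
proof -
  have "linear_ext (\<lambda>x. linear_ext split_basis (case x of (v, w) \<Rightarrow> bilinear_ext (glue n D') v w)) f =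
      linear_ext (\<lambda>x. 0) f"
  proof (rule linear_ext_cong)
    fix x assume "x \<in> Poly_Mapping.keys f"
    with f obtain v w where "x = (v, w)" "Poly_Mapping.keys v \<subseteq> Sigma_R (card D') (standardize (Restr P D'))"
      "Poly_Mapping.keys w \<subseteq> Sigma_R (n - card D') (standardize (Restr P ({1..n} - D')))"
      unfolding poset_module_simps by blast
    then show "linear_ext split_basis (case x of (v, w) \<Rightarrow> bilinear_ext (glue n D') v w) = 0"
      using split_glue_other[OF D'] by simp
  qed
  then show ?thesis by (simp add: linear_ext_comp)
qed

text \<open>Exact rather than modulo relations: for \<gamma> belonging to D splitting is undone by
  gluing, and every other \<gamma> is killed.\<close>

lemma merge_split:
  assumes u: "Poly_Mapping.keys u \<subseteq> Sigma_R n P"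
  shows "merge (linear_ext split_basis u) = linear_ext (\<lambda>\<gamma>. if \<gamma> ` {1..card D} = D then basis \<gamma> else 0) u"
  unfolding merge_def linear_ext_comp
proof (rule linear_ext_cong)
  fix \<gamma> assume "\<gamma> \<in> Poly_Mapping.keys u"
  with u have \<gamma>: "\<gamma> \<in> Sigma_R n P" by blast
  show "linear_ext (\<lambda>(v, w). bilinear_ext (glue n D) v w) (split_basis \<gamma>) =
      (if \<gamma> ` {1..card D} = D then basis \<gamma> else 0)"
  proof (cases "\<gamma> ` {1..card D} = D")
    case True
    then obtain \<sigma> \<tau> where "\<sigma> \<in> S1" "\<tau> \<in> S2" "\<gamma> = glue n D \<sigma> \<tau>"
      using glue_surj[OF \<gamma>] by blast
    with True show ?thesis by (simp add: split_basis_glue)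
  qed (simp add: split_basis_def)
qed

end

text \<open>Whatever lies below \<gamma>(a) in P occurs at an earlier position, so initial segments
  of linear extensions are lower sets. Hence each basis vector is seen by some summand.\<close>

lemma lower_subset_image:
  assumes order: "partial_order_on {1..n} P" and "m \<le> n" and \<gamma>: "\<gamma> \<in> Sigma_R n P"
  shows "lower_subset n (\<gamma> ` {1..m}) P" "card (\<gamma> ` {1..m}) = m"
proof -
  note perm = Sigma_R_permutes[OF \<gamma>]
  show "card (\<gamma> ` {1..m}) = m"
    using card_image[OF permutes_inj_on[OF perm], of "{1..m}"] by simp
  show "lower_subset n (\<gamma> ` {1..m}) P"
  proof
    show "\<gamma> ` {1..m} \<subseteq> {1..n}"
      using image_mono[of "{1..m}" "{1..n}" \<gamma>] \<open>m \<le> n\<close> permutes_image[OF perm] by simp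
    show "y \<in> \<gamma> ` {1..m}" if x: "x \<in> \<gamma> ` {1..m}" and yx: "(y, x) \<in> P" for x y
    proof -
      obtain a where a: "x = \<gamma> a" "a \<in> {1..m}" using x by blast
      obtain b where b: "y = \<gamma> b" "b \<in> {1..n}"
        using partial_order_onD(4)[OF order] yx permutes_image[OF perm] by blast
      have "b < a" if "b \<noteq> a"
        using \<gamma> yx a b that unfolding Sigma_R_iff by blast
      with a b show ?thesis by (cases "b = a") auto
    qed
  qed (rule order)
qed

section \<open>Compatibility of splitting with the action\<close>

context lower_subset
begin

text \<open>The basis vector \<gamma> is glued at its own lower set \<open>D'\<close>, and acting
  keeps it in the span of permutations glued at \<open>D'\<close>. Splitting at D therefore recovers
  the tensor action modulo the relations if \<open>D' = D\<close>, and annihilates both sides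
  otherwise.\<close>

lemma split_act_basis:
  assumes \<gamma>: "\<gamma> \<in> Sigma_R n P" and p: "p \<in> carrier (hecke (card D)) \<times> carrier (hecke (n - card D))"
  shows "linear_ext split_basis (linear_ext (word_act n P (basis \<gamma>)) (embed_rep (card D) p)) -
    linear_ext (\<lambda>x. basis (pair_act (ract V1) (ract V2) x p)) (split_basis \<gamma>) \<in> S"
proof -
  define D' where "D' = \<gamma> ` {1..card D}"
  have D': "lower_subset n D' P" "card D' = card D"
    unfolding D'_def using lower_subset_image[OF order card_le \<gamma>] by auto
  interpret D': lower_subset n D' P by (rule D')
  obtain \<sigma> \<tau> where \<sigma>: "\<sigma> \<in> D'.S1" and \<tau>: "\<tau> \<in> D'.S2" and \<gamma>_eq: "\<gamma> = glue n D' \<sigma> \<tau>"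
    using D'.glue_surj[OF \<gamma>] D'(2) unfolding D'_def by auto
  obtain a b where ab: "p = (a, b)" "a \<in> carrier (hecke (card D'))" "b \<in> carrier (hecke (n - card D'))"
    using p unfolding D'(2) by blast
  define x where "x = basis \<sigma> \<cdot>\<^bsub>D'.V1\<^esub> a"
  define y where "y = basis \<tau> \<cdot>\<^bsub>D'.V2\<^esub> b"
  have keys: "Poly_Mapping.keys (basis \<sigma>) \<subseteq> D'.S1" "Poly_Mapping.keys (basis \<tau>) \<subseteq> D'.S2"
    using \<sigma> \<tau> by auto
  have x: "x = linear_ext (word_act (card D') D'.Q1 (basis \<sigma>)) (hecke_rep a)"
    unfolding x_def using poset_module_ract[OF keys(1)] hecke_rep(1)[OF ab(2)] by metis
  have y: "y = linear_ext (word_act (n - card D') D'.Q2 (basis \<tau>)) (hecke_rep b)"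
    unfolding y_def using poset_module_ract[OF keys(2)] hecke_rep(1)[OF ab(3)] by metis
  have xy: "Poly_Mapping.keys x \<subseteq> D'.S1" "Poly_Mapping.keys y \<subseteq> D'.S2"
    unfolding x y by (rule keys_linear_ext, rule word_act_keys[OF keys(1)])
      (rule keys_linear_ext, rule word_act_keys[OF keys(2)])
  have act: "linear_ext (word_act n P (basis \<gamma>)) (embed_rep (card D) p) = bilinear_ext (glue n D') x y"
    using D'.glue_act[OF keys hecke_rep(2)[OF ab(2)] hecke_rep(2)[OF ab(3)]]
    by (simp add: x y embed_rep_def ab(1) \<gamma>_eq D'(2))
  show ?thesis
  proof (cases "D' = D")
    case True
    \<comment> \<open>\<open>merge\<close> sends the generator (x, y) to the glued vector, so
      \<open>split_merge\<close> compares the splitting of that vector with (x, y) itself.\<close>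
    have "basis (x, y) - linear_ext split_basis (merge (basis (x, y))) \<in> S"
      using xy unfolding True by (intro split_merge) (simp add: poset_module_simps)
    moreover have "linear_ext (\<lambda>x. basis (pair_act (ract V1) (ract V2) x p)) (split_basis \<gamma>) = basis (x, y)"
      using split_basis_glue[of \<sigma> \<tau>] \<sigma> \<tau> unfolding True x_def y_def \<gamma>_eq by (simp add: ab(1))
    ultimately have "- (linear_ext split_basis (bilinear_ext (glue n D') x y) -
        linear_ext (\<lambda>x. basis (pair_act (ract V1) (ract V2) x p)) (split_basis \<gamma>)) \<in> S"
      by (simp add: merge_def True)
    then show ?thesis
      unfolding act using pm.subspace_neg[OF subspace_S] by fastforce
  next
    case False
    then have "split_basis \<gamma> = 0"
      by (simp add: split_basis_def D'_def)
    then show ?thesis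
      unfolding act split_glue_other[OF D' False xy] using pm.subspace_0[OF subspace_S] by simp
  qed
qed

text \<open>Both sides are iterated linear extensions over \<open>g\<close> and \<open>v\<close>, so
  their difference is a combination of the differences in \<open>split_act_basis\<close>.\<close>

lemma split_act:
  assumes v: "Poly_Mapping.keys v \<subseteq> Sigma_R n P"
    and g: "Poly_Mapping.keys g \<subseteq> carrier (hecke (card D)) \<times> carrier (hecke (n - card D))"
  shows "linear_ext split_basis (linear_ext (word_act n P v) (linear_ext (embed_rep (card D)) g)) -
    bilinear_ext (pair_act (ract V1) (ract V2)) (linear_ext split_basis v) g \<in> S"
proof -
  let ?f = "\<lambda>p \<gamma>. linear_ext split_basis (linear_ext (word_act n P (basis \<gamma>)) (embed_rep (card D) p))"
  let ?h = "\<lambda>p \<gamma>. linear_ext (\<lambda>x. basis (pair_act (ract V1) (ract V2) x p)) (split_basis \<gamma>)"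
  have "linear_ext (\<lambda>p. linear_ext (\<lambda>\<gamma>. ?f p \<gamma> - ?h p \<gamma>) v) g \<in> S"
    using v g by (intro linear_ext_in_subspace subspace_S split_act_basis) auto
  moreover have "linear_ext split_basis (linear_ext (word_act n P v) (linear_ext (embed_rep (card D)) g)) =
      linear_ext (\<lambda>p. linear_ext (?f p) v) g"
    unfolding linear_ext_comp[of "word_act n P v"] linear_ext_word_act[of n P v] linear_ext_comp ..
  moreover have "bilinear_ext (pair_act (ract V1) (ract V2)) (linear_ext split_basis v) g =
      linear_ext (\<lambda>p. linear_ext (?h p) v) g"
    unfolding bilinear_ext_conv' linear_ext_comp ..
  ultimately show ?thesis
    by (simp add: linear_ext_fun_diff)
qed

end

section \<open>Assembling the isomorphism\<close>

text \<open>The summands are indexed by subposets, the splitting maps by sets. \<open>Field\<close>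
  recovers the set from a restriction because P is reflexive.\<close>

lemma lower_subposets_facts:
  assumes order: "partial_order_on {1..n} P" and Q: "Q \<in> lower_subposets P m"
  shows "lower_subset n (Field Q) P" "card (Field Q) = m" "Restr P (Field Q) = Q"
    "Restr P ({1..n} - Field Q) = poset_diff P Q"
proof -
  have P: "Field P = {1..n}"
    using partial_order_onD(1,4)[OF order] by (auto simp: Field_def refl_on_def)
  from Q obtain D where D: "Q = Restr P D" "D \<subseteq> {1..n}" "card D = m"
    "\<And>x y. x \<in> D \<Longrightarrow> (y, x) \<in> P \<Longrightarrow> y \<in> D"
    unfolding lower_subposets_def P by blast
  interpret lower_subset n D P
    by unfold_locales (use D order in auto)
  have "Field Q = D"
    unfolding D(1) by (rule Field_D)
  then show "lower_subset n (Field Q) P" "card (Field Q) = m" "Restr P (Field Q) = Q"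
    "Restr P ({1..n} - Field Q) = poset_diff P Q"
    using D(1,3) lower_subset_axioms by (simp_all add: poset_diff_def P)
qed

lemma Restr_lower_subposets:
  assumes order: "partial_order_on {1..n} P" and D: "lower_subset n D P"
  shows "Restr P D \<in> lower_subposets P (card D)" "Field (Restr P D) = D"
proof -
  interpret lower_subset n D P by (rule D)
  have P: "Field P = {1..n}"
    using partial_order_onD(1,4)[OF order] by (auto simp: Field_def refl_on_def)
  show "Restr P D \<in> lower_subposets P (card D)"
    unfolding lower_subposets_def P using subset lower by blast
  show "Field (Restr P D) = D"
    by (rule Field_D)
qed

theorem lemma3p3:
  fixes n m :: nat and P :: "nat rel"
  assumes "partial_order_on {1..n} P" and "0 \<le> m" and "m \<le> n"
  shows "right_module_iso (tensor (hecke m) (hecke (n - m)))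
           (restrict_module (hecke_embed n m) (poset_module n P))
           (direct_sum_module (lower_subposets P m)
             (\<lambda>Q. tensor_module (poset_module m (standardize Q))
                                (poset_module (n - m) (standardize (poset_diff P Q)))))"
proof -
  note order = assms(1) and m = assms(3)
  let ?L = "lower_subposets P m"
  define M1 where "M1 Q = poset_module m (standardize Q)" for Q
  define M2 where "M2 Q = poset_module (n - m) (standardize (poset_diff P Q))" for Q
  define K where "K Q = bilinear_span (M1 Q) (M2 Q)" for Q
  define split where "split Q = linear_ext (lower_subset.split_basis n (Field Q) P)" for Q
  define merge where "merge Q = lower_subset.merge n (Field Q)" for Q
  let ?H = "tensor (hecke m) (hecke (n - m))"
  let ?I = "bilinear_span (hecke m) (hecke (n - m))"
  let ?M = "restrict_module (hecke_embed n m) (poset_module n P)"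
  let ?N = "direct_sum_module ?L (\<lambda>Q. tensor_module (M1 Q) (M2 Q))"
  let ?\<phi> = "\<lambda>v. \<lambda>Q\<in>?L. coset (K Q) (split Q v)"
  note facts = lower_subposets_facts[OF order]

  \<comment> \<open>Finiteness gives the support condition of the direct sum and allows surjectivity
    to sum over all summands.\<close>
  have finite: "finite ?L"
  proof (rule finite_subset)
    show "?L \<subseteq> Restr P ` Pow (Field P)"
      unfolding lower_subposets_def by blast
    show "finite (Restr P ` Pow (Field P))"
      using finite_subset[OF partial_order_onD(4)[OF order]] by (simp add: finite_Field)
  qed
  have K: "pm.subspace (K Q)" for Q
    unfolding K_def M1_def M2_def by (intro subspace_bilinear_span module_poset_module)
  \<comment> \<open>Here and below facts of \<open>lower_subset\<close> are restated for Q: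
    \<open>facts\<close> replaces \<open>card (Field Q)\<close> by m and the two restrictions of P
    by Q and \<open>poset_diff P Q\<close>.\<close>
  have split_keys: "Poly_Mapping.keys (split Q v) \<subseteq> carrier (M1 Q) \<times> carrier (M2 Q)"
    if "Q \<in> ?L" "Poly_Mapping.keys v \<subseteq> Sigma_R n P" for Q v
    unfolding split_def
    using lower_subset.split_basis_keys[OF facts(1)[OF that(1)], unfolded facts(2-4)[OF that(1)],
        folded M1_def M2_def] that(2)
    by (intro keys_linear_ext) blast
  have split_merge: "f - split Q (merge Q f) \<in> K Q"
    if "Q \<in> ?L" "Poly_Mapping.keys f \<subseteq> carrier (M1 Q) \<times> carrier (M2 Q)" for Q f
    unfolding split_def merge_def
    by (rule lower_subset.split_merge[OF facts(1)[OF that(1)], unfolded facts(2-4)[OF that(1)],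
        folded M1_def M2_def, folded K_def, OF that(2)])
  have keys_merge: "Poly_Mapping.keys (merge Q f) \<subseteq> Sigma_R n P"
    if "Q \<in> ?L" "Poly_Mapping.keys f \<subseteq> carrier (M1 Q) \<times> carrier (M2 Q)" for Q f
    unfolding merge_def
    by (rule lower_subset.keys_merge[OF facts(1)[OF that(1)], unfolded facts(2-4)[OF that(1)],
        folded M1_def M2_def, OF that(2)])
  have merge_K: "merge Q f = 0" if "Q \<in> ?L" "f \<in> K Q" for Q f
    unfolding merge_def
    by (rule lower_subset.merge_bilinear_span[OF facts(1)[OF that(1)], unfolded facts(2-4)[OF that(1)],
        folded M1_def M2_def, folded K_def, OF that(2)])
  have merge_split: "merge Q (split Q u) = linear_ext (\<lambda>\<gamma>. if \<gamma> ` {1..m} = Field Q then basis \<gamma> else 0) u"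
    if "Q \<in> ?L" "Poly_Mapping.keys u \<subseteq> Sigma_R n P" for Q u
    unfolding merge_def split_def
    by (rule lower_subset.merge_split[OF facts(1)[OF that(1)], unfolded facts(2)[OF that(1)], OF that(2)])
  have split_merge_other: "split Q (merge Q' f) = 0"
    if "Q \<in> ?L" "Q' \<in> ?L" "Q' \<noteq> Q" "Poly_Mapping.keys f \<subseteq> carrier (M1 Q') \<times> carrier (M2 Q')" for Q Q' f
  proof -
    \<comment> \<open>Distinct subposets have distinct underlying sets, each being the restriction
      of P to its \<open>Field\<close>.\<close>
    have "Field Q' \<noteq> Field Q"
      using facts(3)[OF that(1)] facts(3)[OF that(2)] that(3) by metis
    then show ?thesis
      unfolding split_def merge_def lower_subset.merge_def[OF facts(1)[OF that(2)]]
      by (rule lower_subset.split_merge_other[OF facts(1)[OF that(1)] facts(1)[OF that(2)],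
            unfolded facts(2)[OF that(1)] facts(2-4)[OF that(2)], folded M1_def M2_def, OF refl _ that(4)])
  qed
  have split_act: "split Q (linear_ext (word_act n P v) (linear_ext (embed_rep m) g)) -
      bilinear_ext (pair_act (ract (M1 Q)) (ract (M2 Q))) (split Q v) g \<in> K Q"
    if "Q \<in> ?L" "Poly_Mapping.keys v \<subseteq> Sigma_R n P"
      "Poly_Mapping.keys g \<subseteq> carrier (hecke m) \<times> carrier (hecke (n - m))" for Q v g
    unfolding split_def
    by (rule lower_subset.split_act[OF facts(1)[OF that(1)], unfolded facts(2-4)[OF that(1)],
        folded M1_def M2_def, folded K_def, OF that(2,3)])
  have split_linear: "split Q 0 = 0" "split Q (v + w) = split Q v + split Q w"
    "split Q (v - w) = split Q v - split Q w" "split Q (pm_scale c v) = pm_scale c (split Q v)" for Q v w c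
    by (simp_all add: split_def linear_ext_add linear_ext_diff linear_ext_scale)

  have modules: "right_module (hecke m) (M1 Q)" "right_module (hecke (n - m)) (M2 Q)" for Q
    unfolding M1_def M2_def by (rule right_module_poset_module)+
  have N: "right_module ?H ?N"
    by (intro right_module_direct_sum complex_algebra_tensor complex_algebra_hecke right_module_tensor modules)
  have M_simps: "carrier ?M = {v. Poly_Mapping.keys v \<subseteq> Sigma_R n P}" "\<zero>\<^bsub>?M\<^esub> = 0"
    "v \<oplus>\<^bsub>?M\<^esub> w = v + w" "c \<odot>\<^bsub>?M\<^esub> v = pm_scale c v" for v w c
    by (simp_all add: restrict_module_def poset_module_simps)
  have M_ract: "v \<cdot>\<^bsub>?M\<^esub> coset ?I g = linear_ext (word_act n P v) (linear_ext (embed_rep m) g)"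
    if "Poly_Mapping.keys v \<subseteq> Sigma_R n P"
      "Poly_Mapping.keys g \<subseteq> carrier (hecke m) \<times> carrier (hecke (n - m))" for v g
    by (simp add: restrict_module_def hecke_embed_coset[OF m that(2)] poset_module_ract[OF that(1)])
  have H_carrier: "\<exists>g. a = coset ?I g \<and> Poly_Mapping.keys g \<subseteq> carrier (hecke m) \<times> carrier (hecke (n - m))"
    if "a \<in> carrier ?H" for a
    using that by (auto simp: tensor_def quotient_algebra_simps)
  have T_carrier: "carrier (tensor_module (M1 Q) (M2 Q)) =
      coset (K Q) ` {f. Poly_Mapping.keys f \<subseteq> carrier (M1 Q) \<times> carrier (M2 Q)}" for Q
    by (simp add: tensor_module_simps tensor_def quotient_algebra_simps K_def)
  have T_simps: "\<zero>\<^bsub>tensor_module (M1 Q) (M2 Q)\<^esub> = coset (K Q) 0"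
    "coset (K Q) f \<oplus>\<^bsub>tensor_module (M1 Q) (M2 Q)\<^esub> coset (K Q) g = coset (K Q) (f + g)"
    "c \<odot>\<^bsub>tensor_module (M1 Q) (M2 Q)\<^esub> coset (K Q) f = coset (K Q) (pm_scale c f)" for Q f g c
    using quotient_algebra_add[OF K[of Q]] quotient_algebra_smult[OF K[of Q]]
    by (simp_all add: tensor_module_simps tensor_def quotient_algebra_simps flip: K_def)
  have \<phi>_carrier: "?\<phi> v \<in> carrier ?N" if "v \<in> carrier ?M" for v
    using that finite split_keys by (auto simp: direct_sum_module_simps T_carrier M_simps)

  have inj: "v = w" if "v \<in> carrier ?M" "w \<in> carrier ?M" "?\<phi> v = ?\<phi> w" for v w
  proof -
    let ?u = "v - w"
    have u: "Poly_Mapping.keys ?u \<subseteq> Sigma_R n P"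
      using that(1,2) by (simp add: M_simps keys_closed)
    have "Poly_Mapping.lookup ?u \<gamma> = 0" if \<gamma>: "\<gamma> \<in> Sigma_R n P" for \<gamma>
    proof -
      \<comment> \<open>The summand that sees \<gamma>: its lower set is the initial segment of
        \<gamma>.\<close>
      define Q where "Q = Restr P (\<gamma> ` {1..m})"
      note D = lower_subset_image[OF order m \<gamma>]
      have Q: "Q \<in> ?L" "\<gamma> ` {1..m} = Field Q"
        unfolding Q_def using Restr_lower_subposets[OF order D(1)] D(2) by simp_all
      have "coset (K Q) (split Q v) = coset (K Q) (split Q w)"
        using fun_cong[OF \<open>?\<phi> v = ?\<phi> w\<close>, of Q] Q(1) by simp
      then have "split Q ?u \<in> K Q"
        by (simp add: coset_eq_iff[OF K] split_linear)
      \<comment> \<open>Merging turns vanishing modulo \<open>K Q\<close> into an exact equation,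
        whose coefficient at \<gamma> is that of \<open>?u\<close>.\<close>
      then have "linear_ext (\<lambda>\<gamma>. if \<gamma> ` {1..m} = Field Q then basis \<gamma> else 0) ?u = 0"
        using merge_K[OF Q(1)] merge_split[OF Q(1) u] by simp
      then show ?thesis
        using Q(2) lookup_linear_ext_filter[of "\<lambda>\<gamma>. \<gamma> ` {1..m} = Field Q" ?u \<gamma>] by simp
    qed
    then have "?u = 0"
      using u by (intro poly_mapping_eqI) (metis lookup_zero in_keys_iff subsetD)
    then show ?thesis by simp
  qed

  have surj: "\<exists>v\<in>carrier ?M. ?\<phi> v = F" if F: "F \<in> carrier ?N" for F
  proof -
    have "\<forall>Q\<in>?L. \<exists>f. F Q = coset (K Q) f \<and> Poly_Mapping.keys f \<subseteq> carrier (M1 Q) \<times> carrier (M2 Q)"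
    proof
      fix Q assume "Q \<in> ?L"
      with F have "F Q \<in> carrier (tensor_module (M1 Q) (M2 Q))"
        by (auto simp: direct_sum_module_simps)
      then show "\<exists>f. F Q = coset (K Q) f \<and> Poly_Mapping.keys f \<subseteq> carrier (M1 Q) \<times> carrier (M2 Q)"
        unfolding T_carrier by blast
    qed
    then obtain f where f: "\<And>Q. Q \<in> ?L \<Longrightarrow> F Q = coset (K Q) (f Q)"
      "\<And>Q. Q \<in> ?L \<Longrightarrow> Poly_Mapping.keys (f Q) \<subseteq> carrier (M1 Q) \<times> carrier (M2 Q)"
      by metis
    \<comment> \<open>All components are glued and added up; splitting at Q then retains only the
      component of Q.\<close>
    define v where "v = (\<Sum>Q\<in>?L. merge Q (f Q))"
    have "Poly_Mapping.keys v \<subseteq> Sigma_R n P"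
      unfolding v_def by (intro order.trans[OF keys_sum_subset] UN_least keys_merge f(2))
    moreover have "?\<phi> v Q = F Q" for Q
    proof (cases "Q \<in> ?L")
      case True
      have "split Q v = (\<Sum>Q'\<in>?L. split Q (merge Q' (f Q')))"
        by (simp add: split_def v_def linear_ext_sum)
      also have "\<dots> = (\<Sum>Q'\<in>?L. if Q' = Q then split Q (merge Q (f Q)) else 0)"
        using split_merge_other[OF True] f(2) by (intro sum.cong) auto
      also have "\<dots> = split Q (merge Q (f Q))"
        using finite True by simp
      finally have "coset (K Q) (f Q) = coset (K Q) (split Q v)"
        using split_merge[OF True f(2)[OF True]] by (simp add: coset_eq_iff[OF K])
      then show ?thesis
        using True f(1) by simp
    next
      \<comment> \<open>Both functions take the value \<open>undefined\<close> outside the index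
        set.\<close>
      case False
      then show ?thesis using F by (auto simp: direct_sum_module_simps PiE_iff extensional_def)
    qed
    ultimately show ?thesis
      by (intro bexI[of _ v]) (auto simp: M_simps)
  qed

  have "right_module_iso ?H ?M ?N"
  proof (rule right_module_isoI[OF N, where \<phi> = ?\<phi>])
    show "bij_betw ?\<phi> (carrier ?M) (carrier ?N)"
      unfolding bij_betw_def
    proof
      show "inj_on ?\<phi> (carrier ?M)"
        by (rule inj_onI) (rule inj)
      show "?\<phi> ` carrier ?M = carrier ?N"
      proof
        show "?\<phi> ` carrier ?M \<subseteq> carrier ?N"
          using \<phi>_carrier by blast
        show "carrier ?N \<subseteq> ?\<phi> ` carrier ?M"
          using surj by blast
      qed
    qed
    show "\<zero>\<^bsub>?M\<^esub> \<in> carrier ?M" "?\<phi> \<zero>\<^bsub>?M\<^esub> = \<zero>\<^bsub>?N\<^esub>"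
      by (simp_all add: M_simps direct_sum_module_simps T_simps split_linear)
    fix v assume "v \<in> carrier ?M"
    then have v: "Poly_Mapping.keys v \<subseteq> Sigma_R n P" by (simp add: M_simps)
    show "v \<oplus>\<^bsub>?M\<^esub> w \<in> carrier ?M" "?\<phi> (v \<oplus>\<^bsub>?M\<^esub> w) = ?\<phi> v \<oplus>\<^bsub>?N\<^esub> ?\<phi> w"
      if "w \<in> carrier ?M" for w
      using v that
      by (simp add: M_simps keys_closed)
        (simp add: M_simps direct_sum_module_simps T_simps split_linear cong: restrict_cong)
    show "c \<odot>\<^bsub>?M\<^esub> v \<in> carrier ?M" "?\<phi> (c \<odot>\<^bsub>?M\<^esub> v) = c \<odot>\<^bsub>?N\<^esub> ?\<phi> v" for c
      using v by (simp add: M_simps keys_closed)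
        (simp add: M_simps direct_sum_module_simps T_simps split_linear cong: restrict_cong)
    fix a assume "a \<in> carrier ?H"
    then obtain g where a: "a = coset ?I g"
      and g: "Poly_Mapping.keys g \<subseteq> carrier (hecke m) \<times> carrier (hecke (n - m))"
      using H_carrier by blast
    show "v \<cdot>\<^bsub>?M\<^esub> a \<in> carrier ?M"
      using word_act_keys[OF v] by (simp add: a M_ract[OF v g] M_simps keys_linear_ext)
    \<comment> \<open>Both sides are cosets, and their representatives are the two elements compared
      by \<open>split_act\<close>.\<close>
    have "coset (K Q) (split Q (v \<cdot>\<^bsub>?M\<^esub> a)) =
        coset (K Q) (split Q v) \<cdot>\<^bsub>tensor_module (M1 Q) (M2 Q)\<^esub> a" if Q: "Q \<in> ?L" for Q
      using tensor_module_ract[OF modules split_keys[OF Q v] g, folded K_def] split_act[OF Q v g]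
      by (simp add: a M_ract[OF v g] coset_eq_iff[OF K])
    then show "?\<phi> (v \<cdot>\<^bsub>?M\<^esub> a) = ?\<phi> v \<cdot>\<^bsub>?N\<^esub> a"
      by (simp add: direct_sum_module_simps cong: restrict_cong)
  qed
  then show ?thesis
    unfolding M1_def M2_def .
qed

end
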